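(* Let $d\ge 3$ be a fixed integer and $p=p(q)\in[0,1]$. As the prime power $q\to\infty$, asymptotically almost surely \[ \alpha(\mathbb{F}_q^d,p)= \begin{cases} \Theta(pq^d), & q^{-d+o(1)} \le p\le q^{-d+\frac{1}{d}-o(1)},\\ q^{\frac{1}{d}+o(1)}, & q^{-d+\frac{1}{d}-o(1)}\le p\le q^{-d+\frac{2}{d}+o(1)},\\ \Theta(pq), & q^{-\frac{1}{d+1}+o(1)}\le p\le 1. \end{cases} \] In addition, when $q^{-d+\frac{2}{d}+o(1)}\le p\le q^{-\frac{1}{d+1}+o(1)}$, asymptotically almost surely \[ \max\left\{q^{\frac{1}{d}-o(1)},~\Omega(pq)\right\}\le \alpha(\mathbb{F}^d_q,p)\le \min\left\{p^{\frac{1}{2}}q^{\frac{d}{2}+o(1)},~q^{\frac{d}{d+1}+o(1)}\right\}. \] Moreover, all $q^{o(1)}$ factors here are polylogarithmic in $q$.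
   Context: $\mathbb{F}_q$ is the finite field with $q$ elements ($q$ a prime power). A hyperplane in $\mathbb{F}_q^d$ is a $(d-1)$-dimensional affine subspace; a point set $P\subset\mathbb{F}_q^d$ is in general position if no $d+1$ points of $P$ lie in a common hyperplane. A $p$-random set $\mathbf{S}_p\subset\mathbb{F}_q^d$ contains each point of $\mathbb{F}_q^d$ independently with probability $p$. $\alpha(\mathbb{F}_q^d,p)$ denotes the maximum size of a general position set contained in $\mathbf{S}_p$. A sequence of events holds asymptotically almost surely if its probability tends to $1$ as $q\to\infty$. Asymptotic notation is with respect to $q\to\infty$. *)

theory Defs
  imports
    "HOL-Probability.Probability"
    "HOL-Algebra.AbelCoset"
    "HOL-Algebra.Module"
    "HOL-Number_Theory.Number_Theory"
    "HOL-Library.Landau_Symbols"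
begin

section \<open>Coordinate space and affine subspaces\<close>

text \<open>
  The space \<open>R^d\<close> consists of functions that are \<open>undefined\<close> outside \<open>{..<d}\<close>.
  The fields \<open>mult\<close> and \<open>one\<close> of the module record play no role.
\<close>

definition coord_space :: "('a, 'b) ring_scheme \<Rightarrow> nat \<Rightarrow> ('a, nat \<Rightarrow> 'a) module" where
  "coord_space R d =
    \<lparr>carrier = {..<d} \<rightarrow>\<^sub>E carrier R,
     mult = (\<lambda>x y. undefined),
     one = undefined,
     zero = (\<lambda>i\<in>{..<d}. \<zero>\<^bsub>R\<^esub>),
     add = (\<lambda>x y. \<lambda>i\<in>{..<d}. x i \<oplus>\<^bsub>R\<^esub> y i),
     smult = (\<lambda>a x. \<lambda>i\<in>{..<d}. a \<otimes>\<^bsub>R\<^esub> x i)\<rparr>"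

lemma coord_space_simps [simp]:
  "carrier (coord_space R d) = {..<d} \<rightarrow>\<^sub>E carrier R"
  "\<zero>\<^bsub>coord_space R d\<^esub> = (\<lambda>i\<in>{..<d}. \<zero>\<^bsub>R\<^esub>)"
  "x \<oplus>\<^bsub>coord_space R d\<^esub> y = (\<lambda>i\<in>{..<d}. x i \<oplus>\<^bsub>R\<^esub> y i)"
  "a \<odot>\<^bsub>coord_space R d\<^esub> x = (\<lambda>i\<in>{..<d}. a \<otimes>\<^bsub>R\<^esub> x i)"
  by (simp_all add: coord_space_def)

lemma (in cring) module_coord_space: "module R (coord_space R d)"
proof (rule moduleI)
  show "cring R" ..
  show "abelian_group (coord_space R d)"
  proof (rule abelian_groupI)
    fix x assume x: "x \<in> carrier (coord_space R d)"
    have "(\<lambda>i\<in>{..<d}. \<ominus> x i) \<in> carrier (coord_space R d)"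
      using x by (auto simp: PiE_iff)
    moreover have "(\<lambda>i\<in>{..<d}. \<ominus> x i) \<oplus>\<^bsub>coord_space R d\<^esub> x = \<zero>\<^bsub>coord_space R d\<^esub>"
      using x by (auto simp: PiE_iff l_neg intro!: restrict_ext)
    ultimately show "\<exists>y\<in>carrier (coord_space R d).
        y \<oplus>\<^bsub>coord_space R d\<^esub> x = \<zero>\<^bsub>coord_space R d\<^esub>" by blast
  qed (auto simp: PiE_iff a_assoc intro!: extensionalityI[where A = "{..<d}"] a_comm)
qed (auto simp: PiE_iff l_distr r_distr m_assoc intro!: extensionalityI[where A = "{..<d}"])

definition is_basis :: "('a, 'b) ring_scheme \<Rightarrow> ('a, 'v) module \<Rightarrow> 'v set \<Rightarrow> 'v set \<Rightarrow> bool" where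
  "is_basis R M W B \<longleftrightarrow>
     finite B \<and> B \<subseteq> carrier M \<and>
     (\<forall>c \<in> B \<rightarrow> carrier R. (\<Oplus>\<^bsub>M\<^esub>b\<in>B. c b \<odot>\<^bsub>M\<^esub> b) = \<zero>\<^bsub>M\<^esub> \<longrightarrow> (\<forall>b\<in>B. c b = \<zero>\<^bsub>R\<^esub>)) \<and>
     W = {(\<Oplus>\<^bsub>M\<^esub>b\<in>B. c b \<odot>\<^bsub>M\<^esub> b) | c. c \<in> B \<rightarrow> carrier R}"

definition affine_subspace ::
  "('a, 'b) ring_scheme \<Rightarrow> ('a, 'v) module \<Rightarrow> nat \<Rightarrow> 'v set \<Rightarrow> bool" where
  "affine_subspace R M k H \<longleftrightarrow>
     (\<exists>x \<in> carrier M. \<exists>W B. submodule W R M \<and> is_basis R M W B \<and> card B = k \<and> H = x <+\<^bsub>M\<^esub> W)"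

section \<open>General position\<close>

text \<open>Only used for \<open>d \<ge> 1\<close>; the subtraction truncates for \<open>d = 0\<close>.\<close>

definition hyperplane :: "('a, 'b) ring_scheme \<Rightarrow> nat \<Rightarrow> (nat \<Rightarrow> 'a) set \<Rightarrow> bool" where
  "hyperplane R d H \<longleftrightarrow> affine_subspace R (coord_space R d) (d - 1) H"

definition general_position :: "('a, 'b) ring_scheme \<Rightarrow> nat \<Rightarrow> (nat \<Rightarrow> 'a) set \<Rightarrow> bool" where
  "general_position R d P \<longleftrightarrow>
     P \<subseteq> carrier (coord_space R d) \<and>
     \<not> (\<exists>H A. hyperplane R d H \<and> A \<subseteq> P \<and> card A = d + 1 \<and> A \<subseteq> H)"

definition max_general_position :: "('a, 'b) ring_scheme \<Rightarrow> nat \<Rightarrow> (nat \<Rightarrow> 'a) set \<Rightarrow> nat" where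
  "max_general_position R d S = Max {card P | P. P \<subseteq> S \<and> general_position R d P}"

section \<open>Random sets\<close>

definition random_subset :: "'v set \<Rightarrow> real \<Rightarrow> 'v set pmf" where
  "random_subset V p =
     map_pmf (\<lambda>f. {x \<in> V. f x}) (Pi_pmf V False (\<lambda>_. bernoulli_pmf p))"

text \<open>The random variable \<open>\<alpha>(R^d, p)\<close>, given by its distribution.\<close>

definition alpha :: "('a, 'b) ring_scheme \<Rightarrow> nat \<Rightarrow> real \<Rightarrow> nat pmf" where
  "alpha R d p = map_pmf (max_general_position R d) (random_subset (carrier (coord_space R d)) p)"

section \<open>Asymptotics along the prime powers\<close>

definition prime_powers :: "nat filter" where
  "prime_powers = inf at_top (principal {q. primepow q})"

definition asymptotically_almost_surely :: "(nat \<Rightarrow> 'x pmf) \<Rightarrow> (nat \<Rightarrow> 'x \<Rightarrow> bool) \<Rightarrow> bool" where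
  "asymptotically_almost_surely X E \<longleftrightarrow>
     ((\<lambda>q. measure_pmf.prob (X q) {x. E q x}) \<longlongrightarrow> 1) prime_powers"

text \<open>
  An exponent \<open>e = o(1)\<close>, of either sign, for which the factor \<open>q^e\<close> is polylogarithmic in \<open>q\<close>,
  i.e. is bounded above, and below by the reciprocal of, a power of \<open>ln q\<close>.
\<close>

definition polylog_exponent :: "(nat \<Rightarrow> real) \<Rightarrow> bool" where
  "polylog_exponent e \<longleftrightarrow>
     e \<in> o[prime_powers](\<lambda>_. 1) \<and>
     (\<exists>K. (\<lambda>q. real q powr e q) \<in> O[prime_powers](\<lambda>q. ln (real q) powr K) \<and>
          (\<lambda>q. real q powr (- e q)) \<in> O[prime_powers](\<lambda>q. ln (real q) powr K))"

end

theory Submission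
  imports
    Defs
    "HOL-Algebra.Multiplicative_Group"
    "HOL-Real_Asymp.Real_Asymp"
begin

text \<open>
  The lower bounds come from deleting one point of every affinely dependent \<open>(d + 1)\<close>-subset of the
  random set, from monotonicity in \<open>p\<close>, and from intersecting the random set with the moment curve.

  The upper bounds are first moment bounds, for which the general position sets \<open>I\<close> of size \<open>m\<close> have to
  be counted. Fix a subset \<open>X \<subseteq> I\<close> of size about \<open>m / ln q\<close> and join two points by an edge if they lie
  in a common hyperplane with some \<open>d - 1\<close> points of \<open>X\<close>. Then \<open>I - X\<close> is an independent set of this
  graph, and the Kleitman--Winston argument bounds the number of independent sets once every large set
  \<open>B\<close> of points spans many edges. The hyperplanes through \<open>d - 1\<close> points of \<open>X\<close> form a pencil of
  \<open>q + 1\<close> members, so each choice of these points gives at least about \<open>|B|\<^sup>2 / q\<close> pairs of points of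
  \<open>B\<close>. Since \<open>X\<close> is in general position, a pair arises from at most \<open>O(|X|\<^sup>d\<^sup>-\<^sup>2)\<close> choices, which
  yields \<open>\<Omega>(|X| |B|\<^sup>2 / q)\<close> edges and the bound \<open>O(p q)\<close>. For large \<open>B\<close> a second moment estimate of the
  multiplicities does better and yields the bound \<open>p\<^sup>1\<^sup>/\<^sup>2 q\<^sup>d\<^sup>/\<^sup>2\<close>, up to logarithms.
\<close>

section \<open>Affine functionals on a finite coordinate space\<close>

text \<open>Once hyperplanes are translated, rank and dimension no longer appear. The number
  \<open>card (ann A)\<close> of affine functionals vanishing on \<open>A\<close> is a power of
  \<open>q\<close> that records the codimension of \<open>A\<close>, so linear algebra turns into
  counting. The trivial count \<open>q ^ d choose m\<close> is far too large for a first moment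
  bound: it has to be replaced by something like \<open>N choose m\<close> with \<open>N p\<close>
  small against \<open>m\<close>. The price is the choice of \<open>X\<close> and of the vertices
  picked in the Kleitman-Winston process. With about \<open>m / ln q\<close> of each, this costs
  only \<open>exp (m / 2)\<close>, which explains the logarithm in the size of \<open>X\<close>. So
  \<open>N\<close> is the size above which the graph is dense enough. Bounding multiplicities by
  their maximum allows \<open>N = 4 * q\<close>. The second moment allows \<open>N\<close> of order
  \<open>q ^ d * (ln q) ^ 3 / m\<close>, and \<open>N p\<close> below \<open>m\<close> then becomes
  a lower bound on the square of \<open>m\<close>. All estimates concern one \<open>q\<close> and
  have explicit failure probabilities, uniform in \<open>p\<close>; limits are taken only at the
  end.\<close>

locale finite_affine_space = field R for R (structure) +
  fixes d :: nat
  assumes finite_carrier: "finite (carrier R)"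
begin

definition V where "V = {..<d} \<rightarrow>\<^sub>E carrier R"

definition \<Phi> where "\<Phi> = {..d} \<rightarrow>\<^sub>E carrier R"

abbreviation "q \<equiv> card (carrier R)"

definition lin :: "(nat \<Rightarrow> 'a) \<Rightarrow> (nat \<Rightarrow> 'a) \<Rightarrow> 'a" where
  "lin a x = (\<Oplus>i\<in>{..<d}. a i \<otimes> x i)"

definition aev :: "(nat \<Rightarrow> 'a) \<Rightarrow> (nat \<Rightarrow> 'a) \<Rightarrow> 'a" where
  "aev a x = a d \<oplus> lin a x"

definition zero_functional :: "nat \<Rightarrow> 'a" where
  "zero_functional = (\<lambda>i\<in>{..d}. \<zero>)"

text \<open>Stands in for rank: for a set of points its size is \<open>q\<close> to the power
  \<open>d + 1\<close> minus the affine rank, so independence can be tested by counting.\<close>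

definition ann :: "(nat \<Rightarrow> 'a) set \<Rightarrow> (nat \<Rightarrow> 'a) set" where
  "ann A = {a \<in> \<Phi>. \<forall>x\<in>A. aev a x = \<zero>}"

text \<open>The affine hull, encoded as a double annihilator so that combinations of points never
  have to be handled.\<close>

definition cl :: "(nat \<Rightarrow> 'a) set \<Rightarrow> (nat \<Rightarrow> 'a) set" where
  "cl A = {x \<in> V. \<forall>a\<in>ann A. aev a x = \<zero>}"

definition comb :: "'a \<Rightarrow> (nat \<Rightarrow> 'a) \<Rightarrow> (nat \<Rightarrow> 'a) \<Rightarrow> nat \<Rightarrow> 'a" where
  "comb t a b = (\<lambda>i\<in>{..d}. t \<otimes> a i \<oplus> b i)"

lemma functional_closed: "a \<in> \<Phi> \<Longrightarrow> i \<le> d \<Longrightarrow> a i \<in> carrier R"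
  unfolding \<Phi>_def using PiE_mem by fastforce

lemma point_closed: "x \<in> V \<Longrightarrow> i < d \<Longrightarrow> x i \<in> carrier R"
  unfolding V_def using PiE_mem by fastforce

lemma functional_eqI: "a \<in> \<Phi> \<Longrightarrow> b \<in> \<Phi> \<Longrightarrow> (\<And>i. i \<le> d \<Longrightarrow> a i = b i) \<Longrightarrow> a = b"
  unfolding \<Phi>_def by (rule PiE_ext) auto

lemma point_eqI: "x \<in> V \<Longrightarrow> y \<in> V \<Longrightarrow> (\<And>i. i < d \<Longrightarrow> x i = y i) \<Longrightarrow> x = y"
  unfolding V_def by (rule PiE_ext) auto

lemma lin_closed [simp, intro]: "a \<in> \<Phi> \<Longrightarrow> x \<in> V \<Longrightarrow> lin a x \<in> carrier R"
  unfolding lin_def by (intro finsum_closed) (auto simp: functional_closed point_closed)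

lemma aev_closed [simp, intro]: "a \<in> \<Phi> \<Longrightarrow> x \<in> V \<Longrightarrow> aev a x \<in> carrier R"
  unfolding aev_def by (simp add: functional_closed)

lemma comb_closed [simp, intro]: "t \<in> carrier R \<Longrightarrow> a \<in> \<Phi> \<Longrightarrow> b \<in> \<Phi> \<Longrightarrow> comb t a b \<in> \<Phi>"
  unfolding comb_def using functional_closed by (simp add: \<Phi>_def restrict_PiE_iff)

lemma zero_functional_closed [simp, intro]: "zero_functional \<in> \<Phi>"
  unfolding zero_functional_def \<Phi>_def by auto

lemma lin_comb:
  assumes "t \<in> carrier R" "a \<in> \<Phi>" "b \<in> \<Phi>" "x \<in> V"
  shows "lin (comb t a b) x = t \<otimes> lin a x \<oplus> lin b x"
proof -
  note [simp] = functional_closed[OF assms(2)] functional_closed[OF assms(3)] point_closed[OF assms(4)]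
  have "lin (comb t a b) x = (\<Oplus>i\<in>{..<d}. t \<otimes> (a i \<otimes> x i) \<oplus> b i \<otimes> x i)"
    unfolding lin_def
    using assms(1) by (intro finsum_cong') (simp_all add: comb_def l_distr m_assoc Pi_iff)
  also have "\<dots> = (\<Oplus>i\<in>{..<d}. t \<otimes> (a i \<otimes> x i)) \<oplus> lin b x"
    unfolding lin_def using assms(1) by (intro finsum_addf) (simp_all add: Pi_iff)
  also have "(\<Oplus>i\<in>{..<d}. t \<otimes> (a i \<otimes> x i)) = t \<otimes> lin a x"
    unfolding lin_def using assms(1) by (intro finsum_rdistr[symmetric]) (simp_all add: Pi_iff)
  finally show ?thesis .
qed

lemma aev_comb:
  assumes "t \<in> carrier R" "a \<in> \<Phi>" "b \<in> \<Phi>" "x \<in> V"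
  shows "aev (comb t a b) x = t \<otimes> aev a x \<oplus> aev b x"
proof -
  have "comb t a b d = t \<otimes> a d \<oplus> b d"
    by (simp add: comb_def)
  moreover have "a d \<in> carrier R" "b d \<in> carrier R" "lin a x \<in> carrier R" "lin b x \<in> carrier R"
    using assms by (auto simp: functional_closed)
  ultimately show ?thesis
    unfolding aev_def lin_comb[OF assms] using assms(1)
    by (simp add: r_distr a_ac)
qed

lemma lin_zero [simp]: "x \<in> V \<Longrightarrow> lin zero_functional x = \<zero>"
  unfolding lin_def zero_functional_def by (intro add.finprod_one_eqI) (auto simp: point_closed)

lemma aev_zero [simp]: "x \<in> V \<Longrightarrow> aev zero_functional x = \<zero>"
  unfolding aev_def by (simp) (simp add: zero_functional_def)

lemma finite_V [simp, intro]: "finite V" and finite_\<Phi> [simp, intro]: "finite \<Phi>"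
  unfolding V_def \<Phi>_def using finite_carrier by (auto intro: finite_PiE)

lemma card_V: "card V = q ^ d" and card_\<Phi>: "card \<Phi> = q ^ Suc d"
  by (simp_all add: V_def \<Phi>_def card_PiE)

lemma q_ge_2: "q \<ge> 2"
proof -
  have "card {\<zero>, \<one>} \<le> q" using finite_carrier by (intro card_mono) auto
  thus ?thesis by simp
qed

lemma finite_ann [simp, intro]: "finite (ann A)"
  unfolding ann_def by (rule finite_subset[OF _ finite_\<Phi>]) auto

lemma ann_antimono: "A \<subseteq> B \<Longrightarrow> ann B \<subseteq> ann A"
  unfolding ann_def by auto

lemma ann_subset: "ann A \<subseteq> \<Phi>"
  unfolding ann_def by auto

lemma ann_insert: "ann (insert x A) = {a \<in> ann A. aev a x = \<zero>}"
  unfolding ann_def by auto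

lemma zero_in_ann [simp, intro]: "A \<subseteq> V \<Longrightarrow> zero_functional \<in> ann A"
  unfolding ann_def by auto

lemma comb_in_ann:
  "A \<subseteq> V \<Longrightarrow> t \<in> carrier R \<Longrightarrow> a \<in> ann A \<Longrightarrow> b \<in> ann A \<Longrightarrow> comb t a b \<in> ann A"
  unfolding ann_def by (auto simp: aev_comb subset_iff)

lemma card_ann_pos: "A \<subseteq> V \<Longrightarrow> card (ann A) > 0"
  using zero_in_ann card_gt_0_iff by (metis empty_iff finite_ann)

lemma cl_subset: "cl A \<subseteq> V"
  unfolding cl_def by auto

lemma cl_mono: "A \<subseteq> B \<Longrightarrow> cl A \<subseteq> cl B"
  unfolding cl_def using ann_antimono by blast

lemma subset_cl: "A \<subseteq> V \<Longrightarrow> A \<subseteq> cl A"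
  unfolding cl_def ann_def by auto

lemma ann_insert_cl: "x \<in> cl A \<Longrightarrow> ann (insert x A) = ann A"
  unfolding ann_insert unfolding cl_def by auto

text \<open>Outside the closure, evaluation at \<open>x\<close> is a nonzero linear form on
  \<open>ann A\<close>. A functional \<open>a0\<close> on which it does not vanish splits
  \<open>ann A\<close> into the multiples of \<open>a0\<close> and the kernel
  \<open>ann (insert x A)\<close>.\<close>

lemma card_ann_insert:
  assumes A: "A \<subseteq> V" and x: "x \<in> V" "x \<notin> cl A"
  shows "card (ann A) = q * card (ann (insert x A))"
proof -
  obtain a0 where a0: "a0 \<in> ann A" "aev a0 x \<noteq> \<zero>"
    using x unfolding cl_def by auto
  have a0': "a0 \<in> \<Phi>" using a0 ann_subset by auto
  have c: "aev a0 x \<in> carrier R" using a0' x(1) by (rule aev_closed)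
  let ?f = "\<lambda>(t, a). comb t a0 a"
  have sub: "a \<in> \<Phi>" "aev a x = \<zero>" if "a \<in> ann (insert x A)" for a
    using that by (auto simp: ann_def)
  have "bij_betw ?f (carrier R \<times> ann (insert x A)) (ann A)"
    unfolding bij_betw_def
  proof
    show "inj_on ?f (carrier R \<times> ann (insert x A))"
    proof (rule inj_onI, clarify)
      fix t a s b
      assume t: "t \<in> carrier R" "s \<in> carrier R"
        and a: "a \<in> ann (insert x A)" "b \<in> ann (insert x A)"
        and eq: "comb t a0 a = comb s a0 b"
      have "aev (comb t a0 a) x = t \<otimes> aev a0 x" "aev (comb s a0 b) x = s \<otimes> aev a0 x"
        using t x a0' c sub[OF a(1)] sub[OF a(2)] by (simp_all add: aev_comb)
      hence "t \<otimes> aev a0 x = s \<otimes> aev a0 x" using eq by simp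
      hence ts: "t = s" using t c a0(2) m_rcancel by metis
      have "a i = b i" if "i \<le> d" for i
      proof -
        have "t \<otimes> a0 i \<oplus> a i = t \<otimes> a0 i \<oplus> b i"
          using fun_cong[OF eq, of i] that ts by (simp add: comb_def)
        moreover have "t \<otimes> a0 i \<in> carrier R" "a i \<in> carrier R" "b i \<in> carrier R"
          using a0' t sub[OF a(1)] sub[OF a(2)] that by (simp_all add: functional_closed)
        ultimately show ?thesis by simp
      qed
      hence "a = b" using sub(1)[OF a(1)] sub(1)[OF a(2)]
        by (intro functional_eqI) auto
      thus "t = s \<and> a = b" using ts by simp
    qed
    show "?f ` (carrier R \<times> ann (insert x A)) = ann A"
    proof (intro equalityI subsetI)
      fix b assume "b \<in> ?f ` (carrier R \<times> ann (insert x A))"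
      then obtain t a where ta: "t \<in> carrier R" "a \<in> ann (insert x A)" "b = comb t a0 a" by auto
      have "a \<in> ann A" using ta ann_antimono[of A "insert x A"] by auto
      thus "b \<in> ann A" using comb_in_ann[OF A ta(1) a0(1)] ta by auto
    next
      fix b assume b: "b \<in> ann A"
      have b': "b \<in> \<Phi>" using b ann_subset by auto
      \<comment> \<open>The multiple of \<open>a0\<close> with the same value at \<open>x\<close> as
        \<open>b\<close>; the difference falls into the kernel.\<close>
      define t where "t = aev b x \<otimes> inv (aev a0 x)"
      have t: "t \<in> carrier R" unfolding t_def using b' x a0(2) c by (simp add: field_Units)
      have tt: "t \<otimes> aev a0 x = aev b x" unfolding t_def using b' x a0(2) c
        by (simp add: m_assoc field_Units)
      define a where "a = comb (\<ominus> t) a0 b"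
      have a: "a \<in> ann A" unfolding a_def by (rule comb_in_ann) (use A t a0 b in auto)
      have "aev a x = \<zero>" unfolding a_def
        using t a0' b' x c tt by (simp add: aev_comb l_minus l_neg)
      hence aa: "a \<in> ann (insert x A)" using a by (simp add: ann_insert)
      have "comb t a0 a = b"
      proof (rule functional_eqI)
        show "comb t a0 a \<in> \<Phi>" by (rule comb_closed[OF t a0' subsetD[OF ann_subset a]])
        show "b \<in> \<Phi>" by (rule b')
        fix i assume i: "i \<le> d"
        have *: "a0 i \<in> carrier R" "b i \<in> carrier R" using i a0' b' by (auto simp: functional_closed)
        have "comb t a0 a i = t \<otimes> a0 i \<oplus> (\<ominus> t \<otimes> a0 i \<oplus> b i)"
          using i by (simp add: comb_def a_def)
        also have "\<dots> = b i" using * t by (simp add: l_minus r_neg2)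
        finally show "comb t a0 a i = b i" .
      qed
      thus "b \<in> ?f ` (carrier R \<times> ann (insert x A))" using aa t
        by (intro image_eqI[of _ _ "(t, a)"]) auto
    qed
  qed
  from bij_betw_same_card[OF this] show ?thesis by (simp add: card_cartesian_product)
qed

lemma card_ann_le: 
  assumes A: "A \<subseteq> V" and x: "x \<in> V"
  shows "card (ann A) \<le> q * card (ann (insert x A))"
proof (cases "x \<in> cl A")
  case True
  thus ?thesis using ann_insert_cl[OF True] q_ge_2 by simp
next
  case False
  thus ?thesis using card_ann_insert[OF A x] by simp
qed

lemma ann_empty: "ann {} = \<Phi>"
  unfolding ann_def by auto

lemma card_ann_power:
  assumes "finite A" "A \<subseteq> V"
  shows "\<exists>r. card (ann A) = q ^ r"
  using assms
proof (induction A rule: finite_induct)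
  case empty
  thus ?case by (auto simp: ann_empty card_\<Phi> simp del: power_Suc)
next
  case (insert x A)
  then obtain r where r: "card (ann A) = q ^ r" by auto
  show ?case
  proof (cases "x \<in> cl A")
    case True
    thus ?thesis using ann_insert_cl r by auto
  next
    case False
    hence *: "q ^ r = q * card (ann (insert x A))" using card_ann_insert insert r by auto
    show ?thesis
    proof (cases r)
      case 0
      with * q_ge_2 show ?thesis by (auto simp: )
    next
      case (Suc s)
      with * q_ge_2 have "card (ann (insert x A)) = q ^ s" by auto
      thus ?thesis by blast
    qed
  qed
qed

text \<open>Each point imposes at most one linear condition and so costs at most a factor
  \<open>q\<close>.\<close>

lemma card_ann_ge:
  assumes "finite A" "A \<subseteq> V"
  shows "q ^ Suc d \<le> q ^ card A * card (ann A)"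
  using assms
proof (induction A rule: finite_induct)
  case empty
  thus ?case by (auto simp: ann_empty card_\<Phi>)
next
  case (insert x A)
  have "q ^ Suc d \<le> q ^ card A * card (ann A)" using insert by auto
  also have "\<dots> \<le> q ^ card A * (q * card (ann (insert x A)))"
    using card_ann_le insert by (intro mult_left_mono) auto
  finally show ?case using insert by (simp add: mult_ac)
qed

text \<open>Annihilator sizes are powers of \<open>q\<close>, so one that exceeds \<open>q\<close>
  jumps to the square. This is how two different hyperplanes are seen to meet in codimension at
  least 2.\<close>

lemma card_ann_gt_q:
  assumes "finite A" "A \<subseteq> V" "card (ann A) > q"
  shows "card (ann A) \<ge> q\<^sup>2"
proof -
  obtain r where r: "card (ann A) = q ^ r" using card_ann_power assms by blast
  hence "q ^ r > q ^ 1" using assms(3) by simp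
  hence "r > 1" using q_ge_2 by (metis One_nat_def Suc_1 Suc_le_lessD r power_strict_increasing_iff)
  hence "q ^ 2 \<le> q ^ r" using q_ge_2 by (intro power_increasing) auto
  thus ?thesis using r by simp
qed

lemma lin_remove:
  assumes "a \<in> \<Phi>" "x \<in> V" "j < d"
  shows "lin a x = a j \<otimes> x j \<oplus> (\<Oplus>i\<in>{..<d} - {j}. a i \<otimes> x i)"
proof -
  have "{..<d} = insert j ({..<d} - {j})" using assms(3) by auto
  hence "lin a x = (\<Oplus>i\<in>insert j ({..<d} - {j}). a i \<otimes> x i)" unfolding lin_def by simp
  also have "\<dots> = a j \<otimes> x j \<oplus> (\<Oplus>i\<in>{..<d} - {j}. a i \<otimes> x i)"
    using assms by (intro finsum_insert) (auto simp: functional_closed point_closed)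
  finally show ?thesis .
qed

text \<open>Coordinate \<open>j\<close> is determined by the value of the functional and the other
  coordinates. This serves both the size of a hyperplane and the spanning property of the kernel
  basis.\<close>

lemma lin_eq_imp_eq:
  assumes a: "a \<in> \<Phi>" and j: "j < d" "a j \<noteq> \<zero>" and x: "x \<in> V" and y: "y \<in> V"
    and lin: "lin a x = lin a y" and eq: "\<And>i. i < d \<Longrightarrow> i \<noteq> j \<Longrightarrow> x i = y i"
  shows "x = y"
proof -
  let ?r = "(\<Oplus>i\<in>{..<d} - {j}. a i \<otimes> x i)"
  have rr: "?r = (\<Oplus>i\<in>{..<d} - {j}. a i \<otimes> y i)"
    using eq a y by (intro finsum_cong') (auto simp: functional_closed point_closed)
  have rc: "?r \<in> carrier R"
    using a x by (intro finsum_closed) (auto simp: functional_closed point_closed)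
  have "a j \<otimes> x j \<oplus> ?r = a j \<otimes> y j \<oplus> ?r"
    using lin lin_remove[OF a x j(1)] lin_remove[OF a y j(1)] rr by simp
  hence "a j \<otimes> x j = a j \<otimes> y j"
    using a rc x y j by (simp add: functional_closed point_closed)
  hence "x j = y j"
    using a j x y m_lcancel[of "a j" "x j" "y j"] by (simp add: functional_closed point_closed)
  hence "\<And>i. i < d \<Longrightarrow> x i = y i" using eq by metis
  thus "x = y" using x y by (intro point_eqI) auto
qed

text \<open>With only a constant term left, a single zero would force that term to vanish as
  well.\<close>

lemma nonconst_functional:
  assumes a: "a \<in> \<Phi>" "a \<noteq> zero_functional" and x: "x \<in> V" "aev a x = \<zero>"
  obtains j where "j < d" "a j \<noteq> \<zero>"
proof (rule ccontr)
  assume "\<not> thesis"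
  hence z: "\<And>j. j < d \<Longrightarrow> a j = \<zero>" using that by blast
  have "lin a x = \<zero>"
    unfolding lin_def using z x by (intro add.finprod_one_eqI) (auto simp: point_closed)
  hence "a d = \<zero>" using x a by (simp add: aev_def functional_closed)
  hence "\<And>i. i \<le> d \<Longrightarrow> a i = \<zero>" using z le_neq_implies_less by blast
  hence "a = zero_functional"
    by (intro functional_eqI[OF a(1) zero_functional_closed]) (simp add: zero_functional_def)
  thus False using a by simp
qed

lemma card_zeros:
  assumes a: "a \<in> \<Phi>" "a \<noteq> zero_functional"
  shows "card {x \<in> V. aev a x = \<zero>} \<le> q ^ (d - 1)"
proof (cases "{x \<in> V. aev a x = \<zero>} = {}")
  case True
  thus ?thesis by (metis card.empty zero_le)
next
  case False
  then obtain j where j: "j < d" "a j \<noteq> \<zero>" using nonconst_functional[OF a] by blast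
  let ?f = "\<lambda>x. restrict x ({..<d} - {j})"
  have "inj_on ?f {x \<in> V. aev a x = \<zero>}"
  proof (rule inj_onI, clarify)
    fix x y assume x: "x \<in> V" "aev a x = \<zero>" and y: "y \<in> V" "aev a y = \<zero>" and eq: "?f x = ?f y"
    have "x i = y i" if "i < d" "i \<noteq> j" for i
      using fun_cong[OF eq, of i] that by simp
    moreover have "a d \<oplus> lin a x = a d \<oplus> lin a y" using x y by (simp add: aev_def)
    hence "lin a x = lin a y" using a x y by (simp add: functional_closed)
    ultimately show "x = y" using lin_eq_imp_eq a j x y by metis
  qed
  moreover have "?f ` {x \<in> V. aev a x = \<zero>} \<subseteq> ({..<d} - {j}) \<rightarrow>\<^sub>E carrier R"
    by (intro image_subsetI) (simp only: restrict_PiE_iff, auto intro: point_closed)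
  ultimately have "card {x \<in> V. aev a x = \<zero>} \<le> card (({..<d} - {j}) \<rightarrow>\<^sub>E carrier R)"
    using finite_carrier by (intro card_inj_on_le) (auto intro: finite_PiE)
  also have "\<dots> = q ^ (d - 1)" using j by (simp add: card_PiE)
  finally show ?thesis .
qed

text \<open>Both sides of the count of pairs \<open>(a, x)\<close> with \<open>a \<in> ann A\<close> and \<open>aev a x = \<zero>\<close>
  are known up to the size of \<open>cl A\<close>.\<close>

lemma card_cl:
  assumes A: "A \<subseteq> V" and d: "d \<ge> 1"
  shows "card (cl A) * card (ann A) \<le> q ^ d"
proof -
  let ?N = "card (ann A)" and ?c = "card (cl A)"
  have fcl: "finite (cl A)" using cl_subset finite_V finite_subset by metis
  have cV: "?c \<le> q ^ d" using card_mono[OF finite_V cl_subset] card_V by simp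
  have "(\<Sum>a\<in>ann A. card {x \<in> V. aev a x = \<zero>}) = (\<Sum>x\<in>V. card {a \<in> ann A. aev a x = \<zero>})"
    by (rule sum_multicount_gen) (simp_all)
  also have "\<dots> = (\<Sum>x\<in>V. card (ann (insert x A)))" by (simp add: ann_insert)
  also have "\<dots> = (\<Sum>x\<in>cl A. card (ann (insert x A))) + (\<Sum>x\<in>V - cl A. card (ann (insert x A)))"
    using sum.subset_diff[OF cl_subset finite_V] by (simp add: add.commute)
  finally have 1: "(\<Sum>a\<in>ann A. card {x \<in> V. aev a x = \<zero>}) =
     (\<Sum>x\<in>cl A. card (ann (insert x A))) + (\<Sum>x\<in>V - cl A. card (ann (insert x A)))" .
  have 2: "(\<Sum>x\<in>cl A. card (ann (insert x A))) = ?c * ?N"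
    using ann_insert_cl by (simp)
  have "q * (\<Sum>x\<in>V - cl A. card (ann (insert x A))) = (\<Sum>x\<in>V - cl A. q * card (ann (insert x A)))"
    by (simp add: sum_distrib_left)
  also have "\<dots> = (\<Sum>x\<in>V - cl A. ?N)"
    by (rule sum.cong) (use card_ann_insert[OF A] in auto)
  also have "\<dots> = (q ^ d - ?c) * ?N"
    using card_Diff_subset[OF fcl cl_subset] card_V by simp
  finally have 3: "q * (\<Sum>x\<in>V - cl A. card (ann (insert x A))) = (q ^ d - ?c) * ?N" .
  have z: "zero_functional \<in> ann A" using A by (rule zero_in_ann)
  have "(\<Sum>a\<in>ann A. card {x \<in> V. aev a x = \<zero>}) =
     card {x \<in> V. aev zero_functional x = \<zero>} + (\<Sum>a\<in>ann A - {zero_functional}. card {x \<in> V. aev a x = \<zero>})"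
    using z by (intro sum.remove) auto
  also have "{x \<in> V. aev zero_functional x = \<zero>} = V" by auto
  also have "(\<Sum>a\<in>ann A - {zero_functional}. card {x \<in> V. aev a x = \<zero>}) \<le> 
      (\<Sum>a\<in>ann A - {zero_functional}. q ^ (d - 1))"
    using subsetD[OF ann_subset[of A]] by (intro sum_mono card_zeros) auto
  also have "\<dots> = (?N - 1) * q ^ (d - 1)" using z by simp
  finally have 4: "(\<Sum>a\<in>ann A. card {x \<in> V. aev a x = \<zero>}) \<le> q ^ d + (?N - 1) * q ^ (d - 1)"
    by (simp only: card_V add_left_mono)
  have "q * (?c * ?N) + (q ^ d - ?c) * ?N = q * (\<Sum>a\<in>ann A. card {x \<in> V. aev a x = \<zero>})"
    using 1 2 3 by (simp add: distrib_left)
  also have "\<dots> \<le> q * (q ^ d + (?N - 1) * q ^ (d - 1))" using 4 by simp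
  also have "\<dots> = q * q ^ d + (?N - 1) * q ^ d"
    using d by (cases d) (auto simp: algebra_simps)
  finally have 5: "q * (?c * ?N) + (q ^ d - ?c) * ?N \<le> q * q ^ d + (?N - 1) * q ^ d" .
  have N: "?N \<ge> 1" using card_ann_pos[OF A] by simp
  \<comment> \<open>Over the reals the subtractions become exact, and both sides reduce to multiples
    of \<open>q - 1\<close>.\<close>
  have "real q * (real ?c * real ?N) + (real q ^ d - real ?c) * real ?N
      \<le> real q * real q ^ d + (real ?N - 1) * real q ^ d"
    using of_nat_mono[OF 5, where 'a = real] by (simp add: of_nat_diff[OF N[unfolded One_nat_def]] of_nat_diff[OF cV])
  hence "(real q - 1) * (real ?c * real ?N) \<le> (real q - 1) * real q ^ d"
    by (simp add: algebra_simps)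
  hence "real ?c * real ?N \<le> real q ^ d" using q_ge_2 by simp
  thus ?thesis by (metis of_nat_le_iff of_nat_mult of_nat_power)
qed

end

section \<open>Hyperplanes as zero sets of functionals\<close>

context finite_affine_space
begin

abbreviation "M \<equiv> coord_space R d"

lemma carrier_M [simp]: "carrier M = V"
  by (simp add: V_def)

sublocale M: module R M
  by (rule module_coord_space)

lemma M_add_closed: "x \<in> V \<Longrightarrow> y \<in> V \<Longrightarrow> x \<oplus>\<^bsub>M\<^esub> y \<in> V"
  using M.M.a_closed by (simp only: carrier_M)

lemma M_smult_closed: "c \<in> carrier R \<Longrightarrow> x \<in> V \<Longrightarrow> c \<odot>\<^bsub>M\<^esub> x \<in> V"
  using M.smult_closed by (simp only: carrier_M)

lemma M_add_apply: "i < d \<Longrightarrow> (x \<oplus>\<^bsub>M\<^esub> y) i = x i \<oplus> y i"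
  and M_smult_apply: "i < d \<Longrightarrow> (c \<odot>\<^bsub>M\<^esub> x) i = c \<otimes> x i"
  and M_zero_apply: "i < d \<Longrightarrow> \<zero>\<^bsub>M\<^esub> i = \<zero>"
  by simp_all

lemma M_zero_closed: "\<zero>\<^bsub>M\<^esub> \<in> V"
  using M.M.zero_closed by (simp only: carrier_M)

declare coord_space_simps [simp del]

lemma lin_M_add:
  assumes "a \<in> \<Phi>" "x \<in> V" "y \<in> V"
  shows "lin a (x \<oplus>\<^bsub>M\<^esub> y) = lin a x \<oplus> lin a y"
proof -
  note [simp] = functional_closed[OF assms(1)] point_closed[OF assms(2)] point_closed[OF assms(3)]
  have "lin a (x \<oplus>\<^bsub>M\<^esub> y) = (\<Oplus>i\<in>{..<d}. a i \<otimes> x i \<oplus> a i \<otimes> y i)"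
    unfolding lin_def by (intro finsum_cong') (simp_all add: M_add_apply r_distr Pi_iff)
  also have "\<dots> = lin a x \<oplus> lin a y"
    unfolding lin_def by (intro finsum_addf) (simp_all add: Pi_iff)
  finally show ?thesis .
qed

lemma lin_M_smult:
  assumes "a \<in> \<Phi>" "x \<in> V" "c \<in> carrier R"
  shows "lin a (c \<odot>\<^bsub>M\<^esub> x) = c \<otimes> lin a x"
proof -
  note [simp] = functional_closed[OF assms(1)] point_closed[OF assms(2)]
  have "lin a (c \<odot>\<^bsub>M\<^esub> x) = (\<Oplus>i\<in>{..<d}. c \<otimes> (a i \<otimes> x i))"
    unfolding lin_def using assms(3)
    by (intro finsum_cong') (simp_all add: M_smult_apply m_lcomm Pi_iff)
  also have "\<dots> = c \<otimes> lin a x"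
    unfolding lin_def using assms(3) by (intro finsum_rdistr[symmetric]) (simp_all add: Pi_iff)
  finally show ?thesis .
qed

lemma lin_M_zero: "a \<in> \<Phi> \<Longrightarrow> lin a \<zero>\<^bsub>M\<^esub> = \<zero>"
  unfolding lin_def by (intro add.finprod_one_eqI) (simp add: M_zero_apply functional_closed)

lemma aev_M_add:
  assumes "a \<in> \<Phi>" "x \<in> V" "y \<in> V"
  shows "aev a (x \<oplus>\<^bsub>M\<^esub> y) = aev a x \<oplus> lin a y"
  using assms by (simp add: aev_def lin_M_add a_assoc functional_closed)

lemma M_finsum_closed: "f \<in> B \<rightarrow> V \<Longrightarrow> (\<Oplus>\<^bsub>M\<^esub>b\<in>B. f b) \<in> V"
  using M.M.finsum_closed[of f B] by (simp only: carrier_M)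

lemma M_finsum_insert:
  "finite B \<Longrightarrow> b \<notin> B \<Longrightarrow> f \<in> B \<rightarrow> V \<Longrightarrow> f b \<in> V \<Longrightarrow>
     (\<Oplus>\<^bsub>M\<^esub>b\<in>insert b B. f b) = f b \<oplus>\<^bsub>M\<^esub> (\<Oplus>\<^bsub>M\<^esub>b\<in>B. f b)"
  unfolding carrier_M[symmetric] by (rule M.M.finsum_insert)

lemma lin_M_finsum:
  assumes "finite B" "f \<in> B \<rightarrow> V" "a \<in> \<Phi>" "\<And>b. b \<in> B \<Longrightarrow> lin a (f b) = \<zero>"
  shows "lin a (\<Oplus>\<^bsub>M\<^esub>b\<in>B. f b) = \<zero>"
  using assms
proof (induction B rule: finite_induct)
  case empty
  thus ?case by (simp add: lin_M_zero)
next
  case (insert b B)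
  have f: "f \<in> B \<rightarrow> V" "f b \<in> V" using insert.prems by auto
  have "lin a (\<Oplus>\<^bsub>M\<^esub>b\<in>B. f b) = \<zero>" using insert f by auto
  thus ?case
    using M_finsum_insert[OF insert.hyps f] lin_M_add[OF insert.prems(2) f(2) M_finsum_closed[OF f(1)]]
      insert.prems(3) by simp
qed

lemma M_finsum_apply:
  assumes "finite B" "f \<in> B \<rightarrow> V" "i < d"
  shows "(\<Oplus>\<^bsub>M\<^esub>b\<in>B. f b) i = (\<Oplus>b\<in>B. f b i)"
  using assms
proof (induction B rule: finite_induct)
  case empty
  thus ?case by (simp add: M_zero_apply)
next
  case (insert b B)
  have f: "f \<in> B \<rightarrow> V" "f b \<in> V" using insert.prems by auto
  have "(\<lambda>b. f b i) \<in> B \<rightarrow> carrier R" "f b i \<in> carrier R"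
    using f insert.prems by (auto intro!: point_closed)
  thus ?case
    using M_finsum_insert[OF insert.hyps f] insert.IH[OF f(1) insert.prems(2)] insert.prems(2)
    by (simp add: M_add_apply finsum_insert[OF insert.hyps])
qed

text \<open>A flat of dimension \<open>d - 1\<close> is the affine hull of \<open>x\<close> and the
  translates \<open>x + b\<close>. These \<open>d\<close> points give at most \<open>d\<close>
  linear conditions on \<open>d + 1\<close> coefficients, so a nonzero functional survives.\<close>

lemma hyperplane_imp_functional:
  assumes d: "d \<ge> 1" and H: "hyperplane R d H"
  obtains a where "a \<in> \<Phi>" "a \<noteq> zero_functional" "\<And>y. y \<in> H \<Longrightarrow> aev a y = \<zero>"
proof -
  obtain x W B where x: "x \<in> V" and B: "is_basis R M W B" "card B = d - 1"
    and Hx: "H = x <+\<^bsub>M\<^esub> W"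
    using H unfolding hyperplane_def affine_subspace_def by auto
  have fB: "finite B" and BV: "B \<subseteq> V"
    and W: "W = {(\<Oplus>\<^bsub>M\<^esub>b\<in>B. c b \<odot>\<^bsub>M\<^esub> b) | c. c \<in> B \<rightarrow> carrier R}"
    using B(1) unfolding is_basis_def by auto
  define A where "A = insert x ((\<lambda>b. x \<oplus>\<^bsub>M\<^esub> b) ` B)"
  have A: "finite A" "A \<subseteq> V"
    using fB BV x M_add_closed unfolding A_def by auto
  have "card A \<le> Suc (card ((\<lambda>b. x \<oplus>\<^bsub>M\<^esub> b) ` B))"
    unfolding A_def by (rule card_insert_le_m1) auto
  also have "\<dots> \<le> d" using card_image_le[OF fB, of "\<lambda>b. x \<oplus>\<^bsub>M\<^esub> b"] B d by simp
  finally have "q ^ card A \<le> q ^ d" using q_ge_2 by (intro power_increasing) auto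
  hence "q ^ d * q \<le> q ^ d * card (ann A)"
    using card_ann_ge[OF A] by (metis (no_types, lifting) le_trans mult_le_mono1 power_Suc2)
  hence "card (ann A) \<ge> 2" using q_ge_2 by simp
  hence "\<not> ann A \<subseteq> {zero_functional}"
    using card_mono[of "{zero_functional}" "ann A"] by auto
  then obtain a where a: "a \<in> ann A" "a \<noteq> zero_functional" by auto
  have a': "a \<in> \<Phi>" using a ann_subset by auto
  have ax: "aev a x = \<zero>" using a unfolding ann_def A_def by auto
  have lb: "lin a b = \<zero>" if "b \<in> B" for b
  proof -
    have "aev a (x \<oplus>\<^bsub>M\<^esub> b) = \<zero>" using a that unfolding ann_def A_def by auto
    thus ?thesis using aev_M_add[OF a' x, of b] BV that ax a' by (auto simp: subset_iff)
  qed
  have "aev a y = \<zero>" if y: "y \<in> H" for y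
  proof -
    obtain c where c: "c \<in> B \<rightarrow> carrier R" and yc: "y = x \<oplus>\<^bsub>M\<^esub> (\<Oplus>\<^bsub>M\<^esub>b\<in>B. c b \<odot>\<^bsub>M\<^esub> b)"
      using y unfolding Hx W a_l_coset_def' by auto
    have cV: "(\<lambda>b. c b \<odot>\<^bsub>M\<^esub> b) \<in> B \<rightarrow> V"
      using c BV by (auto intro!: M_smult_closed)
    have "lin a (c b \<odot>\<^bsub>M\<^esub> b) = \<zero>" if "b \<in> B" for b
      using lin_M_smult[OF a', of b "c b"] lb[OF that] that BV c by (auto simp: Pi_iff subset_iff)
    hence "lin a (\<Oplus>\<^bsub>M\<^esub>b\<in>B. c b \<odot>\<^bsub>M\<^esub> b) = \<zero>"
      by (intro lin_M_finsum fB cV a')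
    thus ?thesis unfolding yc using aev_M_add[OF a' x M_finsum_closed[OF cV]] ax by simp
  qed
  thus thesis using that a a' by blast
qed

lemma kernel_submodule:
  assumes a: "a \<in> \<Phi>"
  shows "submodule {w \<in> V. lin a w = \<zero>} R M"
proof (rule M.submoduleI)
  fix w assume w: "w \<in> {w \<in> V. lin a w = \<zero>}"
  have wV: "\<ominus>\<^bsub>M\<^esub> w \<in> V" using M.M.a_inv_closed[of w] w by simp
  have w': "w \<in> V" "lin a w = \<zero>" using w by auto
  have "w \<oplus>\<^bsub>M\<^esub> \<ominus>\<^bsub>M\<^esub> w = \<zero>\<^bsub>M\<^esub>" by (rule M.M.r_neg) (use w' in simp)
  hence "lin a w \<oplus> lin a (\<ominus>\<^bsub>M\<^esub> w) = \<zero>"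
    using lin_M_add[OF a w'(1) wV] lin_M_zero[OF a] by metis
  hence "lin a (\<ominus>\<^bsub>M\<^esub> w) = \<zero>" using w'(2) l_zero[OF lin_closed[OF a wV]] by metis
  thus "\<ominus>\<^bsub>M\<^esub> w \<in> {w \<in> V. lin a w = \<zero>}" using wV by blast
next
  fix c w assume "c \<in> carrier R" "w \<in> {w \<in> V. lin a w = \<zero>}"
  thus "c \<odot>\<^bsub>M\<^esub> w \<in> {w \<in> V. lin a w = \<zero>}"
    using lin_M_smult[OF a] M_smult_closed by simp
next
  fix v w assume "v \<in> {w \<in> V. lin a w = \<zero>}" "w \<in> {w \<in> V. lin a w = \<zero>}"
  thus "v \<oplus>\<^bsub>M\<^esub> w \<in> {w \<in> V. lin a w = \<zero>}"
    using lin_M_add[OF a] M_add_closed by simp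
qed (use lin_M_zero[OF a] M_zero_closed in auto)

text \<open>If \<open>a j \<noteq> \<zero>\<close>, the kernel of the linear part of \<open>a\<close> has the basis
  \<open>e\<^sub>i - (a\<^sub>i / a\<^sub>j) e\<^sub>j\<close> with \<open>i \<noteq> j\<close>.\<close>

lemma kernel_basis:
  assumes a: "a \<in> \<Phi>" and j: "j < d" "a j \<noteq> \<zero>"
  shows "\<exists>B. is_basis R M {w \<in> V. lin a w = \<zero>} B \<and> card B = d - 1"
proof -
  define I where "I = {..<d} - {j}"
  define v where "v i = (\<lambda>l\<in>{..<d}. if l = i then \<one> else if l = j then \<ominus> (a i \<otimes> inv (a j)) else \<zero>)" for i
  have ajU: "a j \<in> Units R" using j a by (simp add: field_Units functional_closed)
  have vV: "v i \<in> V" if "i \<in> I" for i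
    unfolding v_def V_def restrict_PiE_iff using that a ajU
    by (simp add: I_def functional_closed)
  have vi: "v i l = (if i = l then \<one> else \<zero>)" if "i \<in> I" "l \<in> I" for i l
    using that by (simp add: v_def I_def)
  have inj: "inj_on v I"
    by (rule inj_onI) (metis vi one_not_zero)
  have lv: "lin a (v i) = \<zero>" if i: "i \<in> I" for i
  proof -
    have ai: "a i \<in> carrier R" "a j \<in> carrier R" using a i j by (auto simp: functional_closed I_def)
    have "(\<Oplus>l\<in>I. a l \<otimes> v i l) = (\<Oplus>l\<in>I. if i = l then a l else \<zero>)"
      using i a by (intro finsum_cong') (auto simp: vi I_def functional_closed)
    also have "\<dots> = a i"
      using i a by (intro finsum_singleton) (auto simp: I_def functional_closed)
    finally have "lin a (v i) = a j \<otimes> v i j \<oplus> a i"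
      using lin_remove[OF a vV[OF i] j(1)] by (simp add: I_def)
    also have "v i j = \<ominus> (a i \<otimes> inv (a j))" using i j by (simp add: v_def I_def)
    also have "a j \<otimes> \<ominus> (a i \<otimes> inv (a j)) = \<ominus> a i"
      using ai ajU by (simp add: r_minus m_lcomm[of "a j"])
    finally show ?thesis using ai by (simp add: l_neg)
  qed
  let ?s = "\<lambda>c. \<Oplus>\<^bsub>M\<^esub>b\<in>v ` I. c b \<odot>\<^bsub>M\<^esub> b"
  have fI: "finite (v ` I)" by (simp add: I_def)
  have cV: "(\<lambda>b. c b \<odot>\<^bsub>M\<^esub> b) \<in> v ` I \<rightarrow> V" if "c \<in> v ` I \<rightarrow> carrier R" for c
    using that vV by (auto intro!: M_smult_closed)
  have lins: "lin a (?s c) = \<zero>" if c: "c \<in> v ` I \<rightarrow> carrier R" for c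
  proof (rule lin_M_finsum[OF fI cV[OF c] a])
    fix b assume b: "b \<in> v ` I"
    hence "b \<in> V" "lin a b = \<zero>" "c b \<in> carrier R" using vV lv c by auto
    thus "lin a (c b \<odot>\<^bsub>M\<^esub> b) = \<zero>" using lin_M_smult[OF a] by simp
  qed
  \<comment> \<open>On \<open>I\<close> the vector \<open>v i\<close> has entry 1 at
    \<open>i\<close> and 0 elsewhere, so coefficients are read off as coordinates. This gives
    independence, and spanning below.\<close>
  have coord: "?s c l = c (v l)" if c: "c \<in> v ` I \<rightarrow> carrier R" and l: "l \<in> I" for c l
  proof -
    have ld: "l < d" using l by (simp add: I_def)
    have "?s c l = (\<Oplus>b\<in>v ` I. (c b \<odot>\<^bsub>M\<^esub> b) l)"
      by (intro M_finsum_apply fI cV c ld)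
    also have "\<dots> = (\<Oplus>i\<in>I. (c (v i) \<odot>\<^bsub>M\<^esub> v i) l)"
      using cV[OF c] ld by (intro finsum_reindex inj) (auto intro!: point_closed)
    also have "\<dots> = (\<Oplus>i\<in>I. if l = i then c (v i) else \<zero>)"
      using c l ld by (intro finsum_cong') (auto simp: M_smult_apply vi Pi_iff)
    also have "\<dots> = c (v l)"
      using c l by (intro finsum_singleton) (auto simp: I_def)
    finally show ?thesis .
  qed
  have "is_basis R M {w \<in> V. lin a w = \<zero>} (v ` I)"
    unfolding is_basis_def
  proof (intro conjI ballI impI)
    show "v ` I \<subseteq> carrier M" using vV by auto
    fix c b assume c: "c \<in> v ` I \<rightarrow> carrier R" and z: "?s c = \<zero>\<^bsub>M\<^esub>" and b: "b \<in> v ` I"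
    then obtain l where l: "l \<in> I" "b = v l" by auto
    hence "c b = \<zero>\<^bsub>M\<^esub> l" using coord[OF c, of l] z by simp
    thus "c b = \<zero>" using l by (simp add: M_zero_apply I_def)
  next
    show "{w \<in> V. lin a w = \<zero>} = {?s c |c. c \<in> v ` I \<rightarrow> carrier R}"
    proof (intro equalityI subsetI)
      fix w assume "w \<in> {w \<in> V. lin a w = \<zero>}"
      hence w: "w \<in> V" "lin a w = \<zero>" by auto
      define c where "c = (\<lambda>b. w (the_inv_into I v b))"
      have cv: "c (v i) = w i" if "i \<in> I" for i
        using the_inv_into_f_f[OF inj that] by (simp add: c_def)
      have c: "c \<in> v ` I \<rightarrow> carrier R"
      proof
        fix b assume "b \<in> v ` I"
        then obtain l where l: "l \<in> I" "b = v l" by auto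
        thus "c b \<in> carrier R" using cv[OF l(1)] point_closed[OF w(1), of l] by (simp add: I_def)
      qed
      have "w = ?s c"
      \<comment> \<open>Two kernel vectors that agree off \<open>j\<close> are equal, which settles
        coordinate \<open>j\<close>.\<close>
      proof (rule lin_eq_imp_eq[OF a j w(1)])
        show "?s c \<in> V" by (intro M_finsum_closed cV c)
        show "lin a w = lin a (?s c)" using lins[OF c] w by simp
        show "w i = ?s c i" if "i < d" "i \<noteq> j" for i
          using coord[OF c, of i] cv[of i] that by (simp add: I_def)
      qed
      thus "w \<in> {?s c |c. c \<in> v ` I \<rightarrow> carrier R}" using c by blast
    next
      fix w assume "w \<in> {?s c |c. c \<in> v ` I \<rightarrow> carrier R}"
      then obtain c where "c \<in> v ` I \<rightarrow> carrier R" "w = ?s c" by blast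
      thus "w \<in> {w \<in> V. lin a w = \<zero>}"
        using lins M_finsum_closed[OF cV] by simp
    qed
  qed (rule fI)
  moreover have "card (v ` I) = d - 1" using card_image[OF inj] j by (simp add: I_def)
  ultimately show ?thesis by blast
qed

text \<open>The zero set is the translate by \<open>x\<close> of the kernel of the linear part. The
  zero \<open>x\<close> both rules out constant functionals and provides the translation.\<close>

lemma hyperplane_zeros:
  assumes a: "a \<in> \<Phi>" "a \<noteq> zero_functional" and x: "x \<in> V" "aev a x = \<zero>"
  shows "hyperplane R d {y \<in> V. aev a y = \<zero>}"
proof -
  obtain j where j: "j < d" "a j \<noteq> \<zero>" using nonconst_functional[OF a x] .
  let ?W = "{w \<in> V. lin a w = \<zero>}"
  obtain B where B: "is_basis R M ?W B" "card B = d - 1" using kernel_basis[OF a(1) j] by blast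
  have "{y \<in> V. aev a y = \<zero>} = x <+\<^bsub>M\<^esub> ?W"
  proof (intro equalityI subsetI)
    fix y assume "y \<in> {y \<in> V. aev a y = \<zero>}"
    hence y: "y \<in> V" "aev a y = \<zero>" by auto
    define w where "w = \<ominus>\<^bsub>M\<^esub> x \<oplus>\<^bsub>M\<^esub> y"
    have w: "w \<in> V" unfolding w_def using M.M.a_inv_closed[of x] x y by (intro M_add_closed) auto
    have yw: "y = x \<oplus>\<^bsub>M\<^esub> w" unfolding w_def using M.M.r_neg2[of x y] x y by simp
    have "lin a w = \<zero>" using aev_M_add[OF a(1) x(1) w] yw y x w a by simp
    thus "y \<in> x <+\<^bsub>M\<^esub> ?W" unfolding a_l_coset_def' using w yw by blast
  next
    fix y assume "y \<in> x <+\<^bsub>M\<^esub> ?W"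
    then obtain w where "w \<in> V" "lin a w = \<zero>" "y = x \<oplus>\<^bsub>M\<^esub> w" unfolding a_l_coset_def' by auto
    thus "y \<in> {y \<in> V. aev a y = \<zero>}"
      using aev_M_add[OF a(1) x(1), of w] x M_add_closed by simp
  qed
  thus ?thesis
    unfolding hyperplane_def affine_subspace_def
    using kernel_submodule[OF a(1)] B x by auto
qed

text \<open>The bridge to the given definitions: from here on hyperplanes are seen only through
  \<open>ann\<close>.\<close>

lemma general_position_iff:
  assumes d: "d \<ge> 1"
  shows "general_position R d P \<longleftrightarrow> P \<subseteq> V \<and> (\<forall>A\<subseteq>P. card A = d + 1 \<longrightarrow> card (ann A) = 1)"
proof -
  have *: "(\<exists>H. hyperplane R d H \<and> A \<subseteq> H) \<longleftrightarrow> card (ann A) \<noteq> 1"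
    if A: "A \<subseteq> V" "card A = d + 1" for A
  proof
    assume "\<exists>H. hyperplane R d H \<and> A \<subseteq> H"
    then obtain H where H: "hyperplane R d H" "A \<subseteq> H" by blast
    obtain a where "a \<in> \<Phi>" "a \<noteq> zero_functional" "\<And>y. y \<in> H \<Longrightarrow> aev a y = \<zero>"
      using hyperplane_imp_functional[OF d H(1)] by metis
    hence "a \<in> ann A" "a \<noteq> zero_functional" using H by (auto simp: ann_def)
    thus "card (ann A) \<noteq> 1" using zero_in_ann[OF A(1)] by (metis card_1_singletonE singletonD)
  next
    assume c: "card (ann A) \<noteq> 1"
    have "ann A \<noteq> {zero_functional}" using c by auto
    then obtain a where a: "a \<in> ann A" "a \<noteq> zero_functional"
      using zero_in_ann[OF A(1)] by blast
    \<comment> \<open>\<open>A\<close> has \<open>d + 1\<close> points and so is nonempty; any of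
      its points is a zero as required by \<open>hyperplane_zeros\<close>.\<close>
    obtain x where x: "x \<in> A" using A by fastforce
    have "a \<in> \<Phi>" "x \<in> V" "aev a x = \<zero>" using a x A by (auto simp: ann_def)
    hence "hyperplane R d {y \<in> V. aev a y = \<zero>}" using hyperplane_zeros a by blast
    moreover have "A \<subseteq> {y \<in> V. aev a y = \<zero>}" using a A by (auto simp: ann_def)
    ultimately show "\<exists>H. hyperplane R d H \<and> A \<subseteq> H" by blast
  qed
  show ?thesis
    unfolding general_position_def carrier_M using * by (meson order_trans)
qed

end

section \<open>Supersaturation\<close>

context finite_affine_space
begin

lemma card_ann_Un_le:
  assumes "finite B" "A \<subseteq> V" "B \<subseteq> V"
  shows "card (ann A) \<le> q ^ card B * card (ann (A \<union> B))"
  using assms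
proof (induction B rule: finite_induct)
  case (insert x B)
  have "card (ann A) \<le> q ^ card B * card (ann (A \<union> B))" using insert by auto
  also have "\<dots> \<le> q ^ card B * (q * card (ann (insert x (A \<union> B))))"
    using card_ann_le[of "A \<union> B" x] insert by (intro mult_left_mono) auto
  finally show ?case using insert by (simp add: mult_ac)
qed simp

text \<open>When no point of \<open>B\<close> depends on the remaining ones, each costs a full
  factor \<open>q\<close>. It is applied in contraposition: an annihilator that is too large
  exhibits a point in the closure of the others.\<close>

lemma card_ann_Un_eq:
  assumes "finite B" "A \<subseteq> V" "B \<subseteq> V" "\<And>z. z \<in> B \<Longrightarrow> z \<notin> cl (A \<union> (B - {z}))"
  shows "card (ann A) = q ^ card B * card (ann (A \<union> B))"
  using assms
proof (induction B rule: finite_induct)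
  case (insert x B)
  have "z \<notin> cl (A \<union> (B - {z}))" if "z \<in> B" for z
    using insert.prems(3)[of z] that cl_mono[of "A \<union> (B - {z})" "A \<union> (insert x B - {z})"] by blast
  hence "card (ann A) = q ^ card B * card (ann (A \<union> B))" using insert by auto
  moreover have "x \<notin> cl (A \<union> B)"
    using insert.prems(3)[of x] insert.hyps cl_mono[of "A \<union> B" "A \<union> (insert x B - {x})"] by blast
  ultimately show ?case
    using card_ann_insert[of "A \<union> B" x] insert by (simp add: mult_ac)
qed simp

lemma card_cl_empty: "d \<ge> 1 \<Longrightarrow> cl {} = {}"
proof -
  assume d: "d \<ge> 1"
  have "card (cl {}) * (q * q ^ d) \<le> q ^ d"
    using card_cl[of "{}", OF _ d] by (simp add: ann_empty card_\<Phi>)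
  hence "(card (cl {}) * q) * q ^ d \<le> 1 * q ^ d" by (simp add: mult_ac)
  hence "card (cl {}) * q \<le> 1" using q_ge_2 by (subst (asm) mult_le_cancel2) auto
  hence "card (cl {}) = 0" using q_ge_2 by (cases "card (cl {})") auto
  thus ?thesis using finite_subset[OF cl_subset finite_V] by (simp add: card_eq_0_iff)
qed

text \<open>By \<open>card_cl\<close> the closure of one point has at most one element, so a second
  point is always independent of it.\<close>

lemma card_ann_pair:
  assumes d: "d \<ge> 1" and y: "y \<in> V" and u: "u \<in> V" "u \<noteq> y"
  shows "card (ann {y, u}) = q ^ (d - 1)"
proof -
  have q0: "q > 0" using q_ge_2 by simp
  have "card (ann {}) = q * card (ann {y})"
    using card_ann_insert[of "{}" y] y card_cl_empty[OF d] by auto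
  hence 1: "card (ann {y}) = q ^ d" using q0 by (simp add: ann_empty card_\<Phi>)
  have "card (cl {y}) * q ^ d \<le> 1 * q ^ d" using card_cl[of "{y}", OF _ d] y 1 by simp
  hence "card (cl {y}) \<le> 1" using q0 by (subst (asm) mult_le_cancel2) auto
  hence "u \<notin> cl {y}"
    using u subset_cl[of "{y}"] y card_mono[of "cl {y}" "{y, u}"] finite_subset[OF cl_subset finite_V]
    by auto
  hence "q ^ d = q * card (ann {u, y})" using card_ann_insert[of "{y}" u] y u 1 by auto
  hence "q * card (ann {y, u}) = q * q ^ (d - 1)" using d by (cases d) (auto simp: insert_commute)
  thus ?thesis using q0 by simp
qed

section \<open>General position in terms of annihilators\<close>

definition gp :: "(nat \<Rightarrow> 'a) set \<Rightarrow> bool" where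
  "gp X \<longleftrightarrow> X \<subseteq> V \<and> (\<forall>A\<subseteq>X. card A = d + 1 \<longrightarrow> card (ann A) = 1)"

lemma gp_subset: "gp X \<Longrightarrow> Y \<subseteq> X \<Longrightarrow> gp Y"
  unfolding gp_def by auto

lemma gp_V: "gp X \<Longrightarrow> X \<subseteq> V"
  unfolding gp_def by auto

lemma gp_finite: "gp X \<Longrightarrow> finite X"
  using gp_V finite_V finite_subset by metis

text \<open>\<open>A\<close> extends to \<open>d + 1\<close> points of \<open>X\<close>, whose
  annihilator is trivial, and each added point reduces the annihilator at most by a factor
  \<open>q\<close>. The lower bound on \<open>card X\<close> makes the extension possible.\<close>

lemma gp_card_ann:
  assumes X: "gp X" "card X \<ge> d + 1" and A: "A \<subseteq> X" "card A \<le> d + 1"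
  shows "card (ann A) = q ^ (d + 1 - card A)"
proof -
  have fin: "finite X" "finite A" using gp_finite X A finite_subset by metis+
  obtain A' where A': "A \<subseteq> A'" "A' \<subseteq> X" "card A' = d + 1"
    using exists_subset_between[of A "d + 1" X] A X fin by auto
  have AV: "A \<subseteq> V" "A' \<subseteq> V" using A' X gp_V by auto
  have fA': "finite A'" using A' fin finite_subset by metis
  have "card (ann A) \<le> q ^ card (A' - A) * card (ann (A \<union> (A' - A)))"
    using AV fA' by (intro card_ann_Un_le) auto
  also have "A \<union> (A' - A) = A'" using A' by auto
  also have "card (ann A') = 1" using X A' unfolding gp_def by auto
  also have "card (A' - A) = d + 1 - card A" using A' fin by (simp add: card_Diff_subset)
  finally have 1: "card (ann A) \<le> q ^ (d + 1 - card A)" by simp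
  have "q ^ card A * q ^ (d + 1 - card A) \<le> q ^ card A * card (ann A)"
    using card_ann_ge[OF fin(2) AV(1)] A by (simp flip: power_add power_Suc)
  hence "q ^ (d + 1 - card A) \<le> card (ann A)" using q_ge_2 by simp
  thus ?thesis using 1 by simp
qed

lemma gp_card_zeros:
  assumes X: "gp X" and a: "a \<in> \<Phi>" "a \<noteq> zero_functional"
  shows "card {x \<in> X. aev a x = \<zero>} \<le> d"
proof (rule ccontr)
  assume "\<not> ?thesis"
  then obtain A where A: "A \<subseteq> {x \<in> X. aev a x = \<zero>}" "card A = d + 1"
    using obtain_subset_with_card_n[of "d + 1" "{x \<in> X. aev a x = \<zero>}"] by auto
  hence "card (ann A) = 1" using X unfolding gp_def by auto
  moreover have "a \<in> ann A" "zero_functional \<in> ann A"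
    using a A zero_in_ann[of A] gp_V[OF X] by (auto simp: ann_def)
  ultimately show False using a by (metis card_1_singletonE singletonD)
qed

lemma card_ann_gt_1_nonzero:
  assumes "A \<subseteq> V" "card (ann A) > 1"
  obtains a where "a \<in> ann A" "a \<noteq> zero_functional"
proof -
  have "\<not> ann A \<subseteq> {zero_functional}"
    using card_mono[of "{zero_functional}" "ann A"] assms by auto
  thus thesis using that by auto
qed

lemma card_ann_gt_1I:
  assumes "A \<subseteq> V" "a \<in> ann A" "a \<noteq> zero_functional"
  shows "card (ann A) > 1"
proof -
  have "card {a, zero_functional} \<le> card (ann A)"
    using assms zero_in_ann by (intro card_mono) auto
  thus ?thesis using assms by auto
qed

lemma gp_card_cl:
  assumes X: "gp X" and A: "A \<subseteq> V" "card (ann A) > 1"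
  shows "card (X \<inter> cl A) \<le> d"
proof -
  obtain a where a: "a \<in> ann A" "a \<noteq> zero_functional" using card_ann_gt_1_nonzero[OF A] .
  have "card (X \<inter> cl A) \<le> card {x \<in> X. aev a x = \<zero>}"
    using a gp_finite[OF X] by (intro card_mono) (auto simp: cl_def)
  also have "\<dots> \<le> d" using gp_card_zeros[OF X _ a(2)] a ann_subset by auto
  finally show ?thesis .
qed

text \<open>For affinely independent \<open>Y\<close> of size \<open>d - 1\<close>: some hyperplane through \<open>Y\<close> contains
  both \<open>y\<close> and \<open>u\<close>.\<close>

definition related :: "(nat \<Rightarrow> 'a) set \<Rightarrow> (nat \<Rightarrow> 'a) \<Rightarrow> (nat \<Rightarrow> 'a) \<Rightarrow> bool" where
  "related Y y u \<longleftrightarrow> card (ann (insert y (insert u Y))) > 1"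

lemma related_sym: "related Y y u \<longleftrightarrow> related Y u y"
  by (simp add: related_def insert_commute)

text \<open>Two functionals \<open>f\<close> and \<open>g\<close> in \<open>ann Y\<close> that are
  not proportional give the members \<open>f\<close> and \<open>t f + g\<close>. A point off
  \<open>f\<close> lies on the member with \<open>t = - g(y) / f(y)\<close>.\<close>

lemma pencil:
  assumes Y: "Y \<subseteq> V" "card (ann Y) > q"
  obtains P where "P \<subseteq> ann Y - {zero_functional}" "finite P" "card P \<le> q + 1"
    "\<And>y. y \<in> V \<Longrightarrow> \<exists>a\<in>P. aev a y = \<zero>"
proof -
  obtain f where f: "f \<in> ann Y" "f \<noteq> zero_functional"
    using card_ann_gt_1_nonzero[of Y] Y q_ge_2 by auto
  have f': "f \<in> \<Phi>" using f ann_subset by auto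
  \<comment> \<open>The multiples of \<open>f\<close>. There are at most \<open>q\<close> of them,
    so some \<open>g\<close> in \<open>ann Y\<close> is not proportional to
    \<open>f\<close>.\<close>
  let ?S = "(\<lambda>t. comb t f zero_functional) ` carrier R"
  have "card ?S \<le> q" using finite_carrier by (rule card_image_le)
  hence "\<not> ann Y \<subseteq> ?S"
    using Y card_mono[of ?S "ann Y"] finite_carrier by auto
  then obtain g where g: "g \<in> ann Y" "g \<notin> ?S" by auto
  have g': "g \<in> \<Phi>" using g ann_subset by auto
  define P where "P = insert f ((\<lambda>t. comb t f g) ` carrier R)"
  have nz: "comb t f g \<noteq> zero_functional" if t: "t \<in> carrier R" for t
  proof
    assume z: "comb t f g = zero_functional"
    have "g = comb (\<ominus> t) f zero_functional"
    proof (rule functional_eqI[OF g'])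
      show "comb (\<ominus> t) f zero_functional \<in> \<Phi>" using t f' by simp
      fix i assume i: "i \<le> d"
      have fi: "f i \<in> carrier R" "g i \<in> carrier R" using i f' g' functional_closed by auto
      have "t \<otimes> f i \<oplus> g i = \<zero>"
        using fun_cong[OF z, of i] i by (simp add: comb_def zero_functional_def)
      hence "g i = \<ominus> (t \<otimes> f i)" using t fi by (metis a_comm m_closed minus_equality)
      thus "g i = comb (\<ominus> t) f zero_functional i"
        using i t fi by (simp add: comb_def zero_functional_def l_minus)
    qed
    thus False using g t by blast
  qed
  show thesis
  proof (rule that[of P])
    show "P \<subseteq> ann Y - {zero_functional}"
      unfolding P_def using f nz comb_in_ann[OF Y(1)] g by auto
    show "finite P" unfolding P_def using finite_carrier by simp
    have "card P \<le> Suc (card ((\<lambda>t. comb t f g) ` carrier R))"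
      unfolding P_def by (rule card_insert_le_m1) auto
    thus "card P \<le> q + 1" using card_image_le[OF finite_carrier, of "\<lambda>t. comb t f g"] by simp
    fix y assume y: "y \<in> V"
    show "\<exists>a\<in>P. aev a y = \<zero>"
    proof (cases "aev f y = \<zero>")
      case True
      thus ?thesis by (auto simp: P_def)
    next
      case False
      have c: "aev f y \<in> carrier R" "aev g y \<in> carrier R" using f' g' y by auto
      have U: "aev f y \<in> Units R" using False c by (simp add: field_Units)
      define t where "t = \<ominus> (aev g y) \<otimes> inv (aev f y)"
      have t: "t \<in> carrier R" using c U by (simp add: t_def)
      have "aev (comb t f g) y = t \<otimes> aev f y \<oplus> aev g y" by (rule aev_comb[OF t f' g' y])
      also have "t \<otimes> aev f y = \<ominus> (aev g y)" using c U by (simp add: t_def m_assoc)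
      finally have "aev (comb t f g) y = \<zero>" using c by (simp add: l_neg)
      thus ?thesis using t by (auto simp: P_def)
    qed
  qed
qed

text \<open>Assign each point of \<open>B\<close> to one member of a pencil through
  \<open>Y\<close>. Points assigned to the same hyperplane are related, and Cauchy-Schwarz over at
  most \<open>q + 1\<close> classes bounds the number of such pairs from below.\<close>

lemma card_related_pairs_ge:
  assumes Y: "Y \<subseteq> V" "card (ann Y) > q" and B: "B \<subseteq> V"
  shows "(real (card B))\<^sup>2 \<le> real (q + 1) * real (card {(y, u) \<in> B \<times> B. related Y y u})"
proof -
  obtain P where P: "P \<subseteq> ann Y - {zero_functional}" "finite P" "card P \<le> q + 1"
    "\<And>y. y \<in> V \<Longrightarrow> \<exists>a\<in>P. aev a y = \<zero>"
    using pencil[OF Y] by blast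
  have fB: "finite B" using B finite_V finite_subset by metis
  have "\<forall>y\<in>B. \<exists>a. a \<in> P \<and> aev a y = \<zero>" using P(4) B by blast
  then obtain h where h: "\<And>y. y \<in> B \<Longrightarrow> h y \<in> P \<and> aev (h y) y = \<zero>"
    using bchoice[of B "\<lambda>y a. a \<in> P \<and> aev a y = \<zero>"] by blast
  let ?c = "\<lambda>a. {y \<in> B. h y = a}"
  have 1: "card B = (\<Sum>a\<in>P. card (?c a))"
  proof -
    have "B = (\<Union>a\<in>P. ?c a)" using h by auto
    hence "card B = card (\<Union>a\<in>P. ?c a)" by simp
    also have "\<dots> = (\<Sum>a\<in>P. card (?c a))"
      using P fB by (intro card_UN_disjoint) auto
    finally show ?thesis .
  qed
  have "(\<Union>a\<in>P. ?c a \<times> ?c a) \<subseteq> {(y, u) \<in> B \<times> B. related Y y u}"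
  proof
    fix p assume "p \<in> (\<Union>a\<in>P. ?c a \<times> ?c a)"
    then obtain a y u where a: "a \<in> P" "y \<in> B" "u \<in> B" "a = h y" "h u = h y" and p: "p = (y, u)"
      by auto
    have "aev a y = \<zero>" "aev a u = \<zero>" using h[of y] h[of u] a by auto
    hence "a \<in> ann (insert y (insert u Y))" using P(1) a by (auto simp: ann_def)
    moreover have "a \<noteq> zero_functional" using P(1) a by auto
    moreover have "insert y (insert u Y) \<subseteq> V" using Y a B by auto
    ultimately have "related Y y u" unfolding related_def by (metis card_ann_gt_1I)
    thus "p \<in> {(y, u) \<in> B \<times> B. related Y y u}" using a p by simp
  qed
  hence "card (\<Union>a\<in>P. ?c a \<times> ?c a) \<le> card {(y, u) \<in> B \<times> B. related Y y u}"
    using fB by (intro card_mono) (auto intro: finite_subset[of _ "B \<times> B"])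
  moreover have "card (\<Union>a\<in>P. ?c a \<times> ?c a) = (\<Sum>a\<in>P. card (?c a \<times> ?c a))"
    using P fB by (intro card_UN_disjoint) auto
  ultimately have "(\<Sum>a\<in>P. (card (?c a))\<^sup>2) \<le> card {(y, u) \<in> B \<times> B. related Y y u}"
    by (simp add: power2_eq_square card_cartesian_product)
  hence 2: "(\<Sum>a\<in>P. (real (card (?c a)))\<^sup>2) \<le> real (card {(y, u) \<in> B \<times> B. related Y y u})"
    by (simp flip: of_nat_power of_nat_sum)
  have "(real (card B))\<^sup>2 = (\<Sum>a\<in>P. real (card (?c a)))\<^sup>2" by (subst 1) simp
  also have "\<dots> \<le> (\<Sum>a\<in>P. (real (card (?c a)))\<^sup>2) * card P"
    by (rule sum_squared_le_sum_of_squares)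
  also have "\<dots> \<le> real (card {(y, u) \<in> B \<times> B. related Y y u}) * real (q + 1)"
    using 2 P(3) by (intro mult_mono) auto
  finally show ?thesis by (simp add: mult.commute)
qed

text \<open>Two distinct points are independent, so if they share a hyperplane with the
  \<open>d - 1\<close> points of \<open>Y\<close>, some \<open>z\<close> in \<open>Y\<close> lies in
  the closure of the others. Once the other \<open>d - 2\<close> points of \<open>Y\<close> are
  chosen, that closure lies in a hyperplane and so contains at most \<open>d\<close> candidates for
  \<open>z\<close>.\<close>

lemma card_related_sets_le:
  assumes d: "d \<ge> 2" and X: "gp X" and y: "y \<in> V" and u: "u \<in> V" "u \<noteq> y"
  shows "card {Y. Y \<subseteq> X \<and> card Y = d - 1 \<and> related Y y u} \<le> d * (card X choose (d - 2))"
proof -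
  have fX: "finite X" using gp_finite X by auto
  let ?T = "{Y'. Y' \<subseteq> X \<and> card Y' = d - 2}"
  let ?c = "\<lambda>Y'. X \<inter> cl (insert y (insert u Y'))"
  have "{Y. Y \<subseteq> X \<and> card Y = d - 1 \<and> related Y y u} \<subseteq>
    (\<Union>Y'\<in>?T. (\<lambda>z. insert z Y') ` ?c Y')"
  proof clarify
    fix Y assume Y: "Y \<subseteq> X" "card Y = d - 1" and rel: "related Y y u"
    have fY: "finite Y" using Y fX finite_subset by auto
    have YV: "Y \<subseteq> V" using Y X gp_V by auto
    have "\<exists>z\<in>Y. z \<in> cl ({y, u} \<union> (Y - {z}))"
    proof (rule ccontr)
      assume "\<not> ?thesis"
      hence "card (ann {y, u}) = q ^ card Y * card (ann ({y, u} \<union> Y))"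
        using fY YV y u by (intro card_ann_Un_eq) auto
      hence "card (ann ({y, u} \<union> Y)) = 1"
        using card_ann_pair[OF _ y u] d Y q_ge_2 by simp
      thus False using rel unfolding related_def by simp
    qed
    then obtain z where z: "z \<in> Y" "z \<in> cl ({y, u} \<union> (Y - {z}))" by auto
    have "Y = insert z (Y - {z})" "Y - {z} \<in> ?T" "z \<in> ?c (Y - {z})"
      using z Y fY by auto
    thus "Y \<in> (\<Union>Y'\<in>?T. (\<lambda>z. insert z Y') ` ?c Y')" by blast
  qed
  hence "card {Y. Y \<subseteq> X \<and> card Y = d - 1 \<and> related Y y u} \<le>
    card (\<Union>Y'\<in>?T. (\<lambda>z. insert z Y') ` ?c Y')"
    using fX by (intro card_mono) auto
  also have "\<dots> \<le> (\<Sum>Y'\<in>?T. card ((\<lambda>z. insert z Y') ` ?c Y'))"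
    using fX by (intro card_UN_le) auto
  also have "\<dots> \<le> (\<Sum>Y'\<in>?T. d)"
  proof (rule sum_mono)
    fix Y' assume Y': "Y' \<in> ?T"
    have fY: "finite Y'" using Y' fX finite_subset by auto
    let ?A = "insert y (insert u Y')"
    have A: "?A \<subseteq> V" "finite ?A" using y u Y' X gp_V fY by auto
    have "card ?A \<le> Suc (Suc (card Y'))" using fY by (simp add: card_insert_if)
    hence "card ?A \<le> d" using Y' d by simp
    hence "q ^ card ?A \<le> q ^ d" using q_ge_2 by (intro power_increasing) auto
    hence "q ^ d * q \<le> q ^ d * card (ann ?A)"
      using card_ann_ge[OF A(2,1)] by (metis (no_types, lifting) le_trans mult_le_mono1 power_Suc2)
    hence "card (ann ?A) > 1" using q_ge_2 by simp
    hence "card (?c Y') \<le> d" using gp_card_cl[OF X A(1)] by simp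
    moreover have "finite (?c Y')" using fX by simp
    ultimately show "card ((\<lambda>z. insert z Y') ` ?c Y') \<le> d"
      using card_image_le le_trans by blast
  qed
  also have "\<dots> = d * (card X choose (d - 2))" using n_subsets[OF fX] by simp
  finally show ?thesis .
qed

text \<open>For \<open>X\<close> in general position with more than \<open>d\<close> points, these
  subsets span flats of codimension 2, each the axis of a pencil of hyperplanes.\<close>

definition codim2_sets :: "(nat \<Rightarrow> 'a) set \<Rightarrow> (nat \<Rightarrow> 'a) set set" where
  "codim2_sets X = {Y. Y \<subseteq> X \<and> card Y = d - 1}"

text \<open>Ordered pairs, so that the size is the sum of the degrees.\<close>

definition edges :: "(nat \<Rightarrow> 'a) set \<Rightarrow> (nat \<Rightarrow> 'a) set \<Rightarrow> ((nat \<Rightarrow> 'a) \<times> (nat \<Rightarrow> 'a)) set" where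
  "edges X B = {(y, u) \<in> B \<times> B. y \<noteq> u \<and> (\<exists>Y\<in>codim2_sets X. related Y y u)}"

definition pair_mult :: "(nat \<Rightarrow> 'a) set \<Rightarrow> (nat \<Rightarrow> 'a) \<Rightarrow> (nat \<Rightarrow> 'a) \<Rightarrow> nat" where
  "pair_mult X y u = card {Y \<in> codim2_sets X. related Y y u}"

definition total_mult :: "(nat \<Rightarrow> 'a) set \<Rightarrow> (nat \<Rightarrow> 'a) set \<Rightarrow> nat" where
  "total_mult X B = (\<Sum>(y, u)\<in>edges X B. pair_mult X y u)"

lemma finite_codim2_sets: "gp X \<Longrightarrow> finite (codim2_sets X)"
  unfolding codim2_sets_def using gp_finite by auto

lemma card_codim2_sets: "gp X \<Longrightarrow> card (codim2_sets X) = card X choose (d - 1)"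
  unfolding codim2_sets_def using n_subsets gp_finite by auto

lemma edges_subset: "edges X B \<subseteq> B \<times> B"
  unfolding edges_def by auto

lemma finite_edges: "finite B \<Longrightarrow> finite (edges X B)"
  using finite_subset[OF edges_subset] by blast

lemma total_mult_eq:
  assumes X: "gp X" and B: "finite B"
  shows "total_mult X B = (\<Sum>Y\<in>codim2_sets X. card {(y, u) \<in> B \<times> B. y \<noteq> u \<and> related Y y u})"
proof -
  have "total_mult X B = (\<Sum>p\<in>edges X B. card {Y \<in> codim2_sets X. related Y (fst p) (snd p)})"
    unfolding total_mult_def pair_mult_def by (intro sum.cong) auto
  also have "\<dots> = (\<Sum>Y\<in>codim2_sets X. card {p \<in> edges X B. related Y (fst p) (snd p)})"
    by (rule sum_multicount_gen) (use finite_edges[OF B] finite_codim2_sets[OF X] in auto)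
  also have "\<dots> = (\<Sum>Y\<in>codim2_sets X. card {(y, u) \<in> B \<times> B. y \<noteq> u \<and> related Y y u})"
    by (intro sum.cong arg_cong[where f = card]) (auto simp: edges_def)
  finally show ?thesis .
qed

text \<open>The pair bound summed over all \<open>Y\<close>; the subtracted \<open>card B\<close>
  pays for the diagonal pairs, which are not edges.\<close>

lemma total_mult_ge:
  assumes d: "d \<ge> 2" and X: "gp X" "card X \<ge> d + 1" and B: "B \<subseteq> V"
  shows "real (card X choose (d - 1)) * ((real (card B))\<^sup>2 / real (q + 1) - real (card B))
           \<le> real (total_mult X B)"
proof -
  have fB: "finite B" using B finite_V finite_subset by metis
  have "(real (card B))\<^sup>2 / real (q + 1) - real (card B) \<le>
      real (card {(y, u) \<in> B \<times> B. y \<noteq> u \<and> related Y y u})" if Y: "Y \<in> codim2_sets X" for Y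
  proof -
    have "card (ann Y) = q ^ 2"
      using gp_card_ann[OF X, of Y] Y d by (auto simp: codim2_sets_def Suc_diff_Suc numeral_2_eq_2)
    hence Y': "Y \<subseteq> V" "card (ann Y) > q"
      using q_ge_2 Y gp_V[OF X(1)] by (auto simp: codim2_sets_def power2_eq_square)
    have "{(y, u) \<in> B \<times> B. related Y y u} \<subseteq>
       {(y, u) \<in> B \<times> B. y \<noteq> u \<and> related Y y u} \<union> (\<lambda>y. (y, y)) ` B" by auto
    hence "card {(y, u) \<in> B \<times> B. related Y y u} \<le>
       card ({(y, u) \<in> B \<times> B. y \<noteq> u \<and> related Y y u} \<union> (\<lambda>y. (y, y)) ` B)"
      using fB by (intro card_mono) (auto intro: finite_subset[of _ "B \<times> B"])
    also have "\<dots> \<le> card {(y, u) \<in> B \<times> B. y \<noteq> u \<and> related Y y u} + card ((\<lambda>y. (y, y)) ` B)"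
      by (rule card_Un_le)
    also have "card ((\<lambda>y. (y, y)) ` B) \<le> card B" using fB by (rule card_image_le)
    finally have 1: "card {(y, u) \<in> B \<times> B. related Y y u} \<le>
      card {(y, u) \<in> B \<times> B. y \<noteq> u \<and> related Y y u} + card B" by simp
    have "(real (card B))\<^sup>2 / real (q + 1) \<le> real (card {(y, u) \<in> B \<times> B. related Y y u})"
      using card_related_pairs_ge[OF Y' B] by (simp add: divide_le_eq mult.commute)
    thus ?thesis using 1 by linarith
  qed
  hence "(\<Sum>Y\<in>codim2_sets X. (real (card B))\<^sup>2 / real (q + 1) - real (card B)) \<le>
     (\<Sum>Y\<in>codim2_sets X. real (card {(y, u) \<in> B \<times> B. y \<noteq> u \<and> related Y y u}))"
    by (rule sum_mono)
  thus ?thesis by (simp add: total_mult_eq[OF X(1) fB] card_codim2_sets[OF X(1)])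
qed

lemma total_mult_le:
  assumes d: "d \<ge> 2" and X: "gp X" and B: "B \<subseteq> V"
  shows "total_mult X B \<le> d * (card X choose (d - 2)) * card (edges X B)"
proof -
  have "total_mult X B \<le> (\<Sum>(y, u)\<in>edges X B. d * (card X choose (d - 2)))"
    unfolding total_mult_def
  proof (intro sum_mono, clarify)
    fix y u assume "(y, u) \<in> edges X B"
    hence "y \<in> V" "u \<in> V" "u \<noteq> y" using B by (auto simp: edges_def)
    from card_related_sets_le[OF d X this]
    show "pair_mult X y u \<le> d * (card X choose (d - 2))"
      unfolding pair_mult_def codim2_sets_def by (simp add: conj_assoc)
  qed
  thus ?thesis by (simp add: mult.commute)
qed

text \<open>Outside \<open>cl Y\<close> and \<open>cl Z\<close>, a point \<open>y\<close> spans a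
  unique hyperplane with each of \<open>Y\<close> and \<open>Z\<close>, and \<open>u\<close> has to
  lie in both. If they differ, \<open>u\<close> is confined to codimension 2. If they coincide, this
  hyperplane contains \<open>Y \<union> Z\<close>, which then has exactly \<open>d\<close> points
  and spans it; both \<open>y\<close> and \<open>u\<close> lie there, whence the second summand. The
  factor 3 collects \<open>y\<close> in \<open>cl Y\<close>, \<open>y\<close> in \<open>cl Z\<close>
  and the case of different hyperplanes.\<close>

lemma card_related_twice:
  assumes d: "d \<ge> 2" and X: "gp X" "card X \<ge> d + 1" and B: "B \<subseteq> V"
    and Y: "Y \<in> codim2_sets X" and Z: "Z \<in> codim2_sets X" and YZ: "Y \<noteq> Z"
  shows "card {(y, u) \<in> B \<times> B. related Y y u \<and> related Z y u} \<le>
    3 * card B * q ^ (d - 2) + (if card (Y \<union> Z) \<le> d then q ^ (2 * (d - 1)) else 0)"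
proof -
  have fB: "finite B" using B finite_V finite_subset by metis
  have fcl: "finite (cl A)" for A using finite_subset[OF cl_subset finite_V] .
  have q0: "q > 0" using q_ge_2 by simp
  have qd: "q ^ d = q ^ (d - 2) * q\<^sup>2"
    using d by (metis le_add_diff_inverse2 power_add)
  have *: "W \<subseteq> V" "finite W" "card (ann W) = q\<^sup>2" "card (cl W) \<le> q ^ (d - 2)"
    if W: "W \<in> codim2_sets X" for W
  proof -
    show 1: "W \<subseteq> V" using W gp_V[OF X(1)] by (auto simp: codim2_sets_def)
    show "finite W" using 1 finite_V finite_subset by metis
    show 2: "card (ann W) = q\<^sup>2"
      using gp_card_ann[OF X, of W] W d by (auto simp: codim2_sets_def Suc_diff_Suc numeral_2_eq_2)
    have "card (cl W) * q\<^sup>2 \<le> q ^ (d - 2) * q\<^sup>2" using card_cl[OF 1] d by (simp add: 2 qd)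
    thus "card (cl W) \<le> q ^ (d - 2)" using q0 by simp
  qed
  have line: "card (ann (insert y W)) = q" "u \<in> cl (insert y W)"
    if W: "W \<in> codim2_sets X" and y: "y \<in> V" "y \<notin> cl W" and u: "u \<in> V" "related W y u" for W y u
  proof -
    have "q * q = q * card (ann (insert y W))"
      using card_ann_insert[of W y] *(1,3)[OF W] y by (simp add: power2_eq_square)
    thus 1: "card (ann (insert y W)) = q" using q0 by simp
    show "u \<in> cl (insert y W)"
    proof (rule ccontr)
      assume "u \<notin> cl (insert y W)"
      hence "card (ann (insert u (insert y W))) = 1"
        using card_ann_insert[of "insert y W" u] *(1)[OF W] y u 1 q0 by simp
      thus False using u by (simp add: related_def insert_commute)
    qed
  qed
  \<comment> \<open>Candidates for \<open>u\<close> when the two hyperplanes differ. The empty value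
    in the other case leaves those pairs to \<open>E\<close>.\<close>
  define G where "G y = (if ann (insert y Y) = ann (insert y Z) then {}
    else cl (insert y Y) \<inter> cl (insert y Z))" for y
  define E where "E = (if card (Y \<union> Z) \<le> d then cl (Y \<union> Z) else {})"
  define D where "D = B - cl Y - cl Z"
  have "{(y, u) \<in> B \<times> B. related Y y u \<and> related Z y u} \<subseteq>
    cl Y \<times> B \<union> cl Z \<times> B \<union> Sigma {y \<in> D. card (ann (insert y Y)) = q \<and> card (ann (insert y Z)) = q} G \<union> E \<times> E"
  proof
    fix p assume "p \<in> {(y, u) \<in> B \<times> B. related Y y u \<and> related Z y u}"
    then obtain y u where p: "p = (y, u)" and y: "y \<in> B" and u: "u \<in> B"
      and rel: "related Y y u" "related Z y u" by auto
    show "p \<in> cl Y \<times> B \<union> cl Z \<times> B \<union>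
      Sigma {y \<in> D. card (ann (insert y Y)) = q \<and> card (ann (insert y Z)) = q} G \<union> E \<times> E"
    proof (rule ccontr)
      assume "\<not> ?thesis"
      hence ncl: "y \<notin> cl Y" and ny: "(y, u) \<notin> E \<times> E" "y \<notin> cl Z"
        "(y, u) \<notin> Sigma {y \<in> D. card (ann (insert y Y)) = q \<and> card (ann (insert y Z)) = q} G"
        using y u unfolding p by blast+
      have yuV: "y \<in> V" "u \<in> V" using y u B by auto
      note lY = line[OF Y yuV(1) ncl yuV(2) rel(1)]
      note lZ = line[OF Z yuV(1) ny(2) yuV(2) rel(2)]
      have "y \<in> D" using y ncl ny by (simp add: D_def)
      hence "u \<notin> G y" using ny lY lZ by simp
      hence eq: "ann (insert y Y) = ann (insert y Z)"
        using lY lZ by (auto simp: G_def split: if_splits)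
      let ?A = "insert y (Y \<union> Z)"
      have AV: "?A \<subseteq> V" using *(1)[OF Y] *(1)[OF Z] yuV by auto
      have annA: "ann ?A = ann (insert y Y)" using eq by (auto simp: ann_def)
      have YZX: "Y \<union> Z \<subseteq> X" using Y Z by (auto simp: codim2_sets_def)
      have "card (X \<inter> cl ?A) \<le> d"
        using gp_card_cl[OF X(1) AV] annA lY q_ge_2 by simp
      moreover have "Y \<union> Z \<subseteq> X \<inter> cl ?A" using YZX subset_cl[OF AV] by auto
      ultimately have le: "card (Y \<union> Z) \<le> d"
        using card_mono[of "X \<inter> cl ?A" "Y \<union> Z"] gp_finite[OF X(1)] by simp
      have "\<not> Z \<subseteq> Y" using YZ card_subset_eq[of Y Z] *(2)[OF Y] Y Z by (auto simp: codim2_sets_def)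
      hence "card Y < card (Y \<union> Z)" using *(2)[OF Y] *(2)[OF Z] by (intro psubset_card_mono) auto
      hence "card (Y \<union> Z) = d" using le Y d by (auto simp: codim2_sets_def)
      hence "card (ann (Y \<union> Z)) = q" using gp_card_ann[OF X YZX] by simp
      hence "ann ?A = ann (Y \<union> Z)"
        using annA lY ann_antimono[of "Y \<union> Z" ?A] by (intro card_subset_eq) auto
      hence "y \<in> cl (Y \<union> Z)" "u \<in> cl (Y \<union> Z)"
        using annA lY(2) yuV by (auto simp: cl_def ann_def)
      thus False using ny(1) le by (simp add: E_def)
    qed
  qed
  hence "card {(y, u) \<in> B \<times> B. related Y y u \<and> related Z y u} \<le>
    card (cl Y \<times> B \<union> cl Z \<times> B \<union> Sigma {y \<in> D. card (ann (insert y Y)) = q \<and> card (ann (insert y Z)) = q} G \<union> E \<times> E)"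
    using fB fcl by (intro card_mono) (auto simp: D_def G_def E_def)
  also have "\<dots> \<le> card (cl Y \<times> B) + card (cl Z \<times> B) +
      card (Sigma {y \<in> D. card (ann (insert y Y)) = q \<and> card (ann (insert y Z)) = q} G) + card (E \<times> E)"
    by (meson add_mono card_Un_le le_refl le_trans)
  finally have main: "card {(y, u) \<in> B \<times> B. related Y y u \<and> related Z y u} \<le>
      card (cl Y \<times> B) + card (cl Z \<times> B) +
      card (Sigma {y \<in> D. card (ann (insert y Y)) = q \<and> card (ann (insert y Z)) = q} G) + card (E \<times> E)" .
  have c12: "card (cl Y \<times> B) \<le> q ^ (d - 2) * card B" "card (cl Z \<times> B) \<le> q ^ (d - 2) * card B"
    using *(4)[OF Y] *(4)[OF Z] by (simp_all add: card_cartesian_product)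
  have cE: "card (E \<times> E) \<le> (if card (Y \<union> Z) \<le> d then q ^ (2 * (d - 1)) else 0)"
  proof (cases "card (Y \<union> Z) \<le> d")
    case True
    have YZX: "Y \<union> Z \<subseteq> X" "Y \<union> Z \<subseteq> V" using Y Z gp_V[OF X(1)] by (auto simp: codim2_sets_def)
    have "card (ann (Y \<union> Z)) = q ^ (d + 1 - card (Y \<union> Z))"
      using gp_card_ann[OF X YZX(1)] True by simp
    also have "\<dots> \<ge> q ^ 1" using True q_ge_2 by (intro power_increasing) auto
    finally have "card (cl (Y \<union> Z)) * q \<le> card (cl (Y \<union> Z)) * card (ann (Y \<union> Z))" by simp
    also have "\<dots> \<le> q ^ d" using card_cl[OF YZX(2)] d by simp
    also have "\<dots> = q ^ (d - 1) * q" using d by (simp flip: power_Suc2)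
    finally have "card E \<le> q ^ (d - 1)" using q0 True by (simp add: E_def)
    hence "card (E \<times> E) \<le> q ^ (d - 1) * q ^ (d - 1)"
      by (simp add: card_cartesian_product mult_mono)
    thus ?thesis using True by (simp add: mult_2 flip: power_add)
  next
    case False
    thus ?thesis by (simp add: E_def)
  qed
  have cG: "card (Sigma {y \<in> D. card (ann (insert y Y)) = q \<and> card (ann (insert y Z)) = q} G)
      \<le> card B * q ^ (d - 2)"
  proof -
    let ?D = "{y \<in> D. card (ann (insert y Y)) = q \<and> card (ann (insert y Z)) = q}"
    have "card (G y) \<le> q ^ (d - 2)" if y: "y \<in> ?D" for y
    proof (cases "ann (insert y Y) = ann (insert y Z)")
      case False
      let ?A = "cl (insert y Y) \<inter> cl (insert y Z)"
      have yV: "y \<in> V" using y B by (auto simp: D_def)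
      have AV: "?A \<subseteq> V" "finite ?A" using cl_subset fcl by auto
      \<comment> \<open>The annihilator of the intersection contains two different sets of size
        \<open>q\<close>, so it exceeds \<open>q\<close> and has at least the square of
        \<open>q\<close> elements.\<close>
      have sub: "ann (insert y Y) \<union> ann (insert y Z) \<subseteq> ann ?A"
        by (auto simp: ann_def cl_def)
      have "\<not> ann (insert y Z) \<subseteq> ann (insert y Y)"
        using False y card_subset_eq[of "ann (insert y Y)" "ann (insert y Z)"] by auto
      hence "card (ann (insert y Y)) < card (ann (insert y Y) \<union> ann (insert y Z))"
        by (intro psubset_card_mono) auto
      also have "\<dots> \<le> card (ann ?A)" using sub by (intro card_mono) auto
      finally have "card (ann ?A) > q" using y by simp
      hence "card (ann ?A) \<ge> q\<^sup>2" by (intro card_ann_gt_q AV)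
      hence "card (cl ?A) * q\<^sup>2 \<le> card (cl ?A) * card (ann ?A)" by simp
      also have "\<dots> \<le> q ^ d" using card_cl[OF AV(1)] d by simp
      finally have "card (cl ?A) \<le> q ^ (d - 2)" using q0 by (simp add: qd)
      moreover have "card ?A \<le> card (cl ?A)" using subset_cl[OF AV(1)] fcl by (intro card_mono) auto
      ultimately show ?thesis using False by (simp add: G_def)
    qed (simp add: G_def)
    hence "(\<Sum>y\<in>?D. card (G y)) \<le> (\<Sum>y\<in>?D. q ^ (d - 2))" by (intro sum_mono) auto
    moreover have "card ?D \<le> card B" using fB by (intro card_mono) (auto simp: D_def)
    hence "(\<Sum>y\<in>?D. q ^ (d - 2)) \<le> card B * q ^ (d - 2)" by (simp only: sum_constant of_nat_id mult_right_mono)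
    moreover have "card (Sigma ?D G) = (\<Sum>y\<in>?D. card (G y))"
      using fB fcl by (intro card_SigmaI) (auto simp: D_def G_def)
    ultimately show ?thesis by linarith
  qed
  have "3 * card B * q ^ (d - 2) = q ^ (d - 2) * card B + q ^ (d - 2) * card B + card B * q ^ (d - 2)"
    by simp
  thus ?thesis using main c12 cE cG by linarith
qed

text \<open>Cauchy-Schwarz over the edges. The sum of the squared multiplicities counts pairs
  \<open>(Y, Z)\<close> that relate the same edge: \<open>Y = Z\<close> gives
  \<open>total_mult\<close>, and \<open>card_related_twice\<close> controls the rest. Its large
  second summand occurs for at most \<open>d * k\<close> partners of each \<open>Y\<close>.\<close>

lemma total_mult_squared_le:
  assumes d: "d \<ge> 2" and X: "gp X" "card X \<ge> d + 1" and B: "B \<subseteq> V"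
  defines "b \<equiv> card B" and "k \<equiv> card X" and "m \<equiv> card X choose (d - 1)"
  shows "(total_mult X B)\<^sup>2 \<le> card (edges X B) *
    (total_mult X B + m\<^sup>2 * (3 * b * q ^ (d - 2)) + m * (d * k) * q ^ (2 * (d - 1)))"
proof -
  have fB: "finite B" using B finite_V finite_subset by metis
  note fC = finite_codim2_sets[OF X(1)]
  let ?C = "codim2_sets X" and ?E = "edges X B"
  have fE: "finite ?E" using finite_edges fB by blast
  have "(\<Sum>(y, u)\<in>?E. (pair_mult X y u)\<^sup>2) =
     (\<Sum>p\<in>?E. card {W \<in> ?C \<times> ?C. related (fst W) (fst p) (snd p) \<and> related (snd W) (fst p) (snd p)})"
  proof (rule sum.cong[OF refl], clarify)
    fix y u
    have "{W \<in> ?C \<times> ?C. related (fst W) y u \<and> related (snd W) y u} =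
      {Y \<in> ?C. related Y y u} \<times> {Y \<in> ?C. related Y y u}" by auto
    thus "(pair_mult X y u)\<^sup>2 = card {W \<in> ?C \<times> ?C. related (fst W) (fst (y, u)) (snd (y, u)) \<and>
        related (snd W) (fst (y, u)) (snd (y, u))}"
      by (simp add: pair_mult_def card_cartesian_product power2_eq_square)
  qed
  also have "\<dots> = (\<Sum>W\<in>?C \<times> ?C. card {p \<in> ?E. related (fst W) (fst p) (snd p) \<and> related (snd W) (fst p) (snd p)})"
    by (rule sum_multicount_gen) (use fE fC in auto)
  also have "\<dots> = (\<Sum>Y\<in>?C. \<Sum>Z\<in>?C. card {p \<in> ?E. related Y (fst p) (snd p) \<and> related Z (fst p) (snd p)})"
    by (simp add: sum.cartesian_product case_prod_beta)
  also have "\<dots> \<le> (\<Sum>Y\<in>?C. card {(y, u) \<in> B \<times> B. y \<noteq> u \<and> related Y y u} +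
      (m * (3 * b * q ^ (d - 2)) + d * k * q ^ (2 * (d - 1))))"
  proof (rule sum_mono)
    fix Y assume Y: "Y \<in> ?C"
    let ?f = "\<lambda>Z. card {p \<in> ?E. related Y (fst p) (snd p) \<and> related Z (fst p) (snd p)}"
    let ?N = "{Z \<in> ?C - {Y}. card (Y \<union> Z) \<le> d}"
    have YX: "Y \<subseteq> X" "finite Y" "card Y = d - 1"
      using Y gp_finite[OF X(1)] finite_subset by (auto simp: codim2_sets_def)
    have "(\<Sum>Z\<in>?C. ?f Z) = ?f Y + (\<Sum>Z\<in>?C - {Y}. ?f Z)"
      using fC Y by (intro sum.remove) auto
    also have "?f Y \<le> card {(y, u) \<in> B \<times> B. y \<noteq> u \<and> related Y y u}"
      using fB by (intro card_mono) (auto simp: edges_def intro: finite_subset[of _ "B \<times> B"])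
    also have "(\<Sum>Z\<in>?C - {Y}. ?f Z) \<le>
      (\<Sum>Z\<in>?C - {Y}. 3 * b * q ^ (d - 2) + (if card (Y \<union> Z) \<le> d then q ^ (2 * (d - 1)) else 0))"
    proof (rule sum_mono)
      fix Z assume Z: "Z \<in> ?C - {Y}"
      have "?f Z \<le> card {(y, u) \<in> B \<times> B. related Y y u \<and> related Z y u}"
        using fB by (intro card_mono) (auto simp: edges_def intro: finite_subset[of _ "B \<times> B"])
      also have "\<dots> \<le> 3 * b * q ^ (d - 2) + (if card (Y \<union> Z) \<le> d then q ^ (2 * (d - 1)) else 0)"
        unfolding b_def by (rule card_related_twice[OF d X B Y]) (use Z in auto)
      finally show "?f Z \<le> \<dots>" .
    qed
    also have "\<dots> = card (?C - {Y}) * (3 * b * q ^ (d - 2)) + card ?N * q ^ (2 * (d - 1))"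
      using fC by (simp add: sum.distrib sum.If_cases Int_def)
    also have "\<dots> \<le> m * (3 * b * q ^ (d - 2)) + d * k * q ^ (2 * (d - 1))"
    proof (intro add_mono mult_right_mono)
      show "card (?C - {Y}) \<le> m"
        using card_codim2_sets[OF X(1)] card_Diff_subset_Int[of ?C "{Y}"] fC
        by (metis card_Diff1_le m_def)
      \<comment> \<open>A different set of the same size whose union with \<open>Y\<close> has at
        most \<open>d\<close> points arises by exchanging one point of \<open>Y\<close> for one
        point of \<open>X\<close>.\<close>
      have "?N \<subseteq> (\<lambda>(z, x). insert x (Y - {z})) ` (Y \<times> X)"
      proof
        fix Z assume Z: "Z \<in> ?N"
        have ZX: "Z \<subseteq> X" "finite Z" "card Z = d - 1"
          using Z gp_finite[OF X(1)] finite_subset by (auto simp: codim2_sets_def)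
        have "card Y + card (Z - Y) = card (Y \<union> Z)"
          using YX ZX by (metis Un_Diff_cancel card_Un_disjoint Diff_disjoint finite_Diff)
        moreover have "card (Y \<union> Z) \<le> d" using Z by simp
        ultimately have c1: "card (Z - Y) \<le> 1" using YX(3) d by linarith
        have "\<not> Z \<subseteq> Y" using Z card_subset_eq[of Y Z] YX ZX by auto
        then obtain x where x: "x \<in> Z - Y" by auto
        hence zy: "Z - Y = {x}" using c1 ZX card_le_Suc0_iff_eq[of "Z - Y"] by auto
        have "\<not> Y \<subseteq> Z" using Z card_subset_eq[of Z Y] YX ZX by auto
        then obtain z where z: "z \<in> Y" "z \<notin> Z" by auto
        have "Z \<subseteq> insert x (Y - {z})" using zy z by auto
        moreover have "card (insert x (Y - {z})) = d - 1" using x z YX d by auto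
        ultimately have "Z = insert x (Y - {z})"
          using YX ZX by (intro card_subset_eq) auto
        thus "Z \<in> (\<lambda>(z, x). insert x (Y - {z})) ` (Y \<times> X)" using x z ZX by auto
      qed
      hence "card ?N \<le> card (Y \<times> X)"
        using YX gp_finite[OF X(1)] by (intro surj_card_le) auto
      also have "\<dots> \<le> d * k" using YX by (simp add: card_cartesian_product k_def)
      finally show "card ?N \<le> d * k" .
    qed auto
    finally show "(\<Sum>Z\<in>?C. ?f Z) \<le> card {(y, u) \<in> B \<times> B. y \<noteq> u \<and> related Y y u} +
      (m * (3 * b * q ^ (d - 2)) + d * k * q ^ (2 * (d - 1)))" by simp
  qed
  also have "\<dots> = total_mult X B + m\<^sup>2 * (3 * b * q ^ (d - 2)) + m * (d * k) * q ^ (2 * (d - 1))"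
    using card_codim2_sets[OF X(1)]
    by (simp add: sum.distrib total_mult_eq[OF X(1) fB] m_def power2_eq_square algebra_simps)
  finally have Q: "(\<Sum>(y, u)\<in>?E. (pair_mult X y u)\<^sup>2) \<le>
    total_mult X B + m\<^sup>2 * (3 * b * q ^ (d - 2)) + m * (d * k) * q ^ (2 * (d - 1))" .
  have "(real (total_mult X B))\<^sup>2 = (\<Sum>p\<in>?E. real (pair_mult X (fst p) (snd p)))\<^sup>2"
    by (simp add: total_mult_def case_prod_beta)
  also have "\<dots> \<le> (\<Sum>p\<in>?E. (real (pair_mult X (fst p) (snd p)))\<^sup>2) * card ?E"
    by (rule sum_squared_le_sum_of_squares)
  also have "(\<Sum>p\<in>?E. (real (pair_mult X (fst p) (snd p)))\<^sup>2) = real (\<Sum>(y, u)\<in>?E. (pair_mult X y u)\<^sup>2)"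
    by (simp add: case_prod_beta)
  finally have "(total_mult X B)\<^sup>2 \<le> (\<Sum>(y, u)\<in>?E. (pair_mult X y u)\<^sup>2) * card ?E"
    by (simp only: of_nat_le_iff flip: of_nat_power of_nat_mult)
  also have "\<dots> \<le> (total_mult X B + m\<^sup>2 * (3 * b * q ^ (d - 2)) + m * (d * k) * q ^ (2 * (d - 1))) * card ?E"
    using Q by (rule mult_right_mono) auto
  finally show ?thesis by (simp add: mult.commute)
qed

end

section \<open>Independent sets in locally dense graphs\<close>

definition indep_sets :: "('v \<Rightarrow> 'v \<Rightarrow> bool) \<Rightarrow> 'v set \<Rightarrow> nat \<Rightarrow> 'v set set" where
  "indep_sets adj B m = {I. I \<subseteq> B \<and> card I = m \<and> (\<forall>x\<in>I. \<forall>y\<in>I. x \<noteq> y \<longrightarrow> \<not> adj x y)}"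

lemma finite_indep_sets: "finite B \<Longrightarrow> finite (indep_sets adj B m)"
  unfolding indep_sets_def by auto

lemma card_indep_sets_le: "finite B \<Longrightarrow> card (indep_sets adj B m) \<le> card B choose m"
  unfolding indep_sets_def by (subst n_subsets[symmetric]) (auto intro!: card_mono)

text \<open>Split by whether \<open>v\<close> is chosen; if it is, the rest avoids \<open>v\<close>
  and its neighbours.\<close>

lemma indep_sets_step:
  assumes "finite B" "v \<in> B" "symp adj"
  shows "card (indep_sets adj B (Suc m)) \<le>
    card (indep_sets adj (B - {v}) (Suc m)) + card (indep_sets adj {u \<in> B. u \<noteq> v \<and> \<not> adj v u} m)"
proof -
  let ?C = "{u \<in> B. u \<noteq> v \<and> \<not> adj v u}"
  have "indep_sets adj B (Suc m) \<subseteq>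
    indep_sets adj (B - {v}) (Suc m) \<union> insert v ` indep_sets adj ?C m"
  proof
    fix I assume I: "I \<in> indep_sets adj B (Suc m)"
    have fI: "finite I" using I assms finite_subset by (auto simp: indep_sets_def)
    show "I \<in> indep_sets adj (B - {v}) (Suc m) \<union> insert v ` indep_sets adj ?C m"
    proof (cases "v \<in> I")
      case False
      thus ?thesis using I by (auto simp: indep_sets_def)
    next
      case True
      hence "I - {v} \<in> indep_sets adj ?C m" using I fI by (auto simp: indep_sets_def)
      moreover have "I = insert v (I - {v})" using True by auto
      ultimately show ?thesis by blast
    qed
  qed
  hence "card (indep_sets adj B (Suc m)) \<le>
    card (indep_sets adj (B - {v}) (Suc m) \<union> insert v ` indep_sets adj ?C m)"
    using assms by (intro card_mono finite_UnI finite_imageI finite_indep_sets) auto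
  also have "\<dots> \<le> card (indep_sets adj (B - {v}) (Suc m)) + card (insert v ` indep_sets adj ?C m)"
    by (rule card_Un_le)
  also have "card (insert v ` indep_sets adj ?C m) \<le> card (indep_sets adj ?C m)"
    using assms by (intro card_image_le finite_indep_sets) auto
  finally show ?thesis by simp
qed

text \<open>The Kleitman--Winston argument: as long as more than \<open>R\<close> vertices remain, either the vertex \<open>v\<close>
  of large degree is discarded, or it is chosen (at most \<open>t\<close> times) and its neighbours are discarded.\<close>

lemma kleitman_winston:
  fixes \<beta> :: real and R :: nat
  assumes "finite B" "symp adj" "0 \<le> \<beta>" "\<beta> \<le> 1"
    and dense: "\<And>C. C \<subseteq> B \<Longrightarrow> card C > R \<Longrightarrow> \<exists>v\<in>C. real (card {u \<in> C. u \<noteq> v \<and> adj v u}) \<ge> \<beta> * card C"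
    and "(1 - \<beta>) ^ t * card B \<le> R"
  shows "card (indep_sets adj B m) \<le> (\<Sum>j\<le>min t m. (card B choose j) * (R choose (m - j)))"
  using assms(1,5,6)
proof (induction "card B" arbitrary: B t m rule: less_induct)
  case less
  show ?case
  proof (cases "card B \<le> R")
    case True
    have "card (indep_sets adj B m) \<le> card B choose m" using card_indep_sets_le less.prems by blast
    also have "\<dots> \<le> R choose m" using True by (intro binomial_right_mono) auto
    also have "\<dots> = (card B choose 0) * (R choose (m - 0))" by simp
    also have "\<dots> \<le> (\<Sum>j\<le>min t m. (card B choose j) * (R choose (m - j)))"
      by (rule member_le_sum) auto
    finally show ?thesis .
  next
    case False
    then obtain v where v: "v \<in> B" "real (card {u \<in> B. u \<noteq> v \<and> adj v u}) \<ge> \<beta> * card B"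
      using less.prems(2)[of B] by auto
    \<comment> \<open>With \<open>t = 0\<close> the last premise would give
      \<open>card B \<le> R\<close>.\<close>
    obtain s where s: "t = Suc s" using False less.prems(3) by (cases t) auto
    show ?thesis
    proof (cases m)
      case 0
      have "card (indep_sets adj B m) \<le> card B choose m" using card_indep_sets_le less.prems by blast
      thus ?thesis using 0 by simp
    next
      case (Suc l)
      let ?C = "{u \<in> B. u \<noteq> v \<and> \<not> adj v u}"
      have "card B > 0" using v less.prems by (auto simp: card_gt_0_iff)
      hence cB: "card (B - {v}) < card B" "card (B - {v}) = card B - 1" "card B > 0"
        using v less.prems \<open>card B > 0\<close> by simp_all
      have CB: "?C \<subseteq> B - {v}" by auto
      have cC: "card ?C \<le> card B - 1" using card_mono[OF _ CB] less.prems cB by auto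
      have "card ?C + card {u \<in> B. u \<noteq> v \<and> adj v u} = card (?C \<union> {u \<in> B. u \<noteq> v \<and> adj v u})"
        using less.prems by (intro card_Un_disjoint[symmetric]) auto
      also have "\<dots> \<le> card B" using less.prems by (intro card_mono) auto
      finally have "real (card ?C) \<le> (1 - \<beta>) * card B" using v by (simp add: algebra_simps)
      hence "(1 - \<beta>) ^ s * real (card ?C) \<le> (1 - \<beta>) ^ s * ((1 - \<beta>) * card B)"
        using assms by (intro mult_left_mono) auto
      also have "\<dots> \<le> R" using less.prems(3) s by (simp add: mult_ac)
      finally have sC: "(1 - \<beta>) ^ s * real (card ?C) \<le> R" .
      \<comment> \<open>Discarding \<open>v\<close> uses up no choice: the same \<open>t\<close>
        suffices for the smaller set.\<close>
      have "(1 - \<beta>) ^ t * real (card (B - {v})) \<le> (1 - \<beta>) ^ t * card B"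
        using assms cB by (intro mult_left_mono) auto
      hence sB: "(1 - \<beta>) ^ t * real (card (B - {v})) \<le> R" using less.prems(3) by linarith
      have "card (indep_sets adj (B - {v}) m) \<le> (\<Sum>j\<le>min t m. (card (B - {v}) choose j) * (R choose (m - j)))"
        by (rule less.hyps[OF cB(1) _ less.prems(2) sB]) (use less.prems in auto)
      also have "\<dots> = (R choose m) + (\<Sum>j\<le>min s l. ((card B - 1) choose Suc j) * (R choose (l - j)))"
        unfolding s Suc cB min_Suc_Suc by (subst sum.atMost_Suc_shift) simp
      finally have 1: "card (indep_sets adj (B - {v}) m) \<le> \<dots>" .
      have "card (indep_sets adj ?C l) \<le> (\<Sum>j\<le>min s l. (card ?C choose j) * (R choose (l - j)))"
        by (rule less.hyps[OF _ _ less.prems(2) sC]) (use cB cC less.prems in auto)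
      also have "\<dots> \<le> (\<Sum>j\<le>min s l. ((card B - 1) choose j) * (R choose (l - j)))"
        using cC by (intro sum_mono mult_right_mono binomial_right_mono) auto
      finally have 2: "card (indep_sets adj ?C l) \<le> \<dots>" .
      have "card (indep_sets adj B m) \<le>
          card (indep_sets adj (B - {v}) m) + card (indep_sets adj ?C l)"
        unfolding Suc using less.prems v assms by (intro indep_sets_step) auto
      also have "\<dots> \<le> (R choose m) + (\<Sum>j\<le>min s l. ((card B - 1) choose Suc j) * (R choose (l - j))) +
          (\<Sum>j\<le>min s l. ((card B - 1) choose j) * (R choose (l - j)))"
        using 1 2 by linarith
      \<comment> \<open>Pascal's rule merges the two branches. The index \<open>j\<close> counts the
        vertices chosen while more than \<open>R\<close> vertices remain.\<close>
      also have "\<dots> = (R choose m) + (\<Sum>j\<le>min s l. (card B choose Suc j) * (R choose (l - j)))"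
      proof -
        have "card B choose Suc j = ((card B - 1) choose Suc j) + ((card B - 1) choose j)" for j
          using cB(3) by (cases "card B") auto
        thus ?thesis by (simp add: sum.distrib algebra_simps)
      qed
      also have "\<dots> = (\<Sum>j\<le>min t m. (card B choose j) * (R choose (m - j)))"
        unfolding s Suc min_Suc_Suc by (subst sum.atMost_Suc_shift) simp
      finally show ?thesis .
    qed
  qed
qed

section \<open>Counting general position sets\<close>

text \<open>A single term of the exponential series; it plays the part of Stirling's lower bound on
  \<open>fact s\<close>.\<close>

lemma power_le_fact_exp: "real s ^ s \<le> fact s * exp (real s)"
proof -
  have "(\<lambda>n. inverse (fact n) * real s ^ n) sums exp (real s)"
    using exp_converges[of "real s"] by (simp add: scaleR_conv_of_real)
  hence "(\<Sum>n\<in>{s}. inverse (fact n) * real s ^ n) \<le> exp (real s)"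
    using sum_le_suminf[of "\<lambda>n. inverse (fact n) * real s ^ n" "{s}"] by (auto simp: sums_iff)
  thus ?thesis by (simp add: field_simps)
qed

text \<open>As \<open>R choose s\<close> is at most \<open>(e R / s) ^ s\<close>, the hypothesis
  makes the base of the \<open>s\<close>-th power at most \<open>exp (-2)\<close>.\<close>

lemma binomial_times_power_le:
  fixes p :: real
  assumes p: "p \<ge> 0" and s: "exp 3 * real R * p \<le> real s" "s > 0"
  shows "real (R choose s) * p ^ s \<le> exp (- 2 * real s)"
proof -
  have "real (R choose s) * fact s \<le> real R ^ s"
    using binomial_fact_pow[of R s] by (metis of_nat_fact of_nat_le_iff of_nat_mult of_nat_power)
  hence "real (R choose s) * fact s * (exp s * p ^ s) \<le> real R ^ s * (exp s * p ^ s)"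
    using p by (intro mult_right_mono) auto
  also have "\<dots> = (exp 1 * real R * p) ^ s"
    by (simp add: power_mult_distrib flip: exp_of_nat_mult)
  also have "\<dots> \<le> (exp (-2) * real s) ^ s"
  proof (rule power_mono)
    have "exp (-2) * (exp 3 * real R * p) \<le> exp (-2) * real s" using s by (intro mult_left_mono) auto
    moreover have e: "exp 1 = exp (-2) * (exp 3 :: real)" by (simp flip: exp_add)
    ultimately show "exp 1 * real R * p \<le> exp (-2) * real s" unfolding e by (simp only: mult.assoc)
  qed (use p in auto)
  also have "\<dots> = exp (- 2 * real s) * real s ^ s"
    by (simp add: power_mult_distrib mult.commute flip: exp_of_nat_mult)
  also have "\<dots> \<le> exp (- 2 * real s) * (fact s * exp (real s))"
    by (intro mult_left_mono power_le_fact_exp) auto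
  finally have "(fact s * exp (real s)) * (real (R choose s) * p ^ s) \<le>
      (fact s * exp (real s)) * exp (- 2 * real s)" by (simp add: mult_ac)
  thus ?thesis by (subst (asm) mult_le_cancel_left_pos) auto
qed

context finite_affine_space
begin

lemma finite_gp_sets: "finite {I. gp I \<and> card I = m}"
  by (rule finite_subset[of _ "Pow V"]) (auto dest: gp_V)

text \<open>Averaging: some vertex has at least the mean degree.\<close>

lemma edges_imp_degree:
  assumes B: "finite B" "B \<noteq> {}" and E: "\<beta> * (real (card B))\<^sup>2 \<le> real (card (edges X B))"
  shows "\<exists>v\<in>B. \<beta> * real (card B) \<le>
    real (card {u \<in> B. u \<noteq> v \<and> (\<exists>Y\<in>codim2_sets X. related Y v u)})"
proof (rule ccontr)
  let ?N = "\<lambda>v. {u \<in> B. u \<noteq> v \<and> (\<exists>Y\<in>codim2_sets X. related Y v u)}"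
  assume "\<not> ?thesis"
  hence "(\<Sum>v\<in>B. real (card (?N v))) < (\<Sum>v\<in>B. \<beta> * real (card B))"
    using B by (intro sum_strict_mono) (auto simp: not_le)
  also have "\<dots> = \<beta> * (real (card B))\<^sup>2" by (simp add: power2_eq_square mult_ac)
  also have "edges X B = Sigma B ?N" by (auto simp: edges_def)
  hence "real (card (edges X B)) = (\<Sum>v\<in>B. real (card (?N v)))"
    using B by (simp add: card_SigmaI)
  ultimately show False using E by linarith
qed

lemma card_gp_sets_le:
  fixes \<beta> :: real
  assumes \<beta>: "0 \<le> \<beta>" "\<beta> \<le> 1" and k: "k \<le> m" and d: "d \<ge> 1"
    and dense: "\<And>X B. gp X \<Longrightarrow> card X = k \<Longrightarrow> B \<subseteq> V \<Longrightarrow> card B > N \<Longrightarrow>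
       \<beta> * (real (card B))\<^sup>2 \<le> real (card (edges X B))"
    and t: "(1 - \<beta>) ^ t * real (q ^ d) \<le> real N"
  shows "card {I. gp I \<and> card I = m} \<le>
     (q ^ d choose k) * (\<Sum>j\<le>min t (m - k). (q ^ d choose j) * (N choose (m - k - j)))"
proof -
  let ?adj = "\<lambda>X y u. \<exists>Y\<in>codim2_sets X. related Y y u"
  let ?G = "{X. gp X \<and> card X = k}"
  let ?J = "\<lambda>X. indep_sets (?adj X) V (m - k)"
  have "{I. gp I \<and> card I = m} \<subseteq> (\<Union>X\<in>?G. (\<lambda>J. X \<union> J) ` ?J X)"
  proof
    fix I assume "I \<in> {I. gp I \<and> card I = m}"
    hence I: "gp I" "card I = m" by auto
    obtain X where X: "X \<subseteq> I" "card X = k" "finite X"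
      using obtain_subset_with_card_n[of k I] I k by auto
    have fI: "finite I" using gp_finite I by auto
    \<comment> \<open>An edge inside \<open>I - X\<close> would put \<open>d + 1\<close> points of
      \<open>I\<close> on one hyperplane: the \<open>d - 1\<close> points of \<open>Y\<close>
      together with \<open>y\<close> and \<open>u\<close>.\<close>
    have "\<not> related Y y u" if y: "y \<in> I - X" "u \<in> I - X" "y \<noteq> u" and Y: "Y \<in> codim2_sets X" for y u Y
    proof -
      have fY: "finite Y" "Y \<subseteq> X" "card Y = d - 1"
        using Y X finite_subset by (auto simp: codim2_sets_def)
      have "y \<notin> Y" "u \<notin> Y" using y fY by auto
      hence "card (insert y (insert u Y)) = d + 1" using fY y d by simp
      moreover have "insert y (insert u Y) \<subseteq> I" using fY X y by auto
      ultimately show ?thesis using I(1) by (simp add: related_def gp_def)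
    qed
    hence "I - X \<in> ?J X"
      using X I gp_V[OF I(1)] by (auto simp: indep_sets_def card_Diff_subset)
    moreover have "I = X \<union> (I - X)" using X by auto
    moreover have "X \<in> ?G" using gp_subset[OF I(1) X(1)] X by auto
    ultimately show "I \<in> (\<Union>X\<in>?G. (\<lambda>J. X \<union> J) ` ?J X)" by blast
  qed
  hence "card {I. gp I \<and> card I = m} \<le> card (\<Union>X\<in>?G. (\<lambda>J. X \<union> J) ` ?J X)"
    by (intro card_mono finite_UN_I finite_gp_sets finite_imageI finite_indep_sets finite_V)
  also have "\<dots> \<le> (\<Sum>X\<in>?G. card ((\<lambda>J. X \<union> J) ` ?J X))"
    by (rule card_UN_le[OF finite_gp_sets])
  also have "\<dots> \<le> (\<Sum>X\<in>?G. \<Sum>j\<le>min t (m - k). (q ^ d choose j) * (N choose (m - k - j)))"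
  proof (rule sum_mono)
    fix X assume X: "X \<in> ?G"
    have "card ((\<lambda>J. X \<union> J) ` ?J X) \<le> card (?J X)"
      by (intro card_image_le finite_indep_sets finite_V)
    also have "\<dots> \<le> (\<Sum>j\<le>min t (m - k). (card V choose j) * (N choose (m - k - j)))"
    proof (rule kleitman_winston[OF finite_V _ \<beta>])
      show "symp (?adj X)" by (rule sympI) (auto simp: related_sym)
      show "(1 - \<beta>) ^ t * real (card V) \<le> real N" using t by (simp add: card_V)
      fix C assume C: "C \<subseteq> V" "card C > N"
      show "\<exists>v\<in>C. \<beta> * real (card C) \<le> real (card {u \<in> C. u \<noteq> v \<and> ?adj X v u})"
        using edges_imp_degree[of C \<beta> X] dense[of X C] X C finite_subset[OF C(1) finite_V] by force
    qed
    finally show "card ((\<lambda>J. X \<union> J) ` ?J X) \<le>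
        (\<Sum>j\<le>min t (m - k). (q ^ d choose j) * (N choose (m - k - j)))" by (simp add: card_V)
  qed
  also have "\<dots> = card ?G * (\<Sum>j\<le>min t (m - k). (q ^ d choose j) * (N choose (m - k - j)))" by simp
  also have "card ?G \<le> q ^ d choose k"
    using card_mono[of "{X. X \<subseteq> V \<and> card X = k}" ?G] gp_V n_subsets[OF finite_V, of k] card_V by auto
  finally show ?thesis by simp
qed

text \<open>Balance of the constants: \<open>k\<close> is about \<open>m / (4 d ln q)\<close>, so
  choosing \<open>X\<close> and up to \<open>k\<close> vertices in the Kleitman-Winston process
  costs at most \<open>exp (m / 4)\<close> each. The other \<open>s \<ge> m / 2\<close> points
  contribute at most \<open>exp (- 2 s) \<le> exp (- m)\<close>, which wins by
  \<open>exp (- m / 2)\<close>. The factor \<open>m\<close> pays for the sum over \<open>j\<close>.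
  The density \<open>\<beta>\<close> is set so that \<open>k\<close> choices shrink
  \<open>q ^ d\<close> vertices to at most one.\<close>

lemma gp_sets_first_moment:
  fixes \<beta> p :: real
  defines "l \<equiv> ln (real q)"
  assumes \<beta>: "\<beta> = 8 * (real d)\<^sup>2 * l\<^sup>2 / real m" "\<beta> \<le> 1"
    and k: "k = nat \<lfloor>real m / (4 * real d * l)\<rfloor>"
    and K: "real m / (4 * real d * l) \<ge> 2" and dl: "real d * l \<ge> 1"
    and p: "0 \<le> p" "p \<le> 1" and N: "N \<ge> 1" "2 * exp 3 * real N * p \<le> real m" 
    and dense: "\<And>X B. gp X \<Longrightarrow> card X = k \<Longrightarrow> B \<subseteq> V \<Longrightarrow> card B > N \<Longrightarrow>
       \<beta> * (real (card B))\<^sup>2 \<le> real (card (edges X B))"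
  shows "real (card {I. gp I \<and> card I = m}) * p ^ m \<le> real m * exp (- real m / 2)"
proof -
  define K where "K = real m / (4 * real d * l)"
  have m0: "m > 0" using K by (cases m) auto
  have d1: "d \<ge> 1" using dl by (cases d) auto
  have q2: "real q \<ge> 2" using q_ge_2 by simp
  have l0: "l > 0" unfolding l_def using q2 by simp
  have kK: "real k \<le> K" unfolding k K_def[symmetric] using K unfolding K_def[symmetric] by linarith
  have kK': "K / 2 \<le> real k" unfolding k K_def[symmetric] using K unfolding K_def[symmetric] by linarith
  have Km: "K * (real d * l) = real m / 4" unfolding K_def using l0 d1 by (simp add: field_simps)
  have "K * 1 \<le> K * (real d * l)" using dl K unfolding K_def[symmetric] by (intro mult_left_mono) auto
  hence K4: "K \<le> real m / 4" using Km by simp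
  have k4: "real k \<le> real m / 4" using kK K4 by linarith
  have km: "k \<le> m" using k4 by linarith
  have \<beta>0: "0 \<le> \<beta>" unfolding \<beta> by simp
  have \<beta>k: "real d * l \<le> \<beta> * real k"
  proof -
    \<comment> \<open>The constant 8 in \<open>\<beta>\<close> is tailored to this identity; the
      half absorbs the rounding in \<open>k\<close>.\<close>
    have "\<beta> * (K / 2) = real d * l"
      unfolding \<beta> K_def using l0 d1 m0 by (simp add: field_simps power2_eq_square)
    thus ?thesis using mult_left_mono[OF kK' \<beta>0] by simp
  qed
  have qd: "real (q ^ d) = exp (real d * l)"
    unfolding l_def using q2 by (simp add: exp_of_nat_mult)
  have "(1 - \<beta>) ^ k \<le> exp (- \<beta>) ^ k"
    using \<beta> exp_ge_add_one_self[of "- \<beta>"] by (intro power_mono) auto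
  also have "\<dots> = exp (- (\<beta> * real k))" by (simp flip: exp_of_nat_mult add: mult.commute)
  also have "\<dots> \<le> exp (- (real d * l))" using \<beta>k by simp
  finally have "(1 - \<beta>) ^ k * real (q ^ d) \<le> exp (- (real d * l)) * exp (real d * l)"
    unfolding qd by (intro mult_right_mono) auto
  also have "\<dots> = 1" by (simp flip: exp_add)
  \<comment> \<open>Hence \<open>k\<close>, the size of \<open>X\<close>, can also serve as the
    number \<open>t\<close> of choices.\<close>
  finally have t: "(1 - \<beta>) ^ k * real (q ^ d) \<le> real N" using N by linarith
  have "card {I. gp I \<and> card I = m} \<le>
     (q ^ d choose k) * (\<Sum>j\<le>min k (m - k). (q ^ d choose j) * (N choose (m - k - j)))"
    by (rule card_gp_sets_le[OF \<beta>0 \<beta>(2) km d1 dense t])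
  hence "real (card {I. gp I \<and> card I = m}) \<le>
     real ((q ^ d choose k) * (\<Sum>j\<le>min k (m - k). (q ^ d choose j) * (N choose (m - k - j))))"
    by (simp only: of_nat_le_iff)
  hence "real (card {I. gp I \<and> card I = m}) * p ^ m \<le>
     real ((q ^ d choose k) * (\<Sum>j\<le>min k (m - k). (q ^ d choose j) * (N choose (m - k - j)))) * p ^ m"
    using p by (intro mult_right_mono) auto
  also have "\<dots> = (\<Sum>j\<le>min k (m - k). real (q ^ d choose k) * real (q ^ d choose j) *
      (real (N choose (m - k - j)) * p ^ m))"
    by (simp add: sum_distrib_left sum_distrib_right mult_ac)
  also have "\<dots> \<le> (\<Sum>j\<le>min k (m - k). exp (- real m / 2))"
  proof (rule sum_mono)
    fix j assume j: "j \<in> {..min k (m - k)}"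
    define s where "s = m - k - j"
    \<comment> \<open>\<open>X\<close> and the chosen vertices take at most a quarter of the
      \<open>m\<close> points each.\<close>
    have sm: "real s \<ge> real m / 2" using j k4 unfolding s_def by (auto simp: of_nat_diff)
    hence s0: "s > 0" using m0 by (cases s) auto
    have "exp 3 * real N * p \<le> real s" using N sm by linarith
    hence 1: "real (N choose s) * p ^ s \<le> exp (- 2 * real s)"
      by (intro binomial_times_power_le p s0)
    \<comment> \<open>Only \<open>s\<close> of the factors \<open>p\<close> are exploited; the
      others are bounded by 1.\<close>
    have "real (N choose s) * p ^ m \<le> real (N choose s) * p ^ s"
      using p by (intro mult_left_mono power_decreasing) (auto simp: s_def)
    also note 1
    also have "exp (- 2 * real s) \<le> exp (- real m)" using sm by simp
    finally have 2: "real (N choose s) * p ^ m \<le> exp (- real m)" .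
    have b: "real (q ^ d choose i) \<le> exp (real d * l) ^ k" if "i \<le> k" for i
    proof -
      have "real (q ^ d choose i) \<le> real (q ^ d) ^ i"
        using binomial_le_pow[of i "q ^ d"]
        by (cases "i \<le> q ^ d") (simp_all add: binomial_eq_0 flip: of_nat_power)
      also have "\<dots> \<le> real (q ^ d) ^ k" using that q_ge_2 by (intro power_increasing) auto
      finally show ?thesis by (simp only: qd)
    qed
    have "real (q ^ d choose k) * real (q ^ d choose j) * (real (N choose s) * p ^ m)
      \<le> exp (real d * l) ^ k * exp (real d * l) ^ k * exp (- real m)"
      using b[of k] b[of j] j 2 p by (intro mult_mono) auto
    also have "\<dots> = exp (2 * (real k * (real d * l)) - real m)"
      by (simp add: mult_exp_exp flip: exp_of_nat_mult)
    also have "\<dots> \<le> exp (- real m / 2)"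
    proof -
      have "real k * (real d * l) \<le> K * (real d * l)" using kK dl by (intro mult_right_mono) auto
      thus ?thesis using Km by simp
    qed
    finally show "real (q ^ d choose k) * real (q ^ d choose j) *
      (real (N choose (m - k - j)) * p ^ m) \<le> exp (- real m / 2)" unfolding s_def .
  qed
  also have "\<dots> = real (min k (m - k) + 1) * exp (- real m / 2)" by simp
  also have "\<dots> \<le> real m * exp (- real m / 2)"
    using k4 K4 K unfolding K_def[symmetric] by (intro mult_right_mono) auto
  finally show ?thesis .
qed

section \<open>Two density estimates for the graph on \<open>B\<close>\<close>

lemma total_mult_ge':
  assumes d: "d \<ge> 2" and X: "gp X" "card X \<ge> d + 1" and B: "B \<subseteq> V" "real (card B) \<ge> 4 * real q"
  shows "real (card X choose (d - 1)) * ((real (card B))\<^sup>2 / (4 * real q)) \<le> real (total_mult X B)"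
proof -
  have q2: "real q \<ge> 2" using q_ge_2 by simp
  let ?b = "real (card B)"
  \<comment> \<open>From \<open>4 * q\<close> points on, the diagonal is at most half of the main
    term.\<close>
  have "?b * (4 * real q) \<le> ?b * ?b" using B by (intro mult_left_mono) auto
  hence "?b \<le> ?b\<^sup>2 / (4 * real q)" using q2 by (simp add: field_simps power2_eq_square)
  moreover have "?b\<^sup>2 / (2 * real q) \<le> ?b\<^sup>2 / real (q + 1)"
    using q2 by (intro divide_left_mono) auto
  moreover have "?b\<^sup>2 / (2 * real q) = 2 * (?b\<^sup>2 / (4 * real q))" using q2 by simp
  ultimately have "?b\<^sup>2 / (4 * real q) \<le> ?b\<^sup>2 / real (q + 1) - ?b" by linarith
  hence "real (card X choose (d - 1)) * (?b\<^sup>2 / (4 * real q)) \<le>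
    real (card X choose (d - 1)) * (?b\<^sup>2 / real (q + 1) - ?b)"
    by (intro mult_left_mono) auto
  also have "\<dots> \<le> real (total_mult X B)" by (rule total_mult_ge[OF d X B(1)])
  finally show ?thesis .
qed

text \<open>The total multiplicity is divided by the largest multiplicity of a pair. Since
  \<open>k choose (d - 1)\<close> exceeds \<open>k choose (d - 2)\<close> by a factor of order
  \<open>k / d\<close>, the density obtained is linear in \<open>card X\<close>.\<close>

lemma card_edges_ge_linear:
  assumes d: "d \<ge> 2" and X: "gp X" "card X \<ge> 2 * d" and B: "B \<subseteq> V" "real (card B) \<ge> 4 * real q"
  shows "real (card X) / (8 * (real d)\<^sup>2 * real q) * (real (card B))\<^sup>2 \<le> real (card (edges X B))"
proof -
  let ?k = "card X" and ?b = "real (card B)" and ?E = "real (card (edges X B))"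
  have q2: "real q \<ge> 2" using q_ge_2 by simp
  have "real (?k choose (d - 1)) * (?b\<^sup>2 / (4 * real q)) \<le> real (total_mult X B)"
    by (rule total_mult_ge'[OF d X(1) _ B]) (use X d in simp)
  also have "\<dots> \<le> real (d * (?k choose (d - 2)) * card (edges X B))"
    using total_mult_le[OF d X(1) B(1)] by (simp only: of_nat_le_iff)
  finally have 1: "real (?k choose (d - 1)) * (?b\<^sup>2 / (4 * real q)) \<le>
     real d * real (?k choose (d - 2)) * ?E" by simp
  \<comment> \<open>The ratio of the two binomial coefficients, in multiplied form.\<close>
  have "Suc (d - 2) * (?k choose Suc (d - 2)) = (?k - (d - 2)) * (?k choose (d - 2))"
    by (metis binomial_absorption binomial_absorb_comp mult.commute)
  moreover have "Suc (d - 2) = d - 1" using d by simp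
  ultimately have "(d - 1) * (?k choose (d - 1)) = (?k - (d - 2)) * (?k choose (d - 2))" by metis
  hence 2: "real (d - 1) * real (?k choose (d - 1)) = real (?k - (d - 2)) * real (?k choose (d - 2))"
    by (metis of_nat_mult)
  have "real (?k choose (d - 2)) * (real (?k - (d - 2)) * (?b\<^sup>2 / (4 * real q)))
     = real (d - 1) * (real (?k choose (d - 1)) * (?b\<^sup>2 / (4 * real q)))"
    using 2 by (simp add: mult_ac)
  also have "\<dots> \<le> real (d - 1) * (real d * real (?k choose (d - 2)) * ?E)"
    using 1 by (rule mult_left_mono) simp
  finally have "real (?k choose (d - 2)) * (real (?k - (d - 2)) * (?b\<^sup>2 / (4 * real q))) \<le>
     real (?k choose (d - 2)) * (real (d - 1) * real d * ?E)" by (simp only: mult_ac)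
  moreover have "real (?k choose (d - 2)) > 0" using X by (simp add: zero_less_binomial_iff)
  ultimately have 3: "real (?k - (d - 2)) * (?b\<^sup>2 / (4 * real q)) \<le> real (d - 1) * real d * ?E"
    using mult_le_cancel_left_pos by blast
  have "real ?k / 2 * (?b\<^sup>2 / (4 * real q)) \<le> real (?k - (d - 2)) * (?b\<^sup>2 / (4 * real q))"
    using X q2 by (intro mult_right_mono) (auto simp: of_nat_diff)
  also note 3
  also have "real (d - 1) * real d * ?E \<le> (real d)\<^sup>2 * ?E"
    unfolding power2_eq_square by (intro mult_right_mono) auto
  finally show ?thesis using q2 d by (simp add: field_simps)
qed

text \<open>With too few edges the inequality of \<open>total_mult_squared_le\<close> breaks down:
  each of the three upper bounds on \<open>\<beta>\<close> limits the contribution of one of its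
  three summands to a third of the squared total multiplicity.\<close>

lemma card_edges_ge_quadratic:
  fixes \<beta> :: real
  assumes d: "d \<ge> 2" and X: "gp X" "card X \<ge> d + 1" and B: "B \<subseteq> V" "real (card B) \<ge> 4 * real q"
    and \<beta>0: "\<beta> \<ge> 0"
    and \<beta>1: "\<beta> \<le> real (card X choose (d - 1)) / (12 * real q)"
    and \<beta>2: "\<beta> \<le> real (card B) / (144 * real q ^ d)"
    and \<beta>3: "\<beta> \<le> real (card X choose (d - 1)) * (real (card B))\<^sup>2 / (48 * real d * real (card X) * real q ^ (2 * d))"
  shows "\<beta> * (real (card B))\<^sup>2 \<le> real (card (edges X B))"
proof (rule ccontr)
  define M b k T E Q where "M = real (card X choose (d - 1))" and "b = real (card B)"
    and "k = real (card X)" and "T = real (total_mult X B)" and "E = real (card (edges X B))"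
    and "Q = real q"
  note defs = M_def b_def k_def T_def E_def Q_def
  assume "\<not> ?thesis"
  hence E: "E < \<beta> * b\<^sup>2" by (simp add: defs)
  have Q2: "Q \<ge> 2" using q_ge_2 by (simp add: Q_def)
  have b0: "b > 0" using B Q2 by (simp add: defs)
  have k0: "k > 0" using X by (simp add: defs)
  have M0: "M > 0" unfolding M_def using X by (simp add: zero_less_binomial_iff)
  have d0: "real d > 0" using d by simp
  have T: "M * (b\<^sup>2 / (4 * Q)) \<le> T" unfolding defs by (rule total_mult_ge'[OF d X B])
  have "0 < M * (b\<^sup>2 / (4 * Q))" using M0 b0 Q2 by simp
  hence T0: "T > 0" using T by linarith
  define A C where "A = M\<^sup>2 * (3 * b * Q ^ (d - 2))" and "C = M * (real d * k) * Q ^ (2 * (d - 1))"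
  have A0: "A \<ge> 0" and C0: "C \<ge> 0" unfolding A_def C_def using M0 b0 k0 Q2 by simp_all
  have "real ((total_mult X B)\<^sup>2) \<le> real (card (edges X B) *
    (total_mult X B + (card X choose (d - 1))\<^sup>2 * (3 * card B * q ^ (d - 2)) +
      (card X choose (d - 1)) * (d * card X) * q ^ (2 * (d - 1))))"
    using total_mult_squared_le[OF d X B(1)] by (simp only: of_nat_le_iff)
  hence main: "T\<^sup>2 \<le> E * (T + A + C)" by (simp add: defs A_def C_def)
  have Tsq: "M\<^sup>2 * b ^ 4 / (16 * Q\<^sup>2) \<le> T\<^sup>2"
  proof -
    have "(M * (b\<^sup>2 / (4 * Q)))\<^sup>2 \<le> T\<^sup>2"
      using T M0 Q2 by (intro power_mono) auto
    thus ?thesis by (simp add: power_mult_distrib power_divide flip: power_mult)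
  qed
  have dd: "2 * d = 2 * (d - 1) + 2" using d by simp
  have Qd: "Q ^ d = Q ^ (d - 2) * Q\<^sup>2" "Q ^ (2 * d) = Q ^ (2 * (d - 1)) * Q\<^sup>2"
    using d by (metis le_add_diff_inverse2 power_add, metis dd power_add)
  have "\<beta> * b\<^sup>2 \<le> M / (12 * Q) * b\<^sup>2" using \<beta>1 by (intro mult_right_mono) (auto simp: defs)
  also have "\<dots> \<le> T / 3" using T by (simp add: mult_ac)
  finally have "\<beta> * b\<^sup>2 * T \<le> T / 3 * T" using T0 by (intro mult_right_mono) auto
  hence 1: "\<beta> * b\<^sup>2 * T \<le> T\<^sup>2 / 3" by (simp add: power2_eq_square)
  have "\<beta> * (b\<^sup>2 * A) \<le> b / (144 * Q ^ d) * (b\<^sup>2 * A)"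
    using \<beta>2 A0 by (intro mult_right_mono) (auto simp: defs)
  also have "\<dots> = (M\<^sup>2 * b ^ 4 / (16 * Q\<^sup>2)) / 3"
    unfolding A_def Qd using Q2 by (simp add: field_simps power2_eq_square power4_eq_xxxx)
  also have "\<dots> \<le> T\<^sup>2 / 3" using Tsq by simp
  finally have 2: "\<beta> * b\<^sup>2 * A \<le> T\<^sup>2 / 3" by (simp add: mult.assoc)
  have "\<beta> * (b\<^sup>2 * C) \<le> M * b\<^sup>2 / (48 * real d * k * Q ^ (2 * d)) * (b\<^sup>2 * C)"
    using \<beta>3 C0 by (intro mult_right_mono) (auto simp: defs)
  also have "\<dots> = (M\<^sup>2 * b ^ 4 / (16 * Q\<^sup>2)) / 3"
    unfolding C_def Qd using Q2 k0 d0 by (simp add: field_simps power2_eq_square power4_eq_xxxx)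
  also have "\<dots> \<le> T\<^sup>2 / 3" using Tsq by simp
  finally have 3: "\<beta> * b\<^sup>2 * C \<le> T\<^sup>2 / 3" by (simp add: mult.assoc)
  have "E * (T + A + C) < \<beta> * b\<^sup>2 * (T + A + C)"
    using E T0 A0 C0 by (intro mult_strict_right_mono) auto
  also have "\<dots> = \<beta> * b\<^sup>2 * T + \<beta> * b\<^sup>2 * A + \<beta> * b\<^sup>2 * C" by (simp add: distrib_left)
  also have "\<dots> \<le> T\<^sup>2" using 1 2 3 by linarith
  finally show False using main by linarith
qed

end

section \<open>Random subsets\<close>

lemma set_random_subset: "finite V \<Longrightarrow> set_pmf (random_subset V p) \<subseteq> Pow V"
  unfolding random_subset_def by auto

lemma finite_set_random_subset: "finite V \<Longrightarrow> finite (set_pmf (random_subset V p))"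
  using finite_subset[OF set_random_subset] by blast

lemma integrable_random_subset:
  fixes f :: "_ \<Rightarrow> real"
  shows "finite V \<Longrightarrow> integrable (measure_pmf (random_subset V p)) f"
  by (rule integrable_measure_pmf_finite[OF finite_set_random_subset])

lemma prob_random_subset_superset:
  assumes V: "finite V" and A: "A \<subseteq> V" and p: "0 \<le> p" "p \<le> 1"
  shows "measure_pmf.prob (random_subset V p) {S. A \<subseteq> S} = p ^ card A"
proof -
  have "measure_pmf.prob (random_subset V p) {S. A \<subseteq> S} =
    measure_pmf.prob (Pi_pmf V False (\<lambda>_. bernoulli_pmf p)) (Pi V (\<lambda>x. if x \<in> A then {True} else UNIV))"
    unfolding random_subset_def measure_map_pmf
    by (rule arg_cong[where f = "measure_pmf.prob _"]) (use A in \<open>auto simp: Pi_def split: if_splits\<close>)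
  also have "\<dots> = (\<Prod>x\<in>V. measure_pmf.prob (bernoulli_pmf p) (if x \<in> A then {True} else UNIV))"
    by (rule measure_Pi_pmf_Pi[OF V])
  also have "\<dots> = (\<Prod>x\<in>V. if x \<in> A then p else 1)"
    using p by (intro prod.cong) (auto simp: measure_pmf_single)
  also have "\<dots> = (\<Prod>x\<in>A. p)"
    using A V by (simp add: prod.If_cases Int_absorb1)
  finally show ?thesis by simp
qed

lemma expectation_card_subsets:
  assumes V: "finite V" and F: "finite F" "\<And>A. A \<in> F \<Longrightarrow> A \<subseteq> V" and p: "0 \<le> p" "p \<le> 1"
  shows "measure_pmf.expectation (random_subset V p) (\<lambda>S. real (card {A \<in> F. A \<subseteq> S})) =
    (\<Sum>A\<in>F. p ^ card A)"
proof -
  have "real (card {A \<in> F. A \<subseteq> S}) = (\<Sum>A\<in>F. indicator {S. A \<subseteq> S} S)" for S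
    using F(1) by (simp add: indicator_def sum.If_cases Int_def)
  hence "measure_pmf.expectation (random_subset V p) (\<lambda>S. real (card {A \<in> F. A \<subseteq> S})) =
    measure_pmf.expectation (random_subset V p) (\<lambda>S. \<Sum>A\<in>F. indicator {S. A \<subseteq> S} S)"
    by simp
  also have "\<dots> = (\<Sum>A\<in>F. measure_pmf.expectation (random_subset V p) (indicator {S. A \<subseteq> S}))"
    by (intro Bochner_Integration.integral_sum integrable_random_subset V)
  also have "\<dots> = (\<Sum>A\<in>F. p ^ card A)"
    by (intro sum.cong) (simp_all add: prob_random_subset_superset[OF V F(2) p])
  finally show ?thesis .
qed

lemma prob_card_subsets_ge:
  assumes V: "finite V" and F: "finite F" "\<And>A. A \<in> F \<Longrightarrow> A \<subseteq> V" and p: "0 \<le> p" "p \<le> 1" and c: "c > 0"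
  shows "measure_pmf.prob (random_subset V p) {S. real (card {A \<in> F. A \<subseteq> S}) \<ge> c} \<le>
    (\<Sum>A\<in>F. p ^ card A) / c"
  using integral_Markov_inequality_measure[of "measure_pmf (random_subset V p)"
      "\<lambda>S. real (card {A \<in> F. A \<subseteq> S})" "{}" c]
  by (simp add: integrable_random_subset[OF V] c expectation_card_subsets[OF V F p])

lemma expectation_card_Int:
  assumes V: "finite V" and G: "G \<subseteq> V" and p: "0 \<le> p" "p \<le> 1"
  shows "measure_pmf.expectation (random_subset V p) (\<lambda>S. real (card (S \<inter> G))) = real (card G) * p"
    and "measure_pmf.expectation (random_subset V p) (\<lambda>S. (real (card (S \<inter> G)))\<^sup>2) \<le>
      (real (card G) * p)\<^sup>2 + real (card G) * p"
proof -
  have fG: "finite G" using V G finite_subset by blast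
  let ?E = "measure_pmf.expectation (random_subset V p)"
  have c: "real (card (S \<inter> G)) = (\<Sum>x\<in>G. indicator {S. {x} \<subseteq> S} S)" for S
    using fG by (simp add: indicator_def sum.If_cases Int_def conj_commute)
  have "?E (\<lambda>S. real (card (S \<inter> G))) = ?E (\<lambda>S. \<Sum>x\<in>G. indicator {S. {x} \<subseteq> S} S)"
    by (simp only: c)
  also have "\<dots> = (\<Sum>x\<in>G. ?E (indicator {S. {x} \<subseteq> S}))"
    by (intro Bochner_Integration.integral_sum integrable_random_subset V)
  also have "\<dots> = (\<Sum>x\<in>G. p)"
    using prob_random_subset_superset[OF V _ p, of "{x}" for x] G
    by (intro sum.cong) (auto simp: subset_iff)
  finally show "?E (\<lambda>S. real (card (S \<inter> G))) = real (card G) * p" by simp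
  have "(real (card (S \<inter> G)))\<^sup>2 = (\<Sum>z\<in>G \<times> G. indicator {S. {fst z, snd z} \<subseteq> S} S)" for S
    unfolding c power2_eq_square sum_product sum.cartesian_product
    by (intro sum.cong) (auto simp: indicator_def)
  hence "?E (\<lambda>S. (real (card (S \<inter> G)))\<^sup>2) = ?E (\<lambda>S. \<Sum>z\<in>G \<times> G. indicator {S. {fst z, snd z} \<subseteq> S} S)"
    by (simp only:)
  also have "\<dots> = (\<Sum>z\<in>G \<times> G. ?E (indicator {S. {fst z, snd z} \<subseteq> S}))"
    by (intro Bochner_Integration.integral_sum integrable_random_subset V)
  also have "\<dots> = (\<Sum>z\<in>G \<times> G. p ^ card {fst z, snd z})"
  proof (rule sum.cong[OF refl])
    fix z assume "z \<in> G \<times> G"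
    hence "{fst z, snd z} \<subseteq> V" using G by auto
    from prob_random_subset_superset[OF V this p]
    show "?E (indicator {S. {fst z, snd z} \<subseteq> S}) = p ^ card {fst z, snd z}" by simp
  qed
  also have "\<dots> \<le> (\<Sum>z\<in>G \<times> G. p\<^sup>2 + (if fst z = snd z then p else 0))"
    using p by (intro sum_mono) (auto simp: card_insert_if power2_eq_square)
  also have "\<dots> = (\<Sum>x\<in>G. \<Sum>y\<in>G. p\<^sup>2 + (if x = y then p else 0))"
    by (simp add: sum.cartesian_product case_prod_beta)
  also have "\<dots> = (real (card G) * p)\<^sup>2 + real (card G) * p"
    using fG by (simp add: sum.distrib sum.delta' power2_eq_square algebra_simps)
  finally show "?E (\<lambda>S. (real (card (S \<inter> G)))\<^sup>2) \<le> (real (card G) * p)\<^sup>2 + real (card G) * p" .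
qed

text \<open>Chebyshev's inequality: distinct points are present independently, so the variance is at
  most the mean.\<close>

lemma prob_card_Int_deviation:
  assumes V: "finite V" and G: "G \<subseteq> V" and p: "0 \<le> p" "p \<le> 1" and pos: "real (card G) * p > 0"
  defines "\<mu> \<equiv> real (card G) * p"
  shows "measure_pmf.prob (random_subset V p) {S. \<bar>real (card (S \<inter> G)) - \<mu>\<bar> \<ge> \<mu> / 2} \<le> 4 / \<mu>"
proof -
  let ?M = "measure_pmf (random_subset V p)"
  let ?E = "measure_pmf.expectation (random_subset V p)"
  let ?X = "\<lambda>S. real (card (S \<inter> G))"
  note int [simp] = integrable_random_subset[OF V]
  have "?E (\<lambda>S. (?X S - \<mu>)\<^sup>2) = ?E (\<lambda>S. (?X S)\<^sup>2 - 2 * \<mu> * ?X S + \<mu>\<^sup>2)"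
    by (intro Bochner_Integration.integral_cong) (auto simp: power2_diff)
  also have "\<dots> = ?E (\<lambda>S. (?X S)\<^sup>2) - 2 * \<mu> * ?E ?X + \<mu>\<^sup>2"
    by (simp add: Bochner_Integration.integral_add Bochner_Integration.integral_diff)
  also have "\<dots> \<le> \<mu>"
    using expectation_card_Int(2)[OF V G p]
    unfolding expectation_card_Int(1)[OF V G p] \<mu>_def[symmetric] by (simp add: power2_eq_square)
  finally have var: "?E (\<lambda>S. (?X S - \<mu>)\<^sup>2) \<le> \<mu>" .
  have \<mu>: "\<mu> > 0" using pos by (simp add: \<mu>_def)
  have "{S. \<bar>?X S - \<mu>\<bar> \<ge> \<mu> / 2} \<subseteq> {S. (?X S - \<mu>)\<^sup>2 \<ge> (\<mu> / 2)\<^sup>2}"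
    using \<mu> by (auto simp: abs_le_square_iff[symmetric])
  hence "measure ?M {S. \<bar>?X S - \<mu>\<bar> \<ge> \<mu> / 2} \<le> measure ?M {S. (?X S - \<mu>)\<^sup>2 \<ge> (\<mu> / 2)\<^sup>2}"
    by (intro measure_pmf.finite_measure_mono) auto
  also have "\<dots> \<le> ?E (\<lambda>S. (?X S - \<mu>)\<^sup>2) / (\<mu> / 2)\<^sup>2"
    using integral_Markov_inequality_measure[of ?M "\<lambda>S. (?X S - \<mu>)\<^sup>2" "{}" "(\<mu> / 2)\<^sup>2"] \<mu> by simp
  also have "\<dots> \<le> \<mu> / (\<mu> / 2)\<^sup>2" using var \<mu> by (intro divide_right_mono) auto
  also have "\<dots> = 4 / \<mu>" using \<mu> by (simp add: power2_eq_square)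
  finally show ?thesis .
qed

text \<open>Keeping each point of a \<open>p'\<close>-random set with probability \<open>p / p'\<close> gives a \<open>p\<close>-random set.\<close>

lemma prob_random_subset_mono:
  assumes V: "finite V" and p: "0 \<le> p" "p \<le> p'" "p' \<le> 1"
    and U: "\<And>S T. S \<in> U \<Longrightarrow> S \<subseteq> T \<Longrightarrow> T \<subseteq> V \<Longrightarrow> T \<in> U"
  shows "measure_pmf.prob (random_subset V p) U \<le> measure_pmf.prob (random_subset V p') U"
proof (cases "p' = 0")
  case True
  thus ?thesis using p by simp
next
  case False
  define r where "r = p / p'"
  have r: "0 \<le> r" "r \<le> 1" using p False by (auto simp: r_def)
  define K where "K b = (if b then bernoulli_pmf r else return_pmf False)" for b
  have "bernoulli_pmf p = bind_pmf (bernoulli_pmf p') K"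
  proof (rule pmf_eqI)
    fix b
    have "pmf (bind_pmf (bernoulli_pmf p') K) True = p"
      using p r False by (simp add: pmf_bind integral_bernoulli_pmf K_def r_def)
    moreover have "pmf (bind_pmf (bernoulli_pmf p') K) False = 1 - p"
      using p r False by (simp add: pmf_bind K_def r_def algebra_simps)
    ultimately show "pmf (bernoulli_pmf p) b = pmf (bind_pmf (bernoulli_pmf p') K) b"
      using p by (cases b) auto
  qed
  hence eq: "Pi_pmf V False (\<lambda>_. bernoulli_pmf p) =
    bind_pmf (Pi_pmf V False (\<lambda>_. bernoulli_pmf p')) (\<lambda>f. Pi_pmf V False (\<lambda>x. K (f x)))"
    by (simp add: Pi_pmf_bind[OF V, of _ _ _ False])
  let ?g = "\<lambda>f. {x \<in> V. f x}"
  have "emeasure (random_subset V p) U =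
      (\<integral>\<^sup>+f. emeasure (Pi_pmf V False (\<lambda>x. K (f x))) (?g -` U) \<partial>Pi_pmf V False (\<lambda>_. bernoulli_pmf p'))"
    unfolding random_subset_def eq by simp
  also have "\<dots> \<le> (\<integral>\<^sup>+f. indicator (?g -` U) f \<partial>Pi_pmf V False (\<lambda>_. bernoulli_pmf p'))"
  proof (rule nn_integral_mono)
    fix f :: "'a \<Rightarrow> bool"
    show "emeasure (Pi_pmf V False (\<lambda>x. K (f x))) (?g -` U) \<le> indicator (?g -` U) f"
    proof (cases "?g f \<in> U")
      case True
      thus ?thesis using measure_pmf.emeasure_le_1 by (simp add: measure_pmf.emeasure_le_1)
    next
      case False
      \<comment> \<open>Thinning only removes points and \<open>U\<close> is closed upwards, so a
        thinned set in \<open>U\<close> would put the original set into \<open>U\<close>.\<close>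
      have "?g h \<notin> U" if h: "h \<in> set_pmf (Pi_pmf V False (\<lambda>x. K (f x)))" for h
      proof
        assume hU: "?g h \<in> U"
        have "f x" if "x \<in> V" "h x" for x
          using h that by (auto simp: set_Pi_pmf[OF V] PiE_dflt_def K_def split: if_splits)
        hence "?g h \<subseteq> ?g f" by auto
        with U[OF hU] False show False by auto
      qed
      hence "emeasure (Pi_pmf V False (\<lambda>x. K (f x))) (?g -` U) = 0"
        by (subst measure_pmf.emeasure_eq_measure) (auto simp: measure_pmf_zero_iff)
      thus ?thesis by simp
    qed
  qed
  also have "\<dots> = emeasure (random_subset V p') U" unfolding random_subset_def by simp
  finally show ?thesis by (simp add: measure_pmf.emeasure_eq_measure)
qed

section \<open>Distribution of the maximum general position set\<close>

text \<open>Transfers the root bound for univariate polynomials to explicit sums, the form that a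
  functional takes on the moment curve.\<close>

lemma (in domain) card_poly_zeros_le:
  assumes fin: "finite (carrier R)" and c: "c \<in> {..n} \<rightarrow> carrier R" and nz: "i \<le> n" "c i \<noteq> \<zero>"
  shows "card {t \<in> carrier R. (\<Oplus>i\<in>{..n}. c i \<otimes> t [^] i) = \<zero>} \<le> n"
proof -
  interpret P: UP_domain R "UP R" by (unfold_locales)
  define f where "f = (\<lambda>i. if i \<le> n then c i else \<zero>)"
  have "f \<in> up R"
    using c by (intro mem_upI) (auto simp: f_def bound_def intro!: exI[of _ n])
  hence f: "f \<in> carrier (UP R)" by (simp add: UP_def)
  have coeff: "coeff (UP R) f k = f k" for k using f by (simp add: UP_def)
  have coeff': "coeff (UP R) f k = c k" if "k \<le> n" for k
    unfolding coeff using that by (simp add: f_def)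
  have "deg R f \<le> n" by (rule P.deg_aboveI[OF _ f]) (simp add: coeff, simp add: f_def)
  have fnz: "f \<noteq> \<zero>\<^bsub>UP R\<^esub>"
  proof
    assume "f = \<zero>\<^bsub>UP R\<^esub>"
    hence "f i = \<zero>" using coeff[of i] by simp
    thus False using nz by (simp add: f_def)
  qed
  have ev: "eval R R id t f = (\<Oplus>i\<in>{..n}. c i \<otimes> t [^] i)" if t: "t \<in> carrier R" for t
  proof -
    have "eval R R id t f = (\<Oplus>i\<in>{..deg R f}. coeff (UP R) f i \<otimes> t [^] i)"
      using P.eval_on_carrier[OF f, of R id t] by simp
    also have "\<dots> = (\<Oplus>i\<in>{..n}. coeff (UP R) f i \<otimes> t [^] i)"
    proof (rule add.finprod_mono_neutral_cong_left)
      fix i assume "i \<in> {..n} - {..deg R f}"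
      hence "coeff (UP R) f i = \<zero>" using P.deg_aboveD[OF _ f] by auto
      thus "coeff (UP R) f i \<otimes> t [^] i = \<zero>" using t by simp
    qed (use \<open>deg R f \<le> n\<close> t f in auto)
    also have "\<dots> = (\<Oplus>i\<in>{..n}. c i \<otimes> t [^] i)"
      using t c by (intro finsum_cong') (auto simp: coeff' Pi_iff)
    finally show ?thesis .
  qed
  have "card {t \<in> carrier R. eval R R id t f = \<zero>} \<le> deg R f"
    using P.roots_bound[OF f fnz fin] by simp
  moreover have "{t \<in> carrier R. eval R R id t f = \<zero>} =
      {t \<in> carrier R. (\<Oplus>i\<in>{..n}. c i \<otimes> t [^] i) = \<zero>}"
    using ev by auto
  ultimately show ?thesis using \<open>deg R f \<le> n\<close> by simp
qed

section \<open>The moment curve\<close>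

context finite_affine_space
begin

text \<open>Exponents start at 1 because entry \<open>d\<close> of a functional supplies the
  constant term.\<close>

definition moment_point :: "'a \<Rightarrow> nat \<Rightarrow> 'a" where
  "moment_point t = (\<lambda>i\<in>{..<d}. t [^] Suc i)"

definition moment_curve :: "(nat \<Rightarrow> 'a) set" where
  "moment_curve = moment_point ` carrier R"

lemma moment_point_closed: "t \<in> carrier R \<Longrightarrow> moment_point t \<in> V"
  unfolding moment_point_def V_def by (simp add: restrict_PiE_iff del: nat_pow_Suc)

lemma moment_curve_subset: "moment_curve \<subseteq> V"
  unfolding moment_curve_def using moment_point_closed by auto

lemma card_moment_curve:
  assumes d: "d \<ge> 1"
  shows "card moment_curve = q"
proof -
  have "inj_on moment_point (carrier R)"
  proof (rule inj_onI)
    fix s t assume st: "s \<in> carrier R" "t \<in> carrier R" "moment_point s = moment_point t"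
    have "moment_point s 0 = moment_point t 0" using st by simp
    thus "s = t" using st d by (simp add: moment_point_def)
  qed
  thus ?thesis unfolding moment_curve_def by (rule card_image)
qed

lemma aev_moment_point:
  assumes a: "a \<in> \<Phi>" and t: "t \<in> carrier R"
  shows "aev a (moment_point t) = (\<Oplus>i\<in>{..d}. (if i = 0 then a d else a (i - 1)) \<otimes> t [^] i)"
proof -
  define g where "g i = (if i = 0 then a d else a (i - 1)) \<otimes> t [^] i" for i
  have gc: "g i \<in> carrier R" if "i \<le> d" for i
    using functional_closed[OF a, of d] functional_closed[OF a, of "i - 1"] t that
    by (simp add: g_def)
  have "{..d} = insert 0 (Suc ` {..<d})"
    by (metis atMost_Suc_eq_insert_0 lessThan_Suc_atMost lessThan_Suc_eq_insert_0)
  hence "(\<Oplus>i\<in>{..d}. g i) = (\<Oplus>i\<in>insert 0 (Suc ` {..<d}). g i)" by simp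
  also have "\<dots> = g 0 \<oplus> (\<Oplus>i\<in>Suc ` {..<d}. g i)"
    by (rule finsum_insert) (use gc in auto)
  also have "(\<Oplus>i\<in>Suc ` {..<d}. g i) = (\<Oplus>i\<in>{..<d}. g (Suc i))"
    by (rule finsum_reindex) (use gc in auto)
  also have "\<dots> = lin a (moment_point t)"
    unfolding lin_def
  proof (rule finsum_cong')
    show "(\<lambda>i. a i \<otimes> moment_point t i) \<in> {..<d} \<rightarrow> carrier R"
      using a moment_point_closed[OF t] by (auto simp: functional_closed point_closed)
  qed (auto simp: g_def moment_point_def)
  also have "g 0 = a d" using functional_closed[OF a, of d] by (simp add: g_def)
  finally show ?thesis by (simp add: aev_def g_def)
qed

text \<open>On the curve a nonzero functional becomes a nonzero polynomial of degree at most
  \<open>d\<close>, so it vanishes at no more than \<open>d\<close> points.\<close>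

lemma gp_moment_curve:
  assumes d: "d \<ge> 1"
  shows "gp moment_curve"
  unfolding gp_def
proof (intro conjI allI impI)
  fix A assume A: "A \<subseteq> moment_curve" "card A = d + 1"
  have AV: "A \<subseteq> V" using A moment_curve_subset by auto
  show "card (ann A) = 1"
  proof (rule ccontr)
    assume "card (ann A) \<noteq> 1"
    hence "card (ann A) > 1" using card_ann_pos[OF AV] by simp
    then obtain a where a: "a \<in> ann A" "a \<noteq> zero_functional"
      using card_ann_gt_1_nonzero[OF AV] by blast
    have a': "a \<in> \<Phi>" using a ann_subset by auto
    let ?c = "\<lambda>i. if i = 0 then a d else a (i - 1)"
    have "\<exists>i\<le>d. ?c i \<noteq> \<zero>"
    proof (rule ccontr)
      assume "\<not> ?thesis"
      hence z: "?c i = \<zero>" if "i \<le> d" for i using that by blast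
      have "a i = \<zero>" if "i \<le> d" for i
        using z[of 0] z[of "Suc i"] that by (cases "i = d") auto
      hence "a = zero_functional"
        by (intro functional_eqI[OF a' zero_functional_closed]) (simp add: zero_functional_def)
      thus False using a by simp
    qed
    then obtain i where i: "i \<le> d" "?c i \<noteq> \<zero>" by blast
    let ?Z = "{t \<in> carrier R. (\<Oplus>i\<in>{..d}. ?c i \<otimes> t [^] i) = \<zero>}"
    have "card ?Z \<le> d"
      using a' by (intro card_poly_zeros_le[OF finite_carrier, of ?c d i] i) (auto simp: functional_closed)
    have "A \<subseteq> moment_point ` ?Z"
    proof
      fix x assume x: "x \<in> A"
      then obtain t where t: "t \<in> carrier R" "x = moment_point t"
        using A by (auto simp: moment_curve_def)
      have "aev a x = \<zero>" using a x by (simp add: ann_def)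
      thus "x \<in> moment_point ` ?Z" using t aev_moment_point[OF a' t(1)] by auto
    qed
    hence "card A \<le> card ?Z" using finite_carrier by (intro surj_card_le) auto
    thus False using A \<open>card ?Z \<le> d\<close> by simp
  qed
qed (rule moment_curve_subset)

section \<open>Dependent sets and their deletion\<close>

definition dependent_sets :: "(nat \<Rightarrow> 'a) set set" where
  "dependent_sets = {A. A \<subseteq> V \<and> card A = d + 1 \<and> card (ann A) \<noteq> 1}"

lemma finite_dependent_sets: "finite dependent_sets"
  by (rule finite_subset[of _ "Pow V"]) (auto simp: dependent_sets_def)

text \<open>One of the \<open>d + 1\<close> points lies in the closure of the other
  \<open>d\<close>. These can be chosen in at most \<open>q ^ (d * d)\<close> ways, and since
  \<open>d\<close> conditions leave at least \<open>q\<close> functionals, their closure has at most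
  \<open>q ^ (d - 1)\<close> points.\<close>

lemma card_dependent_sets:
  assumes d: "d \<ge> 1"
  shows "card dependent_sets \<le> q ^ (d * d + (d - 1))"
proof -
  let ?T = "{C. C \<subseteq> V \<and> card C = d}"
  have "dependent_sets \<subseteq> (\<Union>C\<in>?T. (\<lambda>x. insert x C) ` cl C)"
  proof
    fix A assume "A \<in> dependent_sets"
    hence A: "A \<subseteq> V" "card A = d + 1" "card (ann A) \<noteq> 1" by (auto simp: dependent_sets_def)
    have fA: "finite A" using A finite_subset finite_V by blast
    have "\<exists>z\<in>A. z \<in> cl (A - {z})"
    proof (rule ccontr)
      assume "\<not> ?thesis"
      hence "card (ann {}) = q ^ card A * card (ann ({} \<union> A))"
        using fA A by (intro card_ann_Un_eq) auto
      hence "card (ann A) = 1" using A q_ge_2 by (simp add: ann_empty card_\<Phi>)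
      thus False using A by simp
    qed
    then obtain z where z: "z \<in> A" "z \<in> cl (A - {z})" by auto
    have "A = insert z (A - {z})" "A - {z} \<in> ?T" using z A fA by auto
    thus "A \<in> (\<Union>C\<in>?T. (\<lambda>x. insert x C) ` cl C)" using z by blast
  qed
  hence "card dependent_sets \<le> card (\<Union>C\<in>?T. (\<lambda>x. insert x C) ` cl C)"
    using finite_subset[OF cl_subset finite_V] by (intro card_mono) auto
  also have "\<dots> \<le> (\<Sum>C\<in>?T. card ((\<lambda>x. insert x C) ` cl C))" by (intro card_UN_le) auto
  also have "\<dots> \<le> (\<Sum>C\<in>?T. q ^ (d - 1))"
  proof (rule sum_mono)
    fix C assume C: "C \<in> ?T"
    have fC: "finite C" using C finite_subset finite_V by blast
    have "q ^ d * q \<le> q ^ d * card (ann C)" using card_ann_ge[OF fC] C by (simp add: mult.commute)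
    hence "q \<le> card (ann C)" using q_ge_2 by simp
    hence "card (cl C) * q \<le> card (cl C) * card (ann C)" by simp
    also have "\<dots> \<le> q ^ d" using card_cl[of C] C d by simp
    also have "\<dots> = q ^ (d - 1) * q" using d by (simp flip: power_Suc2)
    finally have "card (cl C) \<le> q ^ (d - 1)" using q_ge_2 by simp
    thus "card ((\<lambda>x. insert x C) ` cl C) \<le> q ^ (d - 1)"
      using card_image_le[OF finite_subset[OF cl_subset finite_V], of "\<lambda>x. insert x C" C] by linarith
  qed
  also have "\<dots> = (q ^ d choose d) * q ^ (d - 1)" using n_subsets[OF finite_V, of d] card_V by simp
  also have "\<dots> \<le> (q ^ d) ^ d * q ^ (d - 1)"
  proof (rule mult_right_mono)
    show "q ^ d choose d \<le> (q ^ d) ^ d"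
      by (cases "d \<le> q ^ d") (simp_all add: binomial_le_pow binomial_eq_0)
  qed simp
  also have "\<dots> = q ^ (d * d + (d - 1))" by (simp add: power_add power_mult)
  finally show ?thesis .
qed

lemma general_position_iff_gp: "d \<ge> 1 \<Longrightarrow> general_position R d P \<longleftrightarrow> gp P"
  unfolding gp_def by (rule general_position_iff)

abbreviation "mgp \<equiv> max_general_position R d"

text \<open>General position passes to subsets, so every size up to the maximum is attained. Tails
  of \<open>alpha\<close> thereby become statements about single sets \<open>I\<close>.\<close>

lemma max_general_position_ge_iff:
  assumes d: "d \<ge> 1" and S: "S \<subseteq> V"
  shows "m \<le> mgp S \<longleftrightarrow> (\<exists>I\<subseteq>S. gp I \<and> card I = m)"
proof -
  let ?C = "{card P | P. P \<subseteq> S \<and> gp P}"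
  have eq: "mgp S = Max ?C"
    unfolding max_general_position_def using general_position_iff_gp[OF d] by simp
  have fS: "finite S" using S finite_V finite_subset by metis
  have fin: "finite ?C"
    by (rule finite_surj[of "Pow S" _ card]) (use fS in auto)
  have "0 \<in> ?C" by (auto simp: gp_def intro!: exI[of _ "{}"])
  hence ne: "?C \<noteq> {}" by blast
  show ?thesis
  proof
    assume "m \<le> mgp S"
    moreover have "mgp S \<in> ?C" unfolding eq by (rule Max_in[OF fin ne])
    ultimately obtain P where P: "P \<subseteq> S" "gp P" "m \<le> card P" by auto
    obtain I where "I \<subseteq> P" "card I = m" using obtain_subset_with_card_n[OF P(3)] by blast
    thus "\<exists>I\<subseteq>S. gp I \<and> card I = m" using P gp_subset by blast
  next
    assume "\<exists>I\<subseteq>S. gp I \<and> card I = m"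
    hence "m \<in> ?C" by auto
    thus "m \<le> mgp S" unfolding eq by (rule Max_ge[OF fin])
  qed
qed

lemma max_general_position_mono:
  assumes d: "d \<ge> 1" and ST: "S \<subseteq> T" "T \<subseteq> V"
  shows "mgp S \<le> mgp T"
proof -
  have "\<exists>I\<subseteq>S. gp I \<and> card I = mgp S"
    using max_general_position_ge_iff[OF d, of S "mgp S"] ST by auto
  thus ?thesis using max_general_position_ge_iff[OF d ST(2)] ST by blast
qed

lemma max_general_position_le_card:
  assumes d: "d \<ge> 1" and S: "S \<subseteq> V"
  shows "mgp S \<le> card S"
proof -
  obtain I where "I \<subseteq> S" "card I = mgp S"
    using max_general_position_ge_iff[OF d S, of "mgp S"] by auto
  thus ?thesis using card_mono[of S I] S finite_V finite_subset by metis
qed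

lemma max_general_position_deletion:
  assumes d: "d \<ge> 1" and S: "S \<subseteq> V"
  shows "card S - card {A \<in> dependent_sets. A \<subseteq> S} \<le> mgp S"
proof -
  let ?D = "{A \<in> dependent_sets. A \<subseteq> S}"
  have fS: "finite S" using S finite_V finite_subset by metis
  have fD: "finite ?D" using finite_dependent_sets by simp
  have "\<forall>A\<in>?D. \<exists>x. x \<in> A" by (auto simp: dependent_sets_def) (metis card.empty ex_in_conv nat.distinct(1))
  then obtain x where x: "\<And>A. A \<in> ?D \<Longrightarrow> x A \<in> A" using bchoice[of ?D "\<lambda>A x. x \<in> A"] by blast
  define I where "I = S - x ` ?D"
  have "gp I"
    unfolding gp_def
  proof (intro conjI allI impI, goal_cases)
    case 1
    thus ?case using S by (auto simp: I_def)
  next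
    case (2 A)
    show ?case
    proof (rule ccontr)
      assume "card (ann A) \<noteq> 1"
      hence "A \<in> ?D" using 2 S by (auto simp: dependent_sets_def I_def)
      thus False using x[of A] 2 by (auto simp: I_def)
    qed
  qed
  moreover have "I \<subseteq> S" by (auto simp: I_def)
  ultimately have "card I \<le> mgp S" using max_general_position_ge_iff[OF d S] by blast
  moreover have "card S - card ?D \<le> card I"
    using diff_card_le_card_Diff[of "x ` ?D" S] card_image_le[OF fD, of x] fD unfolding I_def
    by (meson diff_le_mono2 finite_imageI le_trans)
  ultimately show ?thesis by linarith
qed

section \<open>Tail bounds for \<open>alpha\<close> at a fixed \<open>q\<close>\<close>

lemma prob_alpha: "measure_pmf.prob (alpha R d p) U = measure_pmf.prob (random_subset V p) {S. S \<subseteq> V \<and> mgp S \<in> U}"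
proof -
  have "measure_pmf.prob (alpha R d p) U = measure_pmf.prob (random_subset V p) {S. mgp S \<in> U}"
    unfolding alpha_def carrier_M by (simp add: vimage_def)
  also have "\<dots> = measure_pmf.prob (random_subset V p) {S. S \<subseteq> V \<and> mgp S \<in> U}"
    using set_random_subset[OF finite_V, of p]
    by (intro measure_pmf.finite_measure_eq_AE) (auto simp: AE_measure_pmf_iff)
  finally show ?thesis .
qed

lemma prob_alpha_ge:
  assumes d: "d \<ge> 1" and p: "0 \<le> p" "p \<le> 1"
  shows "measure_pmf.prob (alpha R d p) {a. m \<le> a} \<le> real (card {I. gp I \<and> card I = m}) * p ^ m"
proof -
  let ?F = "{I. gp I \<and> card I = m}"
  have "{S. S \<subseteq> V \<and> mgp S \<in> {a. m \<le> a}} \<subseteq> {S. real (card {A \<in> ?F. A \<subseteq> S}) \<ge> 1}"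
  proof clarify
    fix S assume S: "S \<subseteq> V" "m \<le> mgp S"
    then obtain I where "I \<subseteq> S" "gp I" "card I = m" using max_general_position_ge_iff[OF d S(1)] by auto
    hence "I \<in> {A \<in> ?F. A \<subseteq> S}" by auto
    moreover have "finite {A \<in> ?F. A \<subseteq> S}" by (rule finite_subset[OF _ finite_gp_sets[of m]]) auto
    ultimately have "card {A \<in> ?F. A \<subseteq> S} > 0" using card_gt_0_iff by blast
    thus "real (card {A \<in> ?F. A \<subseteq> S}) \<ge> 1" by linarith
  qed
  hence "measure_pmf.prob (alpha R d p) {a. m \<le> a} \<le>
    measure_pmf.prob (random_subset V p) {S. real (card {A \<in> ?F. A \<subseteq> S}) \<ge> 1}"
    unfolding prob_alpha by (intro measure_pmf.finite_measure_mono) auto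
  also have "\<dots> \<le> (\<Sum>A\<in>?F. p ^ card A) / 1"
    by (rule prob_card_subsets_ge[OF finite_V finite_gp_sets _ p]) (auto dest: gp_V)
  finally show ?thesis by simp
qed

lemma prob_alpha_ge_mono:
  assumes d: "d \<ge> 1" and p: "0 \<le> p" "p \<le> p'" "p' \<le> 1"
  shows "measure_pmf.prob (alpha R d p) {a. x \<le> real a} \<le> measure_pmf.prob (alpha R d p') {a. x \<le> real a}"
  unfolding prob_alpha
proof (rule prob_random_subset_mono[OF finite_V p])
  fix S T assume "S \<in> {S. S \<subseteq> V \<and> mgp S \<in> {a. x \<le> real a}}" "S \<subseteq> T" "T \<subseteq> V"
  thus "T \<in> {S. S \<subseteq> V \<and> mgp S \<in> {a. x \<le> real a}}"
    using max_general_position_mono[OF d, of S T] by (auto intro: order_trans)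
qed

lemma prob_alpha_gt_card:
  assumes d: "d \<ge> 1" and p: "0 < p" "p \<le> 1"
  defines "\<mu> \<equiv> p * real q ^ d"
  shows "measure_pmf.prob (alpha R d p) {a. real a > 2 * \<mu>} \<le> 4 / \<mu>"
proof -
  have \<mu>: "\<mu> = real (card V) * p" by (simp add: \<mu>_def card_V)
  have pos: "\<mu> > 0" using p q_ge_2 by (simp add: \<mu>_def)
  have "measure_pmf.prob (alpha R d p) {a. real a > 2 * \<mu>} \<le>
    measure_pmf.prob (random_subset V p) {S. \<bar>real (card (S \<inter> V)) - \<mu>\<bar> \<ge> \<mu> / 2}"
    unfolding prob_alpha
  proof (intro measure_pmf.finite_measure_mono subsetI)
    fix S assume "S \<in> {S. S \<subseteq> V \<and> mgp S \<in> {a. real a > 2 * \<mu>}}"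
    hence S: "S \<subseteq> V" "real (mgp S) > 2 * \<mu>" by auto
    have "real (card S) > 2 * \<mu>" using max_general_position_le_card[OF d S(1)] S by linarith
    thus "S \<in> {S. \<bar>real (card (S \<inter> V)) - \<mu>\<bar> \<ge> \<mu> / 2}"
      using S pos by (simp add: Int_absorb2)
  qed auto
  also have "\<dots> \<le> 4 / \<mu>"
    using prob_card_Int_deviation[OF finite_V subset_refl, of p] p pos unfolding \<mu> by simp
  finally show ?thesis .
qed

lemma prob_alpha_lt_moment_curve:
  assumes d: "d \<ge> 1" and p: "0 < p" "p \<le> 1"
  defines "\<mu> \<equiv> p * real q"
  shows "measure_pmf.prob (alpha R d p) {a. real a < \<mu> / 4} \<le> 4 / \<mu>"
proof -
  have \<mu>: "\<mu> = real (card moment_curve) * p" by (simp add: \<mu>_def card_moment_curve[OF d])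
  have pos: "\<mu> > 0" using p q_ge_2 by (simp add: \<mu>_def)
  have "measure_pmf.prob (alpha R d p) {a. real a < \<mu> / 4} \<le>
    measure_pmf.prob (random_subset V p) {S. \<bar>real (card (S \<inter> moment_curve)) - \<mu>\<bar> \<ge> \<mu> / 2}"
    unfolding prob_alpha
  proof (intro measure_pmf.finite_measure_mono subsetI)
    fix S assume "S \<in> {S. S \<subseteq> V \<and> mgp S \<in> {a. real a < \<mu> / 4}}"
    hence S: "S \<subseteq> V" "real (mgp S) < \<mu> / 4" by auto
    have "gp (S \<inter> moment_curve)" using gp_subset[OF gp_moment_curve[OF d]] by auto
    hence "card (S \<inter> moment_curve) \<le> mgp S"
      using max_general_position_ge_iff[OF d S(1)] by blast
    hence "real (card (S \<inter> moment_curve)) < \<mu> / 4" using S by linarith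
    thus "S \<in> {S. \<bar>real (card (S \<inter> moment_curve)) - \<mu>\<bar> \<ge> \<mu> / 2}"
      using pos by simp
  qed auto
  also have "\<dots> \<le> 4 / \<mu>"
    using prob_card_Int_deviation[OF finite_V moment_curve_subset, of p] p pos unfolding \<mu> by simp
  finally show ?thesis .
qed

text \<open>Apart from two bad events, the random set has more than \<open>\<mu> / 2\<close> points
  and contains fewer than \<open>\<mu> / 4\<close> dependent sets. The last summand is Markov's
  bound for the second event.\<close>

lemma prob_alpha_lt_deletion:
  assumes d: "d \<ge> 1" and p: "0 < p" "p \<le> 1"
  defines "\<mu> \<equiv> p * real q ^ d"
  shows "measure_pmf.prob (alpha R d p) {a. real a < \<mu> / 4} \<le> 4 / \<mu> + 4 * (p ^ d * real q ^ (d * d - 1))"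
proof -
  have \<mu>: "\<mu> = real (card V) * p" by (simp add: \<mu>_def card_V)
  have pos: "\<mu> > 0" using p q_ge_2 by (simp add: \<mu>_def)
  let ?A = "{S. \<bar>real (card (S \<inter> V)) - \<mu>\<bar> \<ge> \<mu> / 2}"
  let ?B = "{S. real (card {A \<in> dependent_sets. A \<subseteq> S}) \<ge> \<mu> / 4}"
  have "measure_pmf.prob (alpha R d p) {a. real a < \<mu> / 4} \<le>
    measure_pmf.prob (random_subset V p) (?A \<union> ?B)"
    unfolding prob_alpha
  proof (intro measure_pmf.finite_measure_mono subsetI)
    fix S assume "S \<in> {S. S \<subseteq> V \<and> mgp S \<in> {a. real a < \<mu> / 4}}"
    hence S: "S \<subseteq> V" "real (mgp S) < \<mu> / 4" by auto
    show "S \<in> ?A \<union> ?B"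
    proof (rule ccontr)
      assume "S \<notin> ?A \<union> ?B"
      hence "real (card {A \<in> dependent_sets. A \<subseteq> S}) < \<mu> / 4" "\<bar>real (card S) - \<mu>\<bar> < \<mu> / 2"
        using S by (auto simp: Int_absorb2)
      thus False using max_general_position_deletion[OF d S(1)] S by linarith
    qed
  qed auto
  also have "\<dots> \<le> measure_pmf.prob (random_subset V p) ?A + measure_pmf.prob (random_subset V p) ?B"
    by (rule measure_Un_le) auto
  also have "measure_pmf.prob (random_subset V p) ?A \<le> 4 / \<mu>"
    using prob_card_Int_deviation[OF finite_V subset_refl, of p] p pos unfolding \<mu> by simp
  also have "measure_pmf.prob (random_subset V p) ?B \<le> (\<Sum>A\<in>dependent_sets. p ^ card A) / (\<mu> / 4)"
    by (rule prob_card_subsets_ge[OF finite_V finite_dependent_sets]) (use p pos in \<open>auto simp: dependent_sets_def\<close>)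
  also have "(\<Sum>A\<in>dependent_sets. p ^ card A) = real (card dependent_sets) * p ^ (d + 1)"
    by (simp add: dependent_sets_def)
  also have "real (card dependent_sets) * p ^ (d + 1) / (\<mu> / 4) \<le>
     real q ^ (d * d + (d - 1)) * p ^ (d + 1) / (\<mu> / 4)"
    using card_dependent_sets[OF d] p pos
    by (intro divide_right_mono mult_right_mono) (auto simp flip: of_nat_power)
  also have "\<dots> = 4 * (p ^ d * real q ^ (d * d - 1))"
  proof -
    have "d * d + (d - 1) = (d * d - 1) + d" using d by simp
    hence "real q ^ (d * d + (d - 1)) = real q ^ (d * d - 1) * real q ^ d" by (metis power_add)
    thus ?thesis unfolding \<mu>_def using p q_ge_2 by (simp add: field_simps)
  qed
  finally show ?thesis by simp
qed

end

text \<open>Brings the first moment bound to the shape of the Chebyshev bounds, a constant divided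
  by the size.\<close>

lemma mult_exp_minus_half_le:
  assumes "x > (0::real)"
  shows "x * exp (- x / 2) \<le> 8 / x"
proof -
  have "1 + x / 2 + (x / 2)\<^sup>2 / 2 \<le> exp (x / 2)"
    using assms by (intro exp_lower_Taylor_quadratic) auto
  moreover have "(x / 2)\<^sup>2 / 2 = x\<^sup>2 / 8" by (simp add: power2_eq_square)
  moreover have "1 + x / 2 > 0" using assms by simp
  ultimately have "x\<^sup>2 / 8 \<le> exp (x / 2)" by linarith
  hence "x\<^sup>2 \<le> 8 * exp (x / 2)" by simp
  thus ?thesis using assms by (simp add: exp_minus field_simps power2_eq_square)
qed

section \<open>Upper tails from the two density estimates\<close>

context finite_affine_space
begin

abbreviation l :: real where "l \<equiv> ln (real q)"

lemma l_pos: "l > 0"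
  using q_ge_2 by simp

lemma sample_size_bounds:
  assumes m: "16 * (real d)\<^sup>2 * l \<le> real m" and d: "d \<ge> 1"
  defines "K \<equiv> real m / (4 * real d * l)" and "k \<equiv> nat \<lfloor>real m / (4 * real d * l)\<rfloor>"
  shows "K \<ge> 4 * real d" "real m / (8 * real d * l) \<le> real k" "k \<ge> 2 * d"
proof -
  have "4 * real d * (4 * real d * l) \<le> real m"
    using m by (simp add: power2_eq_square mult_ac)
  thus K: "K \<ge> 4 * real d" unfolding K_def using l_pos d by (simp add: le_divide_eq)
  have k: "real k \<ge> K - 1" unfolding k_def K_def[symmetric] using K by linarith
  have dd: "real d \<ge> 1" using d by simp
  have "K / 2 = real m / (8 * real d * l)" unfolding K_def by simp
  thus "real m / (8 * real d * l) \<le> real k" using k K dd by linarith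
  show "k \<ge> 2 * d" using k K dd by linarith
qed

text \<open>Here \<open>N = 4 * q\<close>, which leads to the bound of order \<open>p q\<close>. The
  condition with the constant 512 says that the density needed in
  \<open>gp_sets_first_moment\<close> is supplied by \<open>card_edges_ge_linear\<close>; it
  restricts the method to \<open>m\<close> above about the square root of \<open>q\<close>.\<close>

lemma prob_alpha_ge_linear:
  assumes d: "d \<ge> 2" and dl: "real d * l \<ge> 1"
    and m: "8 * (real d)\<^sup>2 * l\<^sup>2 \<le> real m" "16 * (real d)\<^sup>2 * l \<le> real m"
      "512 * real d ^ 5 * l ^ 3 * real q \<le> (real m)\<^sup>2"
    and p: "0 \<le> p" "p \<le> 1" "8 * exp 3 * real q * p \<le> real m"
  shows "measure_pmf.prob (alpha R d p) {a. m \<le> a} \<le> real m * exp (- real m / 2)"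
proof -
  have d1: "d \<ge> 1" using d by simp
  define k where "k = nat \<lfloor>real m / (4 * real d * l)\<rfloor>"
  note kb = sample_size_bounds[OF m(2) d1, folded k_def]
  have l0: "l > 0" by (rule l_pos)
  have m0: "real m > 0"
  proof -
    have "0 < 16 * (real d)\<^sup>2 * l" using l0 d1 by simp
    thus ?thesis using m(2) by linarith
  qed
  have q0: "real q > 0" using q_ge_2 by simp
  have "real (card {I. gp I \<and> card I = m}) * p ^ m \<le> real m * exp (- real m / 2)"
  proof (rule gp_sets_first_moment[OF refl _ k_def _ dl p(1,2)])
    show "8 * (real d)\<^sup>2 * l\<^sup>2 / real m \<le> 1" using m m0 by simp
    show "2 \<le> real m / (4 * real d * l)" using kb(1) d by linarith
    show "1 \<le> 4 * q" using q_ge_2 by simp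
    show "2 * exp 3 * real (4 * q) * p \<le> real m" using p by simp
    fix X B assume X: "gp X" "card X = k" and B: "B \<subseteq> V" "4 * q < card B"
    have "8 * (real d)\<^sup>2 * l\<^sup>2 / real m \<le> (real m / (8 * real d * l)) / (8 * (real d)\<^sup>2 * real q)"
      using m(3) m0 l0 d q0
      by (simp add: field_simps power2_eq_square eval_nat_numeral)
    also have "\<dots> \<le> real k / (8 * (real d)\<^sup>2 * real q)"
      using kb(2) by (intro divide_right_mono) auto
    finally have "8 * (real d)\<^sup>2 * l\<^sup>2 / real m * (real (card B))\<^sup>2 \<le>
      real (card X) / (8 * (real d)\<^sup>2 * real q) * (real (card B))\<^sup>2"
      unfolding X by (rule mult_right_mono) simp
    also have "\<dots> \<le> real (card (edges X B))"
      by (rule card_edges_ge_linear[OF d X(1) _ B(1)]) (use X kb B in auto)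
    finally show "8 * (real d)\<^sup>2 * l\<^sup>2 / real m * (real (card B))\<^sup>2 \<le> real (card (edges X B))" .
  qed
  thus ?thesis using prob_alpha_ge[OF d1 p(1,2), of m] by linarith
qed

text \<open>The condition on \<open>m ^ d\<close>, roughly \<open>m\<close> above the
  \<open>d\<close>-th root of \<open>q\<close>, and the two on \<open>l\<close> provide the three
  density conditions of \<open>card_edges_ge_quadratic\<close>. The bound
  \<open>m \<le> q ^ (d - 1)\<close> makes sets of more than \<open>N\<close> points large enough
  for it, and the last assumption keeps \<open>N p\<close> small against \<open>m\<close>.\<close>

lemma prob_alpha_ge_quadratic:
  assumes d: "d \<ge> 3" and l: "l \<ge> 1152 * (real d)\<^sup>2" "l ^ 3 \<ge> 3072 * real d ^ (d + 3)"
    and m: "8 * (real d)\<^sup>2 * l\<^sup>2 \<le> real m" "16 * (real d)\<^sup>2 * l \<le> real m"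
      "96 * (real d)\<^sup>2 * (8 * (real d)\<^sup>2) ^ (d - 1) * l ^ (d + 1) * real q \<le> real m ^ d"
      "real m \<le> real q ^ (d - 1)"
    and p: "0 \<le> p" "p \<le> 1" "2 * exp 3 * l ^ 3 * real q ^ d * p \<le> (real m)\<^sup>2"
  shows "measure_pmf.prob (alpha R d p) {a. m \<le> a} \<le> real m * exp (- real m / 2)"
proof -
  have d1: "d \<ge> 1" and d2: "d \<ge> 2" and dr: "real d \<ge> 3" using d by simp_all
  define k where "k = nat \<lfloor>real m / (4 * real d * l)\<rfloor>"
  note kb = sample_size_bounds[OF m(2) d1, folded k_def]
  have l0: "l > 0" by (rule l_pos)
  have d21: "(real d)\<^sup>2 \<ge> 1" using dr by (simp add: one_le_power)
  have l5: "l \<ge> 5" using l(1) d21 by linarith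
  have dl: "real d * l \<ge> 1" using mult_mono[of 1 "real d" 1 l] dr l5 by simp
  have m0: "real m > 0"
  proof -
    have "0 < 16 * (real d)\<^sup>2 * l" using l0 d1 by simp
    thus ?thesis using m(2) by linarith
  qed
  have q2: "real q \<ge> 2" using q_ge_2 by simp
  \<comment> \<open>\<open>r / q ^ d = l ^ 3 / m\<close> beats the needed density, of order
    \<open>l\<^sup>2 / m\<close>, by one factor \<open>l\<close>.\<close>
  define r where "r = real q ^ d * l ^ 3 / real m"
  define N where "N = nat \<lfloor>r\<rfloor>"
  have "5 * real q \<le> r"
  proof -
    have "l ^ 1 \<le> l ^ 3" using l5 by (intro power_increasing) auto
    hence "5 \<le> l ^ 3" using l5 by simp
    hence "5 * (real q * real m) \<le> l ^ 3 * (real q * real q ^ (d - 1))"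
      using m(4) q2 m0 by (intro mult_mono) auto
    also have "real q * real q ^ (d - 1) = real q ^ d" using d by (simp flip: power_Suc)
    finally show ?thesis unfolding r_def using m0 by (simp add: field_simps)
  qed
  hence N4: "real N \<ge> 4 * real q" unfolding N_def using q2 by linarith
  have Nr: "real N \<le> r" unfolding N_def using \<open>5 * real q \<le> r\<close> q2 by linarith
  have "real (card {I. gp I \<and> card I = m}) * p ^ m \<le> real m * exp (- real m / 2)"
  proof (rule gp_sets_first_moment[OF refl _ k_def _ dl p(1,2)])
    show "8 * (real d)\<^sup>2 * l\<^sup>2 / real m \<le> 1" using m m0 by simp
    show "2 \<le> real m / (4 * real d * l)" using kb(1) d by linarith
    show "1 \<le> N" using N4 q2 by linarith
    have "2 * exp 3 * real N * p \<le> 2 * exp 3 * r * p"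
      using Nr p by (intro mult_right_mono mult_left_mono) auto
    also have "\<dots> = (2 * exp 3 * l ^ 3 * real q ^ d * p) / real m" by (simp add: r_def)
    also have "\<dots> \<le> (real m)\<^sup>2 / real m" using p(3) by (intro divide_right_mono) auto
    also have "\<dots> = real m" by (simp add: power2_eq_square)
    finally show "2 * exp 3 * real N * p \<le> real m" .
    fix X B assume X: "gp X" "card X = k" and B: "B \<subseteq> V" "N < card B"
    have br: "real (card B) \<ge> r" using B(2) unfolding N_def by linarith
    have b4: "real (card B) \<ge> 4 * real q" using B N4 by linarith
    have k0: "real k > 0" using kb(3) d by linarith
    have k1: "real k \<ge> 1" using kb(3) d by linarith
    have "(real k / real (d - 1)) ^ (d - 1) \<le> real (k choose (d - 1))"
      using kb(3) by (intro binomial_ge_n_over_k_pow_k) simp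
    moreover have "(real k / real d) ^ (d - 1) \<le> (real k / real (d - 1)) ^ (d - 1)"
      using d by (intro power_mono divide_left_mono) auto
    ultimately have M: "(real k / real d) ^ (d - 1) \<le> real (k choose (d - 1))" by linarith
    show "8 * (real d)\<^sup>2 * l\<^sup>2 / real m * (real (card B))\<^sup>2 \<le> real (card (edges X B))"
    proof (rule card_edges_ge_quadratic[OF d2 X(1) _ B(1) b4])
      show "d + 1 \<le> card X" using X kb(3) d by simp
      show "0 \<le> 8 * (real d)\<^sup>2 * l\<^sup>2 / real m" by simp
      have "(real m / (8 * (real d)\<^sup>2 * l)) ^ (d - 1) \<le> (real k / real d) ^ (d - 1)"
        using kb(2) m0 l0 dr
        by (intro power_mono) (simp_all add: field_simps power2_eq_square)
      hence M1: "(real m / (8 * (real d)\<^sup>2 * l)) ^ (d - 1) \<le> real (k choose (d - 1))"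
        using M by linarith
      have md: "real m ^ d = real m * real m ^ (d - 1)" "l ^ (d + 1) = l\<^sup>2 * l ^ (d - 1)"
        using d by (simp_all flip: power_Suc power_add)
      have "96 * (real d)\<^sup>2 * l\<^sup>2 * real q * (8 * (real d)\<^sup>2 * l) ^ (d - 1) \<le> real m * real m ^ (d - 1)"
        using m(3) unfolding md by (simp add: power_mult_distrib mult_ac)
      hence "96 * (real d)\<^sup>2 * l\<^sup>2 * real q \<le> real m * (real m / (8 * (real d)\<^sup>2 * l)) ^ (d - 1)"
        using l0 dr unfolding power_divide by (simp add: le_divide_eq)
      also have "\<dots> \<le> real m * real (k choose (d - 1))" using M1 by (intro mult_left_mono) auto
      finally show "8 * (real d)\<^sup>2 * l\<^sup>2 / real m \<le> real (card X choose (d - 1)) / (12 * real q)"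
        unfolding X using m0 q2 by (simp add: field_simps)
      have "8 * (real d)\<^sup>2 * l\<^sup>2 / real m \<le> r / (144 * real q ^ d)"
      proof -
        have "1152 * (real d)\<^sup>2 * l\<^sup>2 \<le> l * l\<^sup>2" using l(1) by (intro mult_right_mono) auto
        thus ?thesis unfolding r_def using m0 q2 by (simp add: field_simps eval_nat_numeral)
      qed
      also have "\<dots> \<le> real (card B) / (144 * real q ^ d)" using br by (intro divide_right_mono) auto
      finally show "8 * (real d)\<^sup>2 * l\<^sup>2 / real m \<le> real (card B) / (144 * real q ^ d)" .
      \<comment> \<open>Here \<open>d \<ge> 3\<close> enters: the binomial coefficient is at least
        of order \<open>k\<^sup>2\<close>, so after division by \<open>k\<close> a factor of order
        \<open>m / l\<close> remains.\<close>
      have "real k ^ 2 \<le> real k ^ (d - 1)" using k1 d by (intro power_increasing) auto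
      hence "(real k)\<^sup>2 / real d ^ (d - 1) \<le> (real k / real d) ^ (d - 1)"
        unfolding power_divide by (intro divide_right_mono) auto
      hence "(real k)\<^sup>2 / real d ^ (d - 1) \<le> real (k choose (d - 1))" using M by linarith
      hence Mk: "real k / real d ^ (d - 1) \<le> real (k choose (d - 1)) / real k"
        using k0 by (simp add: field_simps power2_eq_square)
      have "8 * (real d)\<^sup>2 * l\<^sup>2 / real m \<le>
        (real m / (8 * real d * l)) / real d ^ (d - 1) * (l ^ 6 / (real m)\<^sup>2) / (48 * real d)"
      proof -
        have "l\<^sup>2 * (3072 * real d ^ (d + 3)) \<le> l\<^sup>2 * l ^ 3"
          using l(2) by (intro mult_left_mono) auto
        moreover have "real d ^ (d + 3) = (real d)\<^sup>2 * (real d * real d * real d ^ (d - 1))"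
          using d by (simp flip: power_Suc power_add add: power2_eq_square mult.assoc)
        ultimately have "8 * (real d)\<^sup>2 * l\<^sup>2 * (384 * (real d * real d * real d ^ (d - 1))) \<le> l\<^sup>2 * l ^ 3"
          by (simp add: mult_ac)
        hence "8 * (real d)\<^sup>2 * l\<^sup>2 \<le> l\<^sup>2 * l ^ 3 / (384 * (real d * real d * real d ^ (d - 1)))"
          using dr by (simp add: le_divide_eq)
        hence "8 * (real d)\<^sup>2 * l\<^sup>2 / real m \<le> l\<^sup>2 * l ^ 3 / (384 * (real d * real d * real d ^ (d - 1))) / real m"
          by (rule divide_right_mono) simp
        also have "\<dots> = (real m / (8 * real d * l)) / real d ^ (d - 1) * (l ^ 6 / (real m)\<^sup>2) / (48 * real d)"
          using m0 l0 dr by (simp add: field_simps eval_nat_numeral)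
        finally show ?thesis .
      qed
      also have "\<dots> \<le> real k / real d ^ (d - 1) * (l ^ 6 / (real m)\<^sup>2) / (48 * real d)"
        using kb(2) l0 by (intro divide_right_mono mult_right_mono) auto
      also have "\<dots> \<le> real (k choose (d - 1)) / real k * (l ^ 6 / (real m)\<^sup>2) / (48 * real d)"
        using Mk l0 by (intro divide_right_mono mult_right_mono) auto
      also have "l ^ 6 / (real m)\<^sup>2 = r\<^sup>2 / real q ^ (2 * d)"
        unfolding r_def using q2 by (simp add: power_mult_distrib power_divide power_mult[symmetric] mult.commute)
      also have "real (k choose (d - 1)) / real k * (r\<^sup>2 / real q ^ (2 * d)) / (48 * real d) \<le>
        real (k choose (d - 1)) / real k * ((real (card B))\<^sup>2 / real q ^ (2 * d)) / (48 * real d)"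
        using br \<open>5 * real q \<le> r\<close> q2 by (intro divide_right_mono mult_left_mono power_mono) auto
      also have "\<dots> = real (card X choose (d - 1)) * (real (card B))\<^sup>2 /
          (48 * real d * real (card X) * real q ^ (2 * d))"
        unfolding X by (simp add: field_simps)
      finally show "8 * (real d)\<^sup>2 * l\<^sup>2 / real m \<le> real (card X choose (d - 1)) * (real (card B))\<^sup>2 /
          (48 * real d * real (card X) * real q ^ (2 * d))" .
    qed
  qed
  thus ?thesis using prob_alpha_ge[OF d1 p(1,2), of m] by linarith
qed

end

section \<open>Asymptotics\<close>

text \<open>Collects the constants that \<open>ln q\<close> has to dominate; as they are
  nonnegative, their sum bounds each of them.\<close>

definition log_threshold :: "nat \<Rightarrow> real" where
  "log_threshold d = 1152 * real d ^ 2 + 3072 * real d ^ (d + 3) +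
     96 * (real d)\<^sup>2 * (8 * (real d)\<^sup>2) ^ (d - 1) + 8 * exp 3 + 512 * real d ^ 5"

lemma log_threshold_ge:
  "1152 * real d ^ 2 \<le> log_threshold d" "3072 * real d ^ (d + 3) \<le> log_threshold d"
  "96 * (real d)\<^sup>2 * (8 * (real d)\<^sup>2) ^ (d - 1) \<le> log_threshold d"
  "8 * exp 3 \<le> log_threshold d" "512 * real d ^ 5 \<le> log_threshold d"
  unfolding log_threshold_def by simp_all

lemma prob_not_conj_le:
  assumes "measure_pmf.prob M {a. \<not> P a} \<le> x" "measure_pmf.prob M {a. \<not> Q a} \<le> y"
  shows "measure_pmf.prob M {a. \<not> (P a \<and> Q a)} \<le> x + y"
proof -
  have "{a. \<not> (P a \<and> Q a)} = {a. \<not> P a} \<union> {a. \<not> Q a}" by auto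
  thus ?thesis using measure_Un_le[of "{a. \<not> P a}" "measure_pmf M" "{a. \<not> Q a}"] assms by simp
qed

lemma prob_not_imp_le:
  assumes "H \<Longrightarrow> measure_pmf.prob M {a. \<not> P a} \<le> x" "0 \<le> x"
  shows "measure_pmf.prob M {a. \<not> (H \<longrightarrow> P a)} \<le> x"
  using assms by (cases H) auto

section \<open>Explicit failure probabilities for one large \<open>q\<close>\<close>

context finite_affine_space
begin

lemma prob_alpha_gt_le:
  assumes "measure_pmf.prob (alpha R d p) {a. nat \<lceil>x\<rceil> \<le> a} \<le> real (nat \<lceil>x\<rceil>) * exp (- real (nat \<lceil>x\<rceil>) / 2)"
    and "l \<le> x"
  shows "measure_pmf.prob (alpha R d p) {a. \<not> real a \<le> x} \<le> 8 / l"
proof -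
  let ?m = "nat \<lceil>x\<rceil>"
  have m: "real ?m \<ge> l" using assms l_pos by linarith
  have "{a. \<not> real a \<le> x} \<subseteq> {a. ?m \<le> a}" by (auto simp: not_le nat_le_iff ceiling_le_iff)
  hence "measure_pmf.prob (alpha R d p) {a. \<not> real a \<le> x} \<le> measure_pmf.prob (alpha R d p) {a. ?m \<le> a}"
    by (intro measure_pmf.finite_measure_mono) auto
  also have "\<dots> \<le> 8 / real ?m"
    using assms(1) mult_exp_minus_half_le[of "real ?m"] m l_pos by linarith
  also have "\<dots> \<le> 8 / l" using m l_pos by (intro divide_left_mono mult_pos_pos) linarith+
  finally show ?thesis .
qed

context
  assumes d3: "d \<ge> 3" and l_ge: "l \<ge> log_threshold d"
    and root_ge: "l ^ 4 \<le> real q powr (1 / real d)"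
    and fourth_root_ge: "l ^ 6 \<le> real q powr (1 / 4)"
begin

lemma threshold_bounds:
  "l \<ge> 1152 * (real d)\<^sup>2" "l \<ge> 3072 * real d ^ (d + 3)"
  "l \<ge> 96 * (real d)\<^sup>2 * (8 * (real d)\<^sup>2) ^ (d - 1)" "l \<ge> 8 * exp 3" "l \<ge> 512 * real d ^ 5" "l \<ge> 1152"
  "l \<ge> 8 * (real d)\<^sup>2" "l \<ge> 16 * (real d)\<^sup>2"
proof -
  show *: "l \<ge> 1152 * (real d)\<^sup>2" "l \<ge> 3072 * real d ^ (d + 3)"
    "l \<ge> 96 * (real d)\<^sup>2 * (8 * (real d)\<^sup>2) ^ (d - 1)" "l \<ge> 8 * exp 3" "l \<ge> 512 * real d ^ 5"
    using log_threshold_ge[of d] l_ge by linarith+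
  have "(real d)\<^sup>2 \<ge> 1" using d3 by (simp add: one_le_power)
  thus "l \<ge> 1152" "l \<ge> 8 * (real d)\<^sup>2" "l \<ge> 16 * (real d)\<^sup>2" using *(1) by linarith+
qed

lemma l_power_mono: "i \<le> j \<Longrightarrow> l ^ i \<le> l ^ j"
  using threshold_bounds(6) by (intro power_increasing) auto

lemma large_size:
  assumes "real m \<ge> l ^ 3"
  shows "8 * (real d)\<^sup>2 * l\<^sup>2 \<le> real m" "16 * (real d)\<^sup>2 * l \<le> real m"
proof -
  have "8 * (real d)\<^sup>2 * l\<^sup>2 \<le> l * l\<^sup>2"
    using threshold_bounds(7) by (intro mult_right_mono) auto
  also have "\<dots> = l ^ 3" by (simp add: eval_nat_numeral)
  finally show "8 * (real d)\<^sup>2 * l\<^sup>2 \<le> real m" using assms by linarith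
  have "16 * (real d)\<^sup>2 * l \<le> l * l"
    using threshold_bounds(8) l_pos by (intro mult_right_mono) auto
  also have "\<dots> \<le> l ^ 3" using l_power_mono[of 2 3] by (simp add: power2_eq_square)
  finally show "16 * (real d)\<^sup>2 * l \<le> real m" using assms by linarith
qed

text \<open>The linear method needs \<open>m\<close> above the square root of \<open>q\<close> by
  logarithmic factors. The exponent 3 / 4 leaves ample room and, for \<open>d \<ge> 3\<close>, does
  not exceed \<open>d / (d + 1)\<close>, the exponent that matters later.\<close>

lemma prob_alpha_gt_linear:
  assumes x: "real q powr (3 / 4) \<le> x" and p: "0 \<le> p" "p \<le> 1" "8 * exp 3 * real q * p \<le> x"
  shows "measure_pmf.prob (alpha R d p) {a. \<not> real a \<le> x} \<le> 8 / l"
proof -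
  have q2: "real q \<ge> 2" using q_ge_2 by simp
  have l1: "l \<ge> 1" using threshold_bounds(6) by simp
  let ?m = "nat \<lceil>x\<rceil>" and ?r = "real q powr (1 / 4)"
  have r3: "real q powr (3 / 4) = ?r ^ 3" using q2 by (simp add: powr_power)
  have r4: "real q = ?r ^ 4" using q2 by (simp add: powr_power)
  have "l ^ 3 \<le> l ^ 18" by (rule l_power_mono) simp
  also have "\<dots> = (l ^ 6) ^ 3" by (simp flip: power_mult)
  also have "\<dots> \<le> ?r ^ 3" using fourth_root_ge l_pos by (intro power_mono) auto
  finally have x3: "l ^ 3 \<le> x" using x r3 by simp
  have lx: "l \<le> x" using x3 l_power_mono[of 1 3] by simp
  have mx: "real ?m \<ge> x" by linarith
  have m3: "real ?m \<ge> l ^ 3" using mx x3 by linarith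
  have "512 * real d ^ 5 * l ^ 3 \<le> l * l ^ 3"
    using threshold_bounds(5) l_pos by (intro mult_right_mono) auto
  also have "\<dots> = l ^ 4" by (simp add: eval_nat_numeral)
  also have "\<dots> \<le> l ^ 12" by (rule l_power_mono) simp
  also have "\<dots> = (l ^ 6) ^ 2" by (simp flip: power_mult)
  also have "\<dots> \<le> ?r ^ 2" using fourth_root_ge l_pos by (intro power_mono) auto
  finally have "512 * real d ^ 5 * l ^ 3 * real q \<le> ?r ^ 2 * real q"
    by (rule mult_right_mono) simp
  also have "\<dots> = (?r ^ 3)\<^sup>2" by (subst (2) r4) (simp flip: power_mult power_add)
  also have "\<dots> \<le> (real ?m)\<^sup>2" using x r3 mx by (intro power_mono) auto
  finally have m5: "512 * real d ^ 5 * l ^ 3 * real q \<le> (real ?m)\<^sup>2" .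
  have dl: "real d * l \<ge> 1" using mult_mono[of 1 "real d" 1 l] d3 l1 by simp
  have "measure_pmf.prob (alpha R d p) {a. ?m \<le> a} \<le> real ?m * exp (- real ?m / 2)"
    by (rule prob_alpha_ge_linear[OF _ dl large_size[OF m3] m5 p(1,2)]) (use d3 p mx in auto)
  thus ?thesis using lx by (rule prob_alpha_gt_le)
qed

text \<open>The logarithms have slack: the \<open>d\<close>-th power of \<open>l ^ 3\<close> covers
  a constant times \<open>l ^ (d + 1)\<close>, and \<open>l ^ 6\<close> covers a constant times
  \<open>l ^ 3\<close>, since these constants are at most \<open>l\<close>.\<close>

lemma prob_alpha_gt_quadratic:
  assumes x: "real q powr (1 / real d) * l ^ 3 \<le> x" "x + 1 \<le> real q ^ (d - 1)"
    and p: "0 \<le> p" "p \<le> 1" "p * real q ^ d * l ^ 6 \<le> x\<^sup>2"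
  shows "measure_pmf.prob (alpha R d p) {a. \<not> real a \<le> x} \<le> 8 / l"
proof -
  have q2: "real q \<ge> 2" using q_ge_2 by simp
  have l1: "l \<ge> 1" using threshold_bounds(6) by simp
  let ?m = "nat \<lceil>x\<rceil>" and ?r = "real q powr (1 / real d)"
  have rd: "?r ^ d = real q" using q2 d3 by (simp add: powr_power)
  have r1: "?r \<ge> 1" using q2 by (intro ge_one_powr_ge_zero) auto
  have "1 * l ^ 3 \<le> ?r * l ^ 3" using r1 l_pos by (intro mult_right_mono) auto
  hence x0: "x \<ge> l ^ 3" using x(1) by linarith
  have lx: "l \<le> x" using x0 l_power_mono[of 1 3] by simp
  have mx: "real ?m \<ge> x" "real ?m \<le> x + 1" using lx l1 by linarith+
  have m3: "real ?m \<ge> l ^ 3" using mx x0 by linarith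
  have "96 * (real d)\<^sup>2 * (8 * (real d)\<^sup>2) ^ (d - 1) * l ^ (d + 1) \<le> l * l ^ (d + 1)"
    using threshold_bounds(3) l_pos by (intro mult_right_mono) auto
  also have "\<dots> = l ^ (d + 2)" by simp
  also have "\<dots> \<le> l ^ (3 * d)" using d3 by (intro l_power_mono) simp
  finally have "96 * (real d)\<^sup>2 * (8 * (real d)\<^sup>2) ^ (d - 1) * l ^ (d + 1) * real q \<le> l ^ (3 * d) * real q"
    by (rule mult_right_mono) simp
  also have "\<dots> = (?r * l ^ 3) ^ d" by (simp add: power_mult_distrib rd power_mult)
  also have "\<dots> \<le> real ?m ^ d" using x(1) mx l_pos by (intro power_mono) auto
  finally have md: "96 * (real d)\<^sup>2 * (8 * (real d)\<^sup>2) ^ (d - 1) * l ^ (d + 1) * real q \<le> real ?m ^ d" .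
  have mq: "real ?m \<le> real q ^ (d - 1)" using mx x by linarith
  have "2 * exp 3 * l ^ 3 \<le> l * l ^ 3" using threshold_bounds(4) l_pos by (intro mult_right_mono) auto
  also have "\<dots> = l ^ 4" by (simp add: eval_nat_numeral)
  also have "\<dots> \<le> l ^ 6" by (rule l_power_mono) simp
  finally have "(2 * exp 3 * l ^ 3) * (real q ^ d * p) \<le> l ^ 6 * (real q ^ d * p)"
    using p by (intro mult_right_mono) auto
  also have "\<dots> \<le> x\<^sup>2" using p(3) by (simp add: mult_ac)
  also have "\<dots> \<le> (real ?m)\<^sup>2" using mx lx l1 by (intro power_mono) auto
  finally have mp: "2 * exp 3 * l ^ 3 * real q ^ d * p \<le> (real ?m)\<^sup>2" by (simp only: mult.assoc)
  have l3: "l ^ 3 \<ge> 3072 * real d ^ (d + 3)" using threshold_bounds(2) l_power_mono[of 1 3] by simp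
  have "measure_pmf.prob (alpha R d p) {a. ?m \<le> a} \<le> real ?m * exp (- real ?m / 2)"
    by (rule prob_alpha_ge_quadratic[OF d3 threshold_bounds(1) l3 large_size[OF m3] md mq p(1,2) mp])
  thus ?thesis using lx by (rule prob_alpha_gt_le)
qed

text \<open>The lower end of the range makes the expected size at least \<open>l\<close>, for
  Chebyshev; the upper end makes \<open>p ^ d * q ^ (d * d - 1)\<close> at most
  \<open>1 / l\<close>, for the dependent sets. Each accounts for \<open>4 / l\<close>.\<close>

lemma prob_alpha_lt_sparse:
  assumes p: "p \<le> 1" "real q powr (- real d) * l \<le> p" "p \<le> real q powr (- real d + 1 / real d) / l"
  shows "measure_pmf.prob (alpha R d p) {a. \<not> 1 / 4 * (p * real q ^ d) \<le> real a} \<le> 8 / l"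
proof -
  have q2: "real q \<ge> 2" using q_ge_2 by simp
  have l1: "l \<ge> 1" using threshold_bounds(6) by simp
  have "0 < real q powr (- real d) * l" using q2 l_pos by simp
  hence p0: "p > 0" using p by linarith
  have \<mu>: "l \<le> p * real q ^ d"
  proof -
    have "real q powr (- real d) * l * real q ^ d \<le> p * real q ^ d" using p by (intro mult_right_mono) auto
    thus ?thesis using q2 by (simp add: powr_minus powr_realpow field_simps)
  qed
  have "p ^ d * real q ^ (d * d - 1) \<le>
      (real q powr (- real d + 1 / real d) / l) ^ d * real q ^ (d * d - 1)"
    using p p0 by (intro mult_right_mono power_mono) auto
  also have "(real q powr (- real d + 1 / real d) / l) ^ d = real q powr (1 - real (d * d)) / l ^ d"
  proof -
    have "real d * (- real d + 1 / real d) = 1 - real (d * d)" using d3 by (simp add: field_simps)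
    moreover have "(real q powr (- real d + 1 / real d)) ^ d = real q powr (real d * (- real d + 1 / real d))"
      using d3 q2 by (intro powr_power) simp
    ultimately show ?thesis by (simp only: power_divide)
  qed
  also have "\<dots> * real q ^ (d * d - 1) = 1 / l ^ d"
  proof -
    have "real q ^ (d * d - 1) = real q powr (real (d * d) - 1)"
      using q2 d3 by (simp add: powr_realpow[symmetric] of_nat_diff)
    hence "real q powr (1 - real (d * d)) * real q ^ (d * d - 1) = 1"
      using q2 by (simp flip: powr_add)
    thus ?thesis by simp
  qed
  also have "\<dots> \<le> 1 / l ^ 1" using l_power_mono[of 1 d] d3 l_pos by (intro divide_left_mono) auto
  finally have 1: "p ^ d * real q ^ (d * d - 1) \<le> 1 / l" by simp
  have 2: "4 / (p * real q ^ d) \<le> 4 / l" using \<mu> l_pos p0 q2 by (intro divide_left_mono) auto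
  have "measure_pmf.prob (alpha R d p) {a. real a < p * real q ^ d / 4} \<le> 4 / l + 4 * (1 / l)"
    using prob_alpha_lt_deletion[OF _ p0 p(1)] d3 1 2 by fastforce
  thus ?thesis by (simp add: not_le mult.commute)
qed

text \<open>By monotonicity it is enough to treat \<open>p0\<close>, the top of the sparse range,
  where the expected number of points is the \<open>d\<close>-th root of \<open>q\<close> divided by
  \<open>l\<close>.\<close>

lemma prob_alpha_lt_root:
  assumes p: "p \<le> 1" "real q powr (- real d + 1 / real d) / l \<le> p"
  shows "measure_pmf.prob (alpha R d p) {a. \<not> real q powr (1 / real d) / l ^ 3 \<le> real a} \<le> 8 / l"
proof -
  have q2: "real q \<ge> 2" using q_ge_2 by simp
  have d1: "d \<ge> 1" using d3 by simp
  define p0 where "p0 = real q powr (- real d + 1 / real d) / l"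
  define x where "x = real q powr (1 / real d) / l ^ 3"
  have p01: "0 \<le> p0" "p0 \<le> p" using p l_pos by (auto simp: p0_def)
  \<comment> \<open>The sparse range is nonempty: its ends differ by the factor
    \<open>q powr (1 / d) / l\<^sup>2\<close>, which is at least 1.\<close>
  have "real q powr (- real d) * l \<le> p0"
  proof -
    have "l * l \<le> l ^ 4" using l_power_mono[of 2 4] by (simp add: power2_eq_square)
    hence "l * l \<le> real q powr (1 / real d)" using root_ge by linarith
    hence "real q powr (- real d) * (l * l) \<le> real q powr (- real d) * real q powr (1 / real d)"
      by (rule mult_left_mono) simp
    thus ?thesis using l_pos by (simp add: p0_def powr_add[symmetric] le_divide_eq mult.assoc)
  qed
  hence 1: "measure_pmf.prob (alpha R d p0) {a. \<not> 1 / 4 * (p0 * real q ^ d) \<le> real a} \<le> 8 / l"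
    using p01 p by (intro prob_alpha_lt_sparse) (auto simp: p0_def)
  have "x \<le> 1 / 4 * (p0 * real q ^ d)"
  proof -
    have "4 * l \<le> l * l" using threshold_bounds(6) by (intro mult_right_mono) auto
    also have "\<dots> \<le> l ^ 3" using l_power_mono[of 2 3] by (simp add: power2_eq_square)
    finally have "real q powr (1 / real d) / l ^ 3 \<le> real q powr (1 / real d) / (4 * l)"
      using l_pos by (intro divide_left_mono) auto
    moreover have "p0 * real q ^ d = real q powr (1 / real d) / l"
      using q2 by (simp add: p0_def powr_realpow[symmetric] powr_add[symmetric])
    ultimately show ?thesis by (simp add: x_def mult.commute)
  qed
  hence "measure_pmf.prob (alpha R d p0) {a. \<not> x \<le> real a} \<le>
    measure_pmf.prob (alpha R d p0) {a. \<not> 1 / 4 * (p0 * real q ^ d) \<le> real a}"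
    by (intro measure_pmf.finite_measure_mono) auto
  hence 2: "measure_pmf.prob (alpha R d p0) {a. \<not> x \<le> real a} \<le> 8 / l" using 1 by linarith
  have c: "measure_pmf.prob (alpha R d p') {a. \<not> x \<le> real a} =
    1 - measure_pmf.prob (alpha R d p') {a. x \<le> real a}" for p'
    using measure_pmf.prob_compl[of "{a. x \<le> real a}" "alpha R d p'"]
    by (simp add: Compl_eq_Diff_UNIV[symmetric] Collect_neg_eq)
  have "measure_pmf.prob (alpha R d p) {a. \<not> x \<le> real a} \<le> measure_pmf.prob (alpha R d p0) {a. \<not> x \<le> real a}"
    unfolding c using prob_alpha_ge_mono[OF d1 p01 p(1), of x] by simp
  thus ?thesis using 2 by (simp add: x_def)
qed

lemma prob_alpha_lt_linear:
  assumes p: "p \<le> 1" "l \<le> p * real q"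
  shows "measure_pmf.prob (alpha R d p) {a. \<not> 1 / 4 * (p * real q) \<le> real a} \<le> 8 / l"
proof -
  have p0: "p > 0" using p l_pos q_ge_2 by (smt (verit) mult_nonpos_nonneg of_nat_0_le_iff)
  have "4 / (p * real q) \<le> 8 / l" using p l_pos by (intro frac_le) auto
  moreover have "measure_pmf.prob (alpha R d p) {a. real a < p * real q / 4} \<le> 4 / (p * real q)"
    using prob_alpha_lt_moment_curve[OF _ p0 p(1)] d3 by simp
  ultimately have "measure_pmf.prob (alpha R d p) {a. real a < p * real q / 4} \<le> 8 / l" by linarith
  thus ?thesis by (simp add: not_le mult.commute)
qed

text \<open>Ten inequalities, each with failure probability at most \<open>8 / l\<close>. The
  right-hand side is bracketed like the conjunction, so that \<open>prob_not_conj_le\<close> assigns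
  one summand to each.\<close>

lemma prob_alpha_bounds:
  assumes p: "0 \<le> p" "p \<le> 1"
  shows "measure_pmf.prob (alpha R d p) {a. \<not> (
    (real q powr (- real d) * l \<le> p \<and> p \<le> real q powr (- real d + 1 / real d) / l \<longrightarrow>
       1 / 4 * (p * real q ^ d) \<le> real a \<and> real a \<le> 8 * exp 3 * (p * real q ^ d)) \<and>
    (real q powr (- real d + 1 / real d) / l \<le> p \<and> p \<le> real q powr (- real d + 2 / real d) \<longrightarrow>
       real q powr (1 / real d) / l ^ 3 \<le> real a \<and> real a \<le> real q powr (1 / real d) * l ^ 3) \<and>
    (real q powr (- 1 / (real d + 1)) \<le> p \<and> p \<le> 1 \<longrightarrow>
       1 / 4 * (p * real q) \<le> real a \<and> real a \<le> 8 * exp 3 * (p * real q)) \<and>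
    (real q powr (- real d + 2 / real d) \<le> p \<and> p \<le> real q powr (- 1 / (real d + 1)) \<longrightarrow>
       (real q powr (1 / real d) / l ^ 3 \<le> real a \<and> 1 / 4 * (p * real q) \<le> real a) \<and>
       (real a \<le> p powr (1 / 2) * (real q powr (real d / 2) * l ^ 3) \<and>
        real a \<le> real q powr (real d / (real d + 1)) * l ^ 3)))} \<le>
    (8 / l + 8 / l) + ((8 / l + 8 / l) + ((8 / l + 8 / l) + ((8 / l + 8 / l) + (8 / l + 8 / l))))"
proof (intro prob_not_conj_le prob_not_imp_le)
  have q2: "real q \<ge> 2" using q_ge_2 by simp
  have d1: "d \<ge> 1" using d3 by simp
  have dr: "real d \<ge> 3" using d3 by simp
  have l1: "l \<ge> 1" using threshold_bounds(6) by simp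
  have l8: "0 \<le> 8 / l" using l_pos by simp
  have q34: "real q powr (3 / 4) \<le> real q powr (real d / (real d + 1))"
    using q2 dr by (intro powr_mono) (auto simp: field_simps)
  have q34': "real q powr (3 / 4) \<ge> l"
  proof -
    have "l ^ 1 \<le> l ^ 6" by (rule l_power_mono) simp
    also note fourth_root_ge
    also have "real q powr (1 / 4) \<le> real q powr (3 / 4)" using q2 by (intro powr_mono) auto
    finally show ?thesis by simp
  qed
  \<comment> \<open>This is the value of \<open>p q\<close> where the third and the fourth range
    meet.\<close>
  have split: "real q powr (real d / (real d + 1)) = real q powr (- 1 / (real d + 1)) * real q"
  proof -
    have "real d / (real d + 1) = - 1 / (real d + 1) + 1" using dr by (simp add: field_simps)
    moreover have "real q powr (- 1 / (real d + 1) + 1) = real q powr (- 1 / (real d + 1)) * real q powr 1"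
      by (rule powr_add)
    ultimately show ?thesis using q2 by (simp only: powr_one)
  qed
  have lo: "real q powr (- real d + 1 / real d) / l \<le> real q powr (- real d + 2 / real d)"
  proof -
    have "real q powr (- real d + 1 / real d) / l \<le> real q powr (- real d + 1 / real d) / 1"
      using l1 by (intro divide_left_mono) auto
    also have "\<dots> \<le> real q powr (- real d + 2 / real d)"
      using q2 dr by (simp add: divide_right_mono)
    finally show ?thesis .
  qed
  \<comment> \<open>Every \<open>x\<close> to which \<open>prob_alpha_gt_quadratic\<close> is
    applied below is at most this one. The side condition holds because
    \<open>d / 2 + 1 / 4 \<le> d - 1\<close> for \<open>d \<ge> 3\<close>.\<close>
  have half: "real q powr (real d / 2) * l ^ 3 + 1 \<le> real q ^ (d - 1)"
  proof -
    have "real q powr (real d / 2) \<ge> 1" using q2 by (intro ge_one_powr_ge_zero) auto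
    moreover have "l ^ 3 \<ge> 1" using l1 by (rule one_le_power)
    ultimately have "1 \<le> real q powr (real d / 2) * l ^ 3"
      using mult_mono[of 1 "real q powr (real d / 2)" 1 "l ^ 3"] by simp
    hence "real q powr (real d / 2) * l ^ 3 + 1 \<le> real q powr (real d / 2) * (2 * l ^ 3)" by linarith
    also have "\<dots> \<le> real q powr (real d / 2) * real q powr (1 / 4)"
    proof (rule mult_left_mono)
      have "2 * l ^ 3 \<le> l * l ^ 3" using threshold_bounds(6) by (intro mult_right_mono) auto
      also have "\<dots> = l ^ 4" by (simp add: eval_nat_numeral)
      also have "\<dots> \<le> l ^ 6" by (rule l_power_mono) simp
      finally show "2 * l ^ 3 \<le> real q powr (1 / 4)" using fourth_root_ge by linarith
    qed simp
    also have "\<dots> = real q powr (real d / 2 + 1 / 4)" by (simp add: powr_add)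
    also have "\<dots> \<le> real q powr (real (d - 1))"
      using q2 d3 by (intro powr_mono) (auto simp: of_nat_diff field_simps)
    also have "\<dots> = real q ^ (d - 1)" using q2 by (simp add: powr_realpow)
    finally show ?thesis .
  qed
  show "0 \<le> 8 / l + 8 / l" "0 \<le> 8 / l + 8 / l" "0 \<le> 8 / l + 8 / l"
    "0 \<le> (8 / l + 8 / l) + (8 / l + 8 / l)" using l8 by auto
  {
    assume H: "real q powr (- real d) * l \<le> p \<and> p \<le> real q powr (- real d + 1 / real d) / l"
    show "measure_pmf.prob (alpha R d p) {a. \<not> 1 / 4 * (p * real q ^ d) \<le> real a} \<le> 8 / l"
      by (rule prob_alpha_lt_sparse) (use H p in auto)
    have "0 < real q powr (- real d) * l" using q2 l_pos by simp
    hence p0: "p > 0" using H by linarith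
    have "real q powr (- real d) * l * real q ^ d \<le> p * real q ^ d" using H by (intro mult_right_mono) auto
    hence \<mu>: "l \<le> p * real q ^ d" using q2 by (simp add: powr_minus powr_realpow field_simps)
    \<comment> \<open>The constant \<open>8 * exp 3\<close> is dictated by the range of order
      \<open>p q\<close>; in the sparse range 2 would suffice.\<close>
    have "2 * (p * real q ^ d) \<le> 8 * exp 3 * (p * real q ^ d)"
      using p0 exp_ge_add_one_self[of "3 :: real"] by (intro mult_right_mono) auto
    hence "2 * (p * real q ^ d) < real a" if "\<not> real a \<le> 8 * exp 3 * (p * real q ^ d)" for a :: nat
      using that by linarith
    hence "{a. \<not> real a \<le> 8 * exp 3 * (p * real q ^ d)} \<subseteq> {a. real a > 2 * (p * real q ^ d)}"
      by blast
    hence "measure_pmf.prob (alpha R d p) {a. \<not> real a \<le> 8 * exp 3 * (p * real q ^ d)} \<le>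
       measure_pmf.prob (alpha R d p) {a. real a > 2 * (p * real q ^ d)}"
      by (rule measure_pmf.finite_measure_mono) simp
    also have "\<dots> \<le> 4 / (p * real q ^ d)" by (rule prob_alpha_gt_card[OF d1 p0 p(2)])
    also have "\<dots> \<le> 8 / l" using \<mu> l_pos by (intro frac_le) auto
    finally show "measure_pmf.prob (alpha R d p) {a. \<not> real a \<le> 8 * exp 3 * (p * real q ^ d)} \<le> 8 / l" .
  }
  {
    assume H: "real q powr (- real d + 1 / real d) / l \<le> p \<and> p \<le> real q powr (- real d + 2 / real d)"
    show "measure_pmf.prob (alpha R d p) {a. \<not> real q powr (1 / real d) / l ^ 3 \<le> real a} \<le> 8 / l"
      by (rule prob_alpha_lt_root) (use H p in auto)
    show "measure_pmf.prob (alpha R d p) {a. \<not> real a \<le> real q powr (1 / real d) * l ^ 3} \<le> 8 / l"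
    proof (rule prob_alpha_gt_quadratic[OF order_refl _ p])
      have "real q powr (1 / real d) * l ^ 3 \<le> real q powr (real d / 2) * l ^ 3"
      proof (intro mult_right_mono powr_mono)
        have "2 \<le> real d * real d" using mult_mono[of 2 "real d" 1 "real d"] dr by simp
        thus "1 / real d \<le> real d / 2" using dr by (simp add: field_simps)
      qed (use q2 l_pos in auto)
      thus "real q powr (1 / real d) * l ^ 3 + 1 \<le> real q ^ (d - 1)" using half by linarith
      have "p * real q ^ d \<le> real q powr (- real d + 2 / real d) * real q ^ d"
        using H by (intro mult_right_mono) auto
      also have "\<dots> = (real q powr (1 / real d))\<^sup>2"
      proof -
        have "real q ^ d = real q powr real d" using q2 by (simp add: powr_realpow)
        hence "real q powr (- real d + 2 / real d) * real q ^ d = real q powr (- real d + 2 / real d + real d)"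
          by (simp only: powr_add)
        also have "\<dots> = real q powr (1 / real d + 1 / real d)" by simp
        also have "\<dots> = (real q powr (1 / real d))\<^sup>2" unfolding powr_add power2_eq_square ..
        finally show ?thesis .
      qed
      finally have "p * real q ^ d * l ^ 6 \<le> (real q powr (1 / real d))\<^sup>2 * l ^ 6"
        using l_pos by (intro mult_right_mono) auto
      thus "p * real q ^ d * l ^ 6 \<le> (real q powr (1 / real d) * l ^ 3)\<^sup>2"
        by (simp add: power_mult_distrib flip: power_mult)
    qed
  }
  {
    assume H: "real q powr (- 1 / (real d + 1)) \<le> p \<and> p \<le> 1"
    have "real q powr (real d / (real d + 1)) \<le> p * real q"
      unfolding split using H by (intro mult_right_mono) auto
    hence pq: "real q powr (3 / 4) \<le> p * real q" using q34 by linarith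
    show "measure_pmf.prob (alpha R d p) {a. \<not> 1 / 4 * (p * real q) \<le> real a} \<le> 8 / l"
      by (rule prob_alpha_lt_linear) (use H pq q34' in auto)
    have "1 * (p * real q) \<le> 8 * exp 3 * (p * real q)"
      using p exp_ge_add_one_self[of "3 :: real"] by (intro mult_right_mono) auto
    hence "real q powr (3 / 4) \<le> 8 * exp 3 * (p * real q)" using pq by linarith
    thus "measure_pmf.prob (alpha R d p) {a. \<not> real a \<le> 8 * exp 3 * (p * real q)} \<le> 8 / l"
      by (rule prob_alpha_gt_linear[OF _ p]) (simp add: mult_ac)
  }
  {
    assume H: "real q powr (- real d + 2 / real d) \<le> p \<and> p \<le> real q powr (- 1 / (real d + 1))"
    have "0 < real q powr (- real d + 2 / real d)" using q2 by simp
    hence p0: "p > 0" using H by linarith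
    show root: "measure_pmf.prob (alpha R d p) {a. \<not> real q powr (1 / real d) / l ^ 3 \<le> real a} \<le> 8 / l"
      by (rule prob_alpha_lt_root[OF p(2)]) (use H lo in linarith)
    show "measure_pmf.prob (alpha R d p) {a. \<not> 1 / 4 * (p * real q) \<le> real a} \<le> 8 / l"
    proof (cases "l \<le> p * real q")
      case True
      thus ?thesis by (rule prob_alpha_lt_linear[OF p(2)])
    next
      \<comment> \<open>Below the scale at which the moment curve concentrates, the root bound is
        already stronger, because \<open>l ^ 4\<close> is at most the \<open>d\<close>-th root of
        \<open>q\<close>.\<close>
      case False
      have "l * l ^ 3 \<le> real q powr (1 / real d)" using root_ge by (simp add: eval_nat_numeral)
      hence "l \<le> real q powr (1 / real d) / l ^ 3" using l_pos by (simp add: le_divide_eq)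
      hence "1 / 4 * (p * real q) \<le> real q powr (1 / real d) / l ^ 3" using False l_pos by linarith
      hence "{a. \<not> 1 / 4 * (p * real q) \<le> real a} \<subseteq> {a. \<not> real q powr (1 / real d) / l ^ 3 \<le> real a}"
        by (meson Collect_mono order_trans)
      hence "measure_pmf.prob (alpha R d p) {a. \<not> 1 / 4 * (p * real q) \<le> real a} \<le>
        measure_pmf.prob (alpha R d p) {a. \<not> real q powr (1 / real d) / l ^ 3 \<le> real a}"
        by (rule measure_pmf.finite_measure_mono) simp
      thus ?thesis using root by linarith
    qed
    show "measure_pmf.prob (alpha R d p) {a. \<not> real a \<le> p powr (1 / 2) * (real q powr (real d / 2) * l ^ 3)} \<le> 8 / l"
    proof (rule prob_alpha_gt_quadratic[OF _ _ p])
      \<comment> \<open>At the lower end of the range, the square root of \<open>p\<close> times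
        \<open>q powr (d / 2)\<close> is the \<open>d\<close>-th root of \<open>q\<close>; larger
        \<open>p\<close> only increase it.\<close>
      have "real q powr (1 / real d) = (real q powr (- real d + 2 / real d)) powr (1 / 2) * real q powr (real d / 2)"
      proof -
        have "1 / real d = (- real d + 2 / real d) * (1 / 2) + real d / 2" by (simp add: field_simps)
        thus ?thesis by (metis powr_add powr_powr)
      qed
      also have "\<dots> \<le> p powr (1 / 2) * real q powr (real d / 2)"
        using H by (intro mult_right_mono powr_mono2) auto
      finally have "real q powr (1 / real d) * l ^ 3 \<le> p powr (1 / 2) * real q powr (real d / 2) * l ^ 3"
        using l_pos by (intro mult_right_mono) auto
      thus "real q powr (1 / real d) * l ^ 3 \<le> p powr (1 / 2) * (real q powr (real d / 2) * l ^ 3)"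
        by (simp only: mult.assoc)
      have "p powr (1 / 2) \<le> 1" using p0 p by (simp add: powr_le1)
      hence "p powr (1 / 2) * (real q powr (real d / 2) * l ^ 3) \<le> 1 * (real q powr (real d / 2) * l ^ 3)"
        using l_pos by (intro mult_right_mono) auto
      thus "p powr (1 / 2) * (real q powr (real d / 2) * l ^ 3) + 1 \<le> real q ^ (d - 1)" using half by linarith
      have "(p powr (1 / 2))\<^sup>2 = p" using p0 by (simp add: powr_power)
      moreover have "(real q powr (real d / 2))\<^sup>2 = real q ^ d"
        using q2 by (simp add: powr_power powr_realpow)
      ultimately show "p * real q ^ d * l ^ 6 \<le> (p powr (1 / 2) * (real q powr (real d / 2) * l ^ 3))\<^sup>2"
        by (simp add: power_mult_distrib flip: power_mult)
    qed
    show "measure_pmf.prob (alpha R d p) {a. \<not> real a \<le> real q powr (real d / (real d + 1)) * l ^ 3} \<le> 8 / l"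
    proof (rule prob_alpha_gt_linear[OF _ p])
      have "real q powr (real d / (real d + 1)) * 1 \<le> real q powr (real d / (real d + 1)) * l ^ 3"
        using l1 by (intro mult_left_mono) (auto simp: one_le_power)
      thus "real q powr (3 / 4) \<le> real q powr (real d / (real d + 1)) * l ^ 3" using q34 by linarith
      have "l ^ 1 \<le> l ^ 3" by (rule l_power_mono) simp
      hence "8 * exp 3 \<le> l ^ 3" using threshold_bounds(4) by simp
      moreover have "p * real q \<le> real q powr (real d / (real d + 1))"
        unfolding split using H by (intro mult_right_mono) auto
      ultimately have "8 * exp 3 * (p * real q) \<le> l ^ 3 * real q powr (real d / (real d + 1))"
        using p l_pos by (intro mult_mono) auto
      thus "8 * exp 3 * real q * p \<le> real q powr (real d / (real d + 1)) * l ^ 3" by (simp add: mult_ac)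
    qed
  }
qed

end

end

text \<open>For this exponent the power of \<open>q\<close> is exactly \<open>ln q powr K\<close>,
  so any fixed power of \<open>ln q\<close> can be written as \<open>q\<close> to the power
  \<open>o(1)\<close>. The absolute value in \<open>big\<close> lets one estimate cover both
  signs.\<close>

lemma polylog_exponent_ln_ln: "polylog_exponent (\<lambda>q. K * (ln (ln (real q)) / ln (real q)))"
proof -
  have le: "prime_powers \<le> at_top" unfolding prime_powers_def by simp
  have big: "(\<lambda>q. real q powr (c * (ln (ln (real q)) / ln (real q)))) \<in>
      O[prime_powers](\<lambda>q. ln (real q) powr \<bar>c\<bar>)" for c
  proof (rule landau_o.big.filter_mono[OF le], rule landau_o.big_mono,
      rule eventually_mono[OF eventually_gt_at_top[of 3]])
    fix q :: nat assume q: "3 < q"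
    have "exp 1 < real q" using exp_le q by linarith
    hence l: "ln (real q) > 1" using ln_less_cancel_iff[of "exp 1" "real q"] q by simp
    have "real q powr (c * (ln (ln (real q)) / ln (real q))) = ln (real q) powr c"
      using l q by (simp add: powr_def)
    also have "\<dots> \<le> ln (real q) powr \<bar>c\<bar>" using l by (intro powr_mono) auto
    finally show "norm (real q powr (c * (ln (ln (real q)) / ln (real q)))) \<le> norm (ln (real q) powr \<bar>c\<bar>)"
      by simp
  qed
  have "(\<lambda>q. K * (ln (ln (real q)) / ln (real q))) \<in> o[at_top](\<lambda>_. 1)" by real_asymp
  hence "(\<lambda>q. K * (ln (ln (real q)) / ln (real q))) \<in> o[prime_powers](\<lambda>_. 1)"
    by (rule landau_o.small.filter_mono[OF le])
  thus ?thesis unfolding polylog_exponent_def using big[of K] big[of "- K"] by auto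
qed

text \<open>All exponents and both constants are fixed before \<open>p\<close>; this is possible
  because the failure probability bound \<open>80 / ln q\<close> does not depend on
  \<open>p\<close>.\<close>

theorem theorem1p2:
  fixes F :: "nat \<Rightarrow> ('a, 'b) ring_scheme" and d :: nat
  assumes "d \<ge> 3"
    and "\<And>q. primepow q \<Longrightarrow> field (F q) \<and> card (carrier (F q)) = q"
  shows "\<exists>t1 t2 t3 t4 e1 e2 e3 e4 :: nat \<Rightarrow> real. \<exists>c C :: real.
    (\<forall>e \<in> {t1, t2, t3, t4, e1, e2, e3, e4}. polylog_exponent e) \<and> 0 < c \<and> 0 < C \<and>
    (\<forall>p :: nat \<Rightarrow> real. (\<forall>q. primepow q \<longrightarrow> 0 \<le> p q \<and> p q \<le> 1) \<longrightarrow>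
      asymptotically_almost_surely (\<lambda>q. alpha (F q) d (p q)) (\<lambda>q \<alpha>.
        (real q powr (- real d + t1 q) \<le> p q \<and> p q \<le> real q powr (- real d + 1 / real d - t2 q) \<longrightarrow>
           c * (p q * real q ^ d) \<le> real \<alpha> \<and> real \<alpha> \<le> C * (p q * real q ^ d)) \<and>
        (real q powr (- real d + 1 / real d - t2 q) \<le> p q \<and> p q \<le> real q powr (- real d + 2 / real d + t3 q) \<longrightarrow>
           real q powr (1 / real d - e1 q) \<le> real \<alpha> \<and> real \<alpha> \<le> real q powr (1 / real d + e1 q)) \<and>
        (real q powr (- 1 / (real d + 1) + t4 q) \<le> p q \<and> p q \<le> 1 \<longrightarrow>
           c * (p q * real q) \<le> real \<alpha> \<and> real \<alpha> \<le> C * (p q * real q)) \<and>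
        (real q powr (- real d + 2 / real d + t3 q) \<le> p q \<and> p q \<le> real q powr (- 1 / (real d + 1) + t4 q) \<longrightarrow>
           max (real q powr (1 / real d - e2 q)) (c * (p q * real q)) \<le> real \<alpha> \<and>
           real \<alpha> \<le> min (p q powr (1 / 2) * real q powr (real d / 2 + e3 q))
                         (real q powr (real d / (real d + 1) + e4 q)))))"
proof -
  \<comment> \<open>Chosen so that \<open>q powr \<epsilon> q = ln q\<close>.\<close>
  define \<epsilon> :: "nat \<Rightarrow> real" where "\<epsilon> q = ln (ln (real q)) / ln (real q)" for q
  define \<epsilon>3 :: "nat \<Rightarrow> real" where "\<epsilon>3 q = 3 * \<epsilon> q" for q
  \<comment> \<open>For the two upper thresholds, which carry no logarithmic factor.\<close>
  define \<epsilon>0 :: "nat \<Rightarrow> real" where "\<epsilon>0 q = 0" for q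
  have poly: "polylog_exponent \<epsilon>" "polylog_exponent \<epsilon>3" "polylog_exponent \<epsilon>0"
    using polylog_exponent_ln_ln[of 1] polylog_exponent_ln_ln[of 3] polylog_exponent_ln_ln[of 0]
    by (simp_all add: \<epsilon>_def[abs_def] \<epsilon>3_def[abs_def] \<epsilon>0_def[abs_def])
  let ?E = "\<lambda>p q a. 
        (real q powr (- real d + \<epsilon> q) \<le> p q \<and> p q \<le> real q powr (- real d + 1 / real d - \<epsilon> q) \<longrightarrow>
           1 / 4 * (p q * real q ^ d) \<le> real a \<and> real a \<le> 8 * exp 3 * (p q * real q ^ d)) \<and>
        (real q powr (- real d + 1 / real d - \<epsilon> q) \<le> p q \<and> p q \<le> real q powr (- real d + 2 / real d + \<epsilon>0 q) \<longrightarrow>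
           real q powr (1 / real d - \<epsilon>3 q) \<le> real a \<and> real a \<le> real q powr (1 / real d + \<epsilon>3 q)) \<and>
        (real q powr (- 1 / (real d + 1) + \<epsilon>0 q) \<le> p q \<and> p q \<le> 1 \<longrightarrow>
           1 / 4 * (p q * real q) \<le> real a \<and> real a \<le> 8 * exp 3 * (p q * real q)) \<and>
        (real q powr (- real d + 2 / real d + \<epsilon>0 q) \<le> p q \<and> p q \<le> real q powr (- 1 / (real d + 1) + \<epsilon>0 q) \<longrightarrow>
           max (real q powr (1 / real d - \<epsilon>3 q)) (1 / 4 * (p q * real q)) \<le> real a \<and>
           real a \<le> min (p q powr (1 / 2) * real q powr (real d / 2 + \<epsilon>3 q))
                         (real q powr (real d / (real d + 1) + \<epsilon>3 q)))"
  have main: "asymptotically_almost_surely (\<lambda>q. alpha (F q) d (p q)) (?E p)"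
    if p: "\<forall>q. primepow q \<longrightarrow> 0 \<le> p q \<and> p q \<le> 1" for p :: "nat \<Rightarrow> real"
  proof -
    have d0: "1 / real d > 0" using assms(1) by simp
    have "eventually (\<lambda>q. ln (real q) \<ge> log_threshold d) at_top" by real_asymp
    moreover have "eventually (\<lambda>q. ln (real q) ^ 4 \<le> real q powr (1 / real d)) at_top"
      using d0 by real_asymp
    moreover have "eventually (\<lambda>q. ln (real q) ^ 6 \<le> real q powr (1 / 4)) at_top"
      by real_asymp
    \<comment> \<open>The premise restricts the claim to prime powers, where \<open>F q\<close> is
      known to be a field; on the filter \<open>prime_powers\<close> it is discharged.\<close>
    ultimately have ev: "eventually (\<lambda>q. primepow q \<longrightarrow>
      1 - 80 / ln (real q) \<le> measure_pmf.prob (alpha (F q) d (p q)) {a. ?E p q a}) at_top"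
    proof eventually_elim
      case (elim q)
      show ?case
      proof
        assume q: "primepow q"
        have F: "field (F q)" "card (carrier (F q)) = q" using assms(2)[OF q] by auto
        have q0: "q > 0" using q by (rule primepow_gt_0_nat)
        interpret A: finite_affine_space "F q" d
        proof (intro finite_affine_space.intro finite_affine_space_axioms.intro F)
          show "finite (carrier (F q))" using F q0 by (intro card_ge_0_finite) simp
        qed
        let ?l = "ln (real q)"
        have l0: "?l > 0" using A.l_pos F by simp
        have pw: "real q powr (x + \<epsilon> q) = real q powr x * ?l" "real q powr (x - \<epsilon> q) = real q powr x / ?l"
          "real q powr (x + \<epsilon>3 q) = real q powr x * ?l ^ 3" "real q powr (x - \<epsilon>3 q) = real q powr x / ?l ^ 3" for x
        proof -
          have "real q powr \<epsilon> q = ?l" using l0 q0 by (simp add: powr_def \<epsilon>_def)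
          moreover have "real q powr \<epsilon>3 q = ?l powr 3" using l0 q0 by (simp add: powr_def \<epsilon>_def \<epsilon>3_def)
          hence "real q powr \<epsilon>3 q = ?l ^ 3" using l0 by simp
          ultimately show "real q powr (x + \<epsilon> q) = real q powr x * ?l"
            "real q powr (x - \<epsilon> q) = real q powr x / ?l"
            "real q powr (x + \<epsilon>3 q) = real q powr x * ?l ^ 3"
            "real q powr (x - \<epsilon>3 q) = real q powr x / ?l ^ 3"
            by (simp_all add: powr_add powr_diff)
        qed
        have "measure_pmf.prob (alpha (F q) d (p q)) {a. \<not> ?E p q a} \<le>
          (8 / ?l + 8 / ?l) + ((8 / ?l + 8 / ?l) + ((8 / ?l + 8 / ?l) + ((8 / ?l + 8 / ?l) + (8 / ?l + 8 / ?l))))"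
          using A.prob_alpha_bounds[of "p q", unfolded F(2)] assms(1) elim p q
          unfolding pw \<epsilon>0_def max.bounded_iff min.bounded_iff add_0_right by blast
        hence "measure_pmf.prob (alpha (F q) d (p q)) {a. \<not> ?E p q a} \<le> 80 / ?l" by simp
        moreover have "measure_pmf.prob (alpha (F q) d (p q)) {a. \<not> ?E p q a} =
          1 - measure_pmf.prob (alpha (F q) d (p q)) {a. ?E p q a}"
          unfolding Collect_neg_eq Compl_eq_Diff_UNIV
          using measure_pmf.prob_compl[of "{a. ?E p q a}" "alpha (F q) d (p q)"] by simp
        ultimately show "1 - 80 / ?l \<le> measure_pmf.prob (alpha (F q) d (p q)) {a. ?E p q a}" by linarith
      qed
    qed
    have le: "prime_powers \<le> at_top" unfolding prime_powers_def by simp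
    have "((\<lambda>q. 1 - 80 / ln (real q)) \<longlongrightarrow> 1) at_top" by real_asymp
    hence lim: "((\<lambda>q. 1 - 80 / ln (real q)) \<longlongrightarrow> 1) prime_powers" by (rule tendsto_mono[OF le])
    show ?thesis
      unfolding asymptotically_almost_surely_def
    proof (rule tendsto_sandwich[OF _ _ lim tendsto_const])
      show "eventually (\<lambda>q. 1 - 80 / ln (real q) \<le>
          measure_pmf.prob (alpha (F q) d (p q)) {a. ?E p q a}) prime_powers"
        unfolding prime_powers_def eventually_inf_principal using ev by simp
      show "eventually (\<lambda>q. measure_pmf.prob (alpha (F q) d (p q)) {a. ?E p q a} \<le> 1) prime_powers"
        by (intro always_eventually allI measure_pmf.prob_le_1)
    qed
  qed
  show ?thesis
    by (rule exI[of _ \<epsilon>], rule exI[of _ \<epsilon>], rule exI[of _ \<epsilon>0], rule exI[of _ \<epsilon>0],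
        rule exI[of _ \<epsilon>3], rule exI[of _ \<epsilon>3], rule exI[of _ \<epsilon>3], rule exI[of _ \<epsilon>3],
        rule exI[of _ "1 / 4"], rule exI[of _ "8 * exp 3"], intro conjI allI impI main)
      (use poly in auto)
qed

end
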